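(* Let $d\ge3$ be a fixed integer. Let $p=p_n\in(0,1)$ be such that $p=o(1)$ and $\log^4 n=o(np^2)$ as $n\to+\infty$. Denote $v_n=n^2p^2\log(1/p)$. Let $X$ be the adjacency matrix of an Erdős–Rényi graph on $n$ vertices with parameter $p$. For any $t\ge1$, as $n\to+\infty$, $$\log\mathbb{P}\big(\mathrm{tr}(X^d)\ge t\,n^dp^d\big)\le-\phi_n(t)+o(v_n),$$ where $$\phi_n(t)=\inf\big\{\Lambda_p^*(Y):\ \mathrm{tr}(Y^d)\ge t(np)^d,\ Y\in\mathcal{H}_n^0\big\}.$$
   Context: $X$ is the random symmetric $n\times n$ matrix such that $(X_{i,j})_{i<j}$ are independent Bernoulli random variables of parameter $p$ and $X_{i,i}=0$ for all $i$. $\mathcal{H}_n^0$ is the set of real symmetric $n\times n$ matrices with null diagonal coefficients. $\Lambda_p^*(Y)=\sum_{i<j}I_p(Y_{i,j})$, where $I_p(x)=x\log\frac xp+(1-x)\log\frac{1-x}{1-p}$ for $x\in[0,1]$ (with $0\log0=0$) and $I_p(x)=+\infty$ otherwise. Convention: $\inf\emptyset=+\infty$. *)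

theory Defs
  imports
    "HOL-Probability.Probability"
    "HOL-Library.Landau_Symbols"
    "Jordan_Normal_Form.Matrix"
begin

definition mat_trace :: "real mat \<Rightarrow> real" where
  "mat_trace A = (\<Sum>i<dim_row A. A $$ (i, i))"

definition sym_mats0 :: "nat \<Rightarrow> real mat set" where
  "sym_mats0 n = {Y \<in> carrier_mat n n. transpose_mat Y = Y \<and> (\<forall>i<n. Y $$ (i, i) = 0)}"

definition index_pairs :: "nat \<Rightarrow> (nat \<times> nat) set" where
  "index_pairs n = {(i, j). i < j \<and> j < n}"

text \<open>Only the joint law of the entries above the diagonal is prescribed; the remaining entries
  are determined by symmetry and the null diagonal.\<close>
definition erdos_renyi_adjacency ::
    "'a measure \<Rightarrow> nat \<Rightarrow> real \<Rightarrow> ('a \<Rightarrow> real mat) \<Rightarrow> bool" where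
  "erdos_renyi_adjacency M n p X \<longleftrightarrow>
     prob_space M \<and>
     (\<forall>\<omega>\<in>space M. X \<omega> \<in> sym_mats0 n) \<and>
     prob_space.indep_vars M (\<lambda>_. borel) (\<lambda>ij \<omega>. X \<omega> $$ ij) (index_pairs n) \<and>
     (\<forall>ij\<in>index_pairs n.
        distr M borel (\<lambda>\<omega>. X \<omega> $$ ij) =
        distr (measure_pmf (bernoulli_pmf p)) borel (of_bool :: bool \<Rightarrow> real))"

text \<open>The convention \<open>0 * log 0 = 0\<close> is respected at \<open>x = 0\<close> and at \<open>x = 1\<close>, since the
  vanishing factor multiplies a real number.\<close>
definition rate_I :: "real \<Rightarrow> real \<Rightarrow> ereal" where
  "rate_I p x =
     (if 0 \<le> x \<and> x \<le> 1
      then ereal (x * ln (x / p) + (1 - x) * ln ((1 - x) / (1 - p)))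
      else \<infinity>)"

definition Lambda_star :: "nat \<Rightarrow> real \<Rightarrow> real mat \<Rightarrow> ereal" where
  "Lambda_star n p Y = (\<Sum>ij\<in>index_pairs n. rate_I p (Y $$ ij))"

text \<open>The infimum is taken in the extended reals, where \<open>Inf {} = \<infinity>\<close>.\<close>
definition phi :: "nat \<Rightarrow> nat \<Rightarrow> real \<Rightarrow> real \<Rightarrow> ereal" where
  "phi d n p t =
     (INF Y \<in> {Y \<in> sym_mats0 n. mat_trace (Y ^\<^sub>m d) \<ge> t * (real n * p) ^ d}. Lambda_star n p Y)"

text \<open>Extended logarithm, with value \<open>-\<infinity>\<close> at \<open>0\<close>; it is only meant for arguments \<open>x \<ge> 0\<close>.\<close>
definition log_prob :: "real \<Rightarrow> ereal" where
  "log_prob x = (if x = 0 then -\<infinity> else ereal (ln x))"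

end

theory Submission
  imports Defs "HOL-Library.Function_Algebras"
begin

text \<open>
  Conditioning the product law on a set \<open>\<A>\<close> of graphs and computing relative entropies gives
  \<open>P(\<A>) \<le> exp (- \<Lambda>\<^sub>p\<^sup>*(Y))\<close>, with \<open>Y\<close> the conditional mean of the adjacency matrix. So it suffices to
  cover the graphs, up to probability \<open>exp (- K v\<^sub>n)\<close>, by \<open>exp (o(v\<^sub>n))\<close> cells on which the trace is
  within \<open>o(n\<^sup>dp\<^sup>d)\<close> of its value at the mean of the cell.

  The cells are balls of radius \<open>o(n p)\<close> in the Schatten 4-norm. By Talagrand's inequality,
  \<open>X - E X\<close> is, up to probability \<open>exp (- K v\<^sub>n)\<close>, the sum of a matrix with Schatten 4-norm of
  the typical order \<open>(n\<^sup>3p\<^sup>2)\<^bsup>1/4\<^esup>\<close> and of a matrix with Frobenius norm \<open>O(\<surd>v\<^sub>n)\<close>; the latter is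
  well approximated in Schatten 4-norm by matrices of small rank, which have a small net.

  For \<open>d \<ge> 4\<close> the trace is continuous in Schatten 4-norm. For \<open>d = 3\<close> the cubic remainder
  \<open>tr (X - Y)\<^sup>3\<close> is left over; restricted to a random bipartition of the vertices it is linear in the
  edges inside one part, given the other edges, so that Hoeffding's inequality applies.

  Finally \<open>\<phi>\<^sub>n\<close> is continuous at scale \<open>v\<^sub>n\<close>: planting a clique of size \<open>\<gamma> n p\<close> on a block where \<open>Y\<close> is
  small costs \<open>O(\<gamma>\<^sup>2 v\<^sub>n)\<close> and increases the trace by about \<open>(\<gamma> n p)\<^sup>d\<close>.
\<close>

section \<open>Matrix norms\<close>

text \<open>The Frobenius norm of \<open>X\<close> is of order n sqrt p, far above the scale n p of
  the trace, so closeness in that norm is out of reach. The Schatten 4-norm of the noise is of order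
  (n^3 p^2)^(1/4), which is o(n p) once n p^2 tends to infinity, and it still bounds the Frobenius
  norm of a product of two factors. Bounding the norm of \<open>X - E X\<close> would not be enough:
  an event of cost v_n may move it by sqrt v_n = n p sqrt L with L = log (1/p), more than n p, so
  the deviation must be located by a net and not just measured. This is why Talagrand's inequality
  is stated so as to produce a nearby point of a convex set. Cells are convex so that they contain
  their conditional mean. A mean of rate O(v_n), unlike \<open>X\<close>, has Frobenius norm O(n p),
  because x^2 log (1/p) <= 4 I_p(x) + 81 p^2 log (1/p); the expansion for d = 3 and the choice of a
  light block for the clique both rest on this. All probabilities before the transfer to random
  matrices are finite sums over edge sets.\<close>

type_synonym fmat = "nat \<Rightarrow> nat \<Rightarrow> real"

text \<open>The size is an argument of the operations and not part of the matrix, so sums and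
  differences are the pointwise ones of functions and no dimension conditions arise. Traces and
  norms of size \<open>n\<close> never read an entry with an index at least
  \<open>n\<close>.\<close>

definition mmul :: "nat \<Rightarrow> fmat \<Rightarrow> fmat \<Rightarrow> fmat" where
  "mmul n A B = (\<lambda>i j. \<Sum>k<n. A i k * B k j)"

definition mtr :: "nat \<Rightarrow> fmat \<Rightarrow> real" where
  "mtr n A = (\<Sum>i<n. A i i)"

definition tp :: "fmat \<Rightarrow> fmat" where
  "tp A = (\<lambda>i j. A j i)"

definition finner :: "nat \<Rightarrow> fmat \<Rightarrow> fmat \<Rightarrow> real" where
  "finner n A B = (\<Sum>i<n. \<Sum>j<n. A i j * B i j)"

definition fro :: "nat \<Rightarrow> fmat \<Rightarrow> real" where
  "fro n A = L2_set (\<lambda>(i, j). A i j) ({..<n} \<times> {..<n})"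

text \<open>The Schatten 4-norm, \<open>\<parallel>A\<parallel>\<^sub>4\<^sup>4 = tr (A A\<^sup>T A A\<^sup>T)\<close>.\<close>
definition s4 :: "nat \<Rightarrow> fmat \<Rightarrow> real" where
  "s4 n A = sqrt (fro n (mmul n A (tp A)))"

text \<open>The exponent is shifted: \<open>pw n A m\<close> is the power \<open>A\<^bsup>m+1\<^esup>\<close>.\<close>
primrec pw :: "nat \<Rightarrow> fmat \<Rightarrow> nat \<Rightarrow> fmat" where
  "pw n A 0 = A"
| "pw n A (Suc m) = mmul n (pw n A m) A"

lemma tp_tp [simp]: "tp (tp A) = A"
  by (simp add: tp_def)

lemma tp_plus: "tp (A + B) = tp A + tp B"
  by (simp add: tp_def fun_eq_iff)

lemma tp_mmul: "tp (mmul n A B) = mmul n (tp B) (tp A)"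
  by (simp add: tp_def mmul_def fun_eq_iff mult.commute)

lemma mmul_assoc: "mmul n (mmul n A B) C = mmul n A (mmul n B C)"
proof (intro ext)
  fix i j
  have "(\<Sum>k<n. (\<Sum>l<n. A i l * B l k) * C k j) = (\<Sum>k<n. \<Sum>l<n. A i l * (B l k * C k j))"
    by (simp add: sum_distrib_right mult.assoc)
  also have "\<dots> = (\<Sum>l<n. \<Sum>k<n. A i l * (B l k * C k j))"
    by (rule sum.swap)
  finally show "mmul n (mmul n A B) C i j = mmul n A (mmul n B C) i j"
    by (simp add: mmul_def sum_distrib_left)
qed

lemma mmul_plus_left: "mmul n (A + B) C = mmul n A C + mmul n B C"
  by (simp add: mmul_def fun_eq_iff algebra_simps sum.distrib)

lemma mmul_plus_right: "mmul n A (B + C) = mmul n A B + mmul n A C"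
  by (simp add: mmul_def fun_eq_iff algebra_simps sum.distrib)

lemma mmul_minus_left: "mmul n (A - B) C = mmul n A C - mmul n B C"
  by (simp add: mmul_def fun_eq_iff algebra_simps sum_subtractf)

lemma mmul_minus_right: "mmul n A (B - C) = mmul n A B - mmul n A C"
  by (simp add: mmul_def fun_eq_iff algebra_simps sum_subtractf)

lemma mtr_plus: "mtr n (A + B) = mtr n A + mtr n B"
  by (simp add: mtr_def sum.distrib)

lemma mtr_minus: "mtr n (A - B) = mtr n A - mtr n B"
  by (simp add: mtr_def sum_subtractf)

lemma mtr_mmul: "mtr n (mmul n A B) = finner n A (tp B)"
  by (simp add: mtr_def mmul_def finner_def tp_def)

lemma mtr_mmul_commute: "mtr n (mmul n A B) = mtr n (mmul n B A)"
  unfolding mtr_def mmul_def by (subst sum.swap) (simp add: mult.commute)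

lemma finner_mmul_right: "finner n (mmul n A B) C = finner n A (mmul n C (tp B))"
proof -
  have "(\<Sum>j<n. (\<Sum>k<n. A i k * B k j) * C i j) = (\<Sum>k<n. A i k * (\<Sum>j<n. C i j * B k j))" for i
  proof -
    have "(\<Sum>j<n. (\<Sum>k<n. A i k * B k j) * C i j) = (\<Sum>j<n. \<Sum>k<n. A i k * (C i j * B k j))"
      unfolding sum_distrib_right by (simp only: mult_ac)
    also have "\<dots> = (\<Sum>k<n. \<Sum>j<n. A i k * (C i j * B k j))"
      by (rule sum.swap)
    finally show ?thesis by (simp add: sum_distrib_left)
  qed
  then show ?thesis
    by (simp add: finner_def mmul_def tp_def)
qed

lemma finner_tp: "finner n (tp A) (tp B) = finner n A B"
  unfolding finner_def tp_def by (rule sum.swap)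

lemma finner_mmul_left: "finner n (mmul n A B) C = finner n B (mmul n (tp A) C)"
proof -
  have "finner n (mmul n A B) C = finner n (mmul n (tp B) (tp A)) (tp C)"
    by (metis finner_tp tp_mmul)
  also have "\<dots> = finner n (tp B) (mmul n (tp C) A)"
    by (simp add: finner_mmul_right)
  also have "\<dots> = finner n B (mmul n (tp A) C)"
    by (metis finner_tp tp_mmul tp_tp)
  finally show ?thesis .
qed

lemma fro_nonneg [simp]: "0 \<le> fro n A"
  by (simp add: fro_def)

lemma fro_sq: "(fro n A)\<^sup>2 = finner n A A"
proof -
  have "(fro n A)\<^sup>2 = (\<Sum>(i, j)\<in>{..<n} \<times> {..<n}. (A i j)\<^sup>2)"
    unfolding fro_def L2_set_def by (subst real_sqrt_pow2) (auto intro!: sum_nonneg sum.cong)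
  then show ?thesis
    by (simp add: finner_def sum.cartesian_product power2_eq_square)
qed

lemma fro_sq': "(fro n A)\<^sup>2 = (\<Sum>i<n. \<Sum>j<n. (A i j)\<^sup>2)"
  unfolding fro_sq by (simp add: finner_def power2_eq_square)

lemma finner_le: "\<bar>finner n A B\<bar> \<le> fro n A * fro n B"
proof -
  have "\<bar>finner n A B\<bar> \<le> (\<Sum>x\<in>{..<n} \<times> {..<n}. \<bar>case x of (i, j) \<Rightarrow> A i j\<bar> * \<bar>case x of (i, j) \<Rightarrow> B i j\<bar>)"
    unfolding finner_def sum.cartesian_product
    by (rule order.trans[OF sum_abs]) (auto intro!: sum_mono simp: abs_mult)
  also have "\<dots> \<le> fro n A * fro n B"
    unfolding fro_def by (rule L2_set_mult_ineq)
  finally show ?thesis .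
qed

lemma fro_plus: "fro n (A + B) \<le> fro n A + fro n B"
proof -
  have "fro n (A + B) = L2_set (\<lambda>x. (case x of (i, j) \<Rightarrow> A i j) + (case x of (i, j) \<Rightarrow> B i j))
      ({..<n} \<times> {..<n})"
    unfolding fro_def by (intro L2_set_cong) auto
  then show ?thesis
    using L2_set_triangle_ineq[of "\<lambda>(i, j). A i j" "\<lambda>(i, j). B i j" "{..<n} \<times> {..<n}"]
    by (simp add: fro_def)
qed

lemma fro_tp [simp]: "fro n (tp A) = fro n A"
  by (rule power2_eq_imp_eq) (auto simp: fro_sq finner_tp)

lemma fro_scale: "fro n (\<lambda>i j. c * A i j) = \<bar>c\<bar> * fro n A"
  by (rule power2_eq_imp_eq) (auto simp: fro_sq' power_mult_distrib sum_distrib_left)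

lemma fro_mono:
  assumes "\<And>i j. i < n \<Longrightarrow> j < n \<Longrightarrow> \<bar>A i j\<bar> \<le> \<bar>B i j\<bar>"
  shows "fro n A \<le> fro n B"
  by (rule power2_le_imp_le) (auto simp: fro_sq' abs_le_square_iff[symmetric] intro!: sum_mono assms)

lemma s4_nonneg [simp]: "0 \<le> s4 n A"
  by (simp add: s4_def)

lemma s4_sq: "(s4 n A)\<^sup>2 = fro n (mmul n A (tp A))"
  by (simp add: s4_def)

text \<open>Both squares equal tr (A A^T A A^T), as moving factors across the inner product shows.
  This makes the Schatten 4-norm invariant under transposition without singular values.\<close>

lemma fro_gram: "fro n (mmul n (tp A) A) = fro n (mmul n A (tp A))"
proof (rule power2_eq_imp_eq)
  have "(fro n (mmul n (tp A) A))\<^sup>2 = finner n A (mmul n A (mmul n (tp A) A))"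
    by (simp add: fro_sq finner_mmul_left)
  also have "\<dots> = finner n (mmul n A (tp A)) (mmul n A (tp A))"
    by (simp add: finner_mmul_right mmul_assoc)
  finally show "(fro n (mmul n (tp A) A))\<^sup>2 = (fro n (mmul n A (tp A)))\<^sup>2"
    by (simp add: fro_sq)
qed auto

lemma s4_tp [simp]: "s4 n (tp A) = s4 n A"
  by (simp add: s4_def fro_gram)

text \<open>The square is the inner product of \<open>mmul n B (tp B)\<close> with
  \<open>mmul n (tp A) A\<close>, so Cauchy-Schwarz applies. In terms of 4-norms this is Hoelder's
  inequality for a product of two matrices.\<close>

lemma fro_mmul_sq_le: "(fro n (mmul n A B))\<^sup>2 \<le> fro n (mmul n (tp A) A) * fro n (mmul n B (tp B))"
proof -
  have "(fro n (mmul n A B))\<^sup>2 = finner n (mmul n A (mmul n B (tp B))) A"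
    unfolding fro_sq by (subst (2) finner_mmul_left, subst finner_mmul_left)
      (simp add: finner_mmul_right mmul_assoc tp_mmul)
  also have "\<dots> = finner n (mmul n B (tp B)) (mmul n (tp A) A)"
    by (simp add: finner_mmul_left)
  finally show ?thesis
    using finner_le[of n "mmul n B (tp B)" "mmul n (tp A) A"] by (simp add: mult.commute)
qed

lemma fro_mmul_s4_s4: "fro n (mmul n A B) \<le> s4 n A * s4 n B"
proof (rule power2_le_imp_le)
  show "(fro n (mmul n A B))\<^sup>2 \<le> (s4 n A * s4 n B)\<^sup>2"
    using fro_mmul_sq_le[of n A B] by (simp add: power_mult_distrib s4_sq fro_gram)
qed auto

lemma fro_mmul_le: "fro n (mmul n A B) \<le> fro n A * fro n B"
proof (rule power2_le_imp_le)
  have "mmul n A B i j ^ 2 \<le> (\<Sum>k<n. (A i k)\<^sup>2) * (\<Sum>k<n. (B k j)\<^sup>2)" for i j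
    unfolding mmul_def by (rule Cauchy_Schwarz_ineq_sum)
  then have "(fro n (mmul n A B))\<^sup>2 \<le> (\<Sum>i<n. \<Sum>j<n. (\<Sum>k<n. (A i k)\<^sup>2) * (\<Sum>k<n. (B k j)\<^sup>2))"
    unfolding fro_sq' by (intro sum_mono)
  also have "\<dots> = (\<Sum>i<n. \<Sum>k<n. (A i k)\<^sup>2) * (\<Sum>j<n. \<Sum>k<n. (B k j)\<^sup>2)"
    by (simp add: sum_product)
  also have "(\<Sum>j<n. \<Sum>k<n. (B k j)\<^sup>2) = (fro n B)\<^sup>2"
    unfolding fro_sq' by (rule sum.swap)
  finally show "(fro n (mmul n A B))\<^sup>2 \<le> (fro n A * fro n B)\<^sup>2"
    by (simp add: fro_sq' power_mult_distrib)
qed auto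

lemma s4_le_fro: "s4 n A \<le> fro n A"
  by (rule power2_le_imp_le)
    (use fro_mmul_le[of n A "tp A"] in \<open>simp_all add: s4_sq power2_eq_square[of "fro n A"]\<close>)

lemma fro_mmul_s4: "fro n (mmul n A B) \<le> fro n A * s4 n B"
proof (rule power2_le_imp_le)
  have "(fro n (mmul n A B))\<^sup>2 \<le> (s4 n A)\<^sup>2 * (s4 n B)\<^sup>2"
    using fro_mmul_sq_le[of n A B] by (simp add: s4_sq fro_gram)
  also have "\<dots> \<le> (fro n A)\<^sup>2 * (s4 n B)\<^sup>2"
    by (intro mult_right_mono power_mono s4_le_fro) auto
  finally show "(fro n (mmul n A B))\<^sup>2 \<le> (fro n A * s4 n B)\<^sup>2"
    by (simp add: power_mult_distrib)
qed auto

text \<open>Expanding the Gram matrix of \<open>A + B\<close> into four products and applying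
  \<open>fro_mmul_s4_s4\<close> to each yields the square of the right-hand side.\<close>

lemma s4_plus: "s4 n (A + B) \<le> s4 n A + s4 n B"
proof (rule power2_le_imp_le)
  let ?g = "\<lambda>A B. mmul n A (tp B)"
  have eq: "?g (A + B) (A + B) = (?g A A + ?g A B) + (?g B A + ?g B B)"
    by (simp add: tp_plus mmul_plus_left mmul_plus_right)
  have "(s4 n (A + B))\<^sup>2 \<le> (fro n (?g A A) + fro n (?g A B)) + (fro n (?g B A) + fro n (?g B B))"
    using fro_plus[of n "?g A A + ?g A B" "?g B A + ?g B B"] fro_plus[of n "?g A A" "?g A B"]
      fro_plus[of n "?g B A" "?g B B"] unfolding s4_sq eq by linarith
  also have "\<dots> \<le> (s4 n A * s4 n A + s4 n A * s4 n B) + (s4 n B * s4 n A + s4 n B * s4 n B)"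
    using fro_mmul_s4_s4[of n A "tp A"] fro_mmul_s4_s4[of n A "tp B"]
      fro_mmul_s4_s4[of n B "tp A"] fro_mmul_s4_s4[of n B "tp B"] by (intro add_mono) simp_all
  also have "\<dots> = (s4 n A + s4 n B)\<^sup>2"
    by (simp add: power2_eq_square algebra_simps)
  finally show "(s4 n (A + B))\<^sup>2 \<le> (s4 n A + s4 n B)\<^sup>2" .
qed auto

lemma s4_scale: "s4 n (\<lambda>i j. c * A i j) = \<bar>c\<bar> * s4 n A"
proof (rule power2_eq_imp_eq)
  have "mmul n (\<lambda>i j. c * A i j) (tp (\<lambda>i j. c * A i j)) = (\<lambda>i j. c\<^sup>2 * mmul n A (tp A) i j)"
    by (simp add: mmul_def tp_def fun_eq_iff sum_distrib_left power2_eq_square mult_ac)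
  then show "(s4 n (\<lambda>i j. c * A i j))\<^sup>2 = (\<bar>c\<bar> * s4 n A)\<^sup>2"
    by (simp add: s4_sq fro_scale power_mult_distrib)
qed auto

lemma s4_minus_commute: "s4 n (A - B) = s4 n (B - A)"
proof -
  have "A - B = (\<lambda>i j. (-1) * (B - A) i j)"
    by (simp add: fun_eq_iff)
  then show ?thesis
    by (metis s4_scale abs_minus_cancel abs_one mult_1)
qed

lemma s4_triangle: "s4 n (A - C) \<le> s4 n (A - B) + s4 n (B - C)"
  using s4_plus[of n "A - B" "B - C"] by (simp add: algebra_simps)

lemma mtr_mmul_le: "\<bar>mtr n (mmul n A B)\<bar> \<le> fro n A * fro n B"
  by (metis finner_le fro_tp mtr_mmul)

section \<open>Traces of powers as functions of the matrix\<close>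

lemma fro_pw_le_s4:
  assumes "s4 n X \<le> a"
  shows "fro n (pw n X (Suc m)) \<le> a ^ (m + 2)"
proof (induction m)
  case 0
  have "fro n (mmul n X X) \<le> s4 n X * s4 n X" by (rule fro_mmul_s4_s4)
  also have "\<dots> \<le> a * a" using assms by (intro mult_mono order.trans[OF s4_nonneg assms]) auto
  finally show ?case by (simp add: power2_eq_square)
next
  case (Suc m)
  have "fro n (pw n X (Suc (Suc m))) \<le> fro n (pw n X (Suc m)) * s4 n X"
    by (simp only: pw.simps(2)[of n X "Suc m"] fro_mmul_s4)
  also have "\<dots> \<le> a ^ (m + 2) * a"
    using assms by (intro mult_mono Suc.IH order.trans[OF s4_nonneg assms] zero_le_power) auto
  finally show ?case by (simp add: mult.commute)
qed

lemma fro_pw_le_fro: "fro n (pw n X m) \<le> fro n X ^ (m + 1)"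
proof (induction m)
  case (Suc m)
  have "fro n (pw n X (Suc m)) \<le> fro n (pw n X m) * fro n X"
    by (simp add: fro_mmul_le)
  also have "\<dots> \<le> fro n X ^ (m + 1) * fro n X"
    by (intro mult_right_mono Suc.IH) auto
  finally show ?case by (simp add: mult.commute)
qed simp

text \<open>Telescoping, one factor at a time. Powers start at the square because the 4-norm
  controls the Frobenius norm only of products of at least two factors.\<close>

lemma fro_pw_diff_le:
  assumes "s4 n X \<le> a" "s4 n Y \<le> a" "s4 n (X - Y) \<le> g"
  shows "fro n (pw n X (Suc m) - pw n Y (Suc m)) \<le> (real m + 2) * a ^ (m + 1) * g"
proof (induction m)
  case 0
  have a: "0 \<le> a" "0 \<le> g" using order.trans[OF s4_nonneg] assms by blast+
  have "mmul n X X - mmul n Y Y = mmul n X (X - Y) + mmul n (X - Y) Y"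
    by (simp add: mmul_minus_left mmul_minus_right)
  then have "fro n (mmul n X X - mmul n Y Y) \<le> fro n (mmul n X (X - Y)) + fro n (mmul n (X - Y) Y)"
    by (metis fro_plus)
  also have "\<dots> \<le> s4 n X * s4 n (X - Y) + s4 n (X - Y) * s4 n Y"
    by (intro add_mono fro_mmul_s4_s4)
  also have "\<dots> \<le> a * g + g * a"
    using a assms by (intro add_mono mult_mono) auto
  also have "\<dots> = (real 0 + 2) * a ^ (0 + 1) * g" by simp
  finally show ?case by (simp only: pw.simps)
next
  case (Suc m)
  have a: "0 \<le> a" "0 \<le> g" using order.trans[OF s4_nonneg] assms by blast+
  let ?P = "pw n X (Suc m)" and ?Q = "pw n Y (Suc m)"
  have "pw n X (Suc (Suc m)) - pw n Y (Suc (Suc m)) = mmul n (?P - ?Q) X + mmul n ?Q (X - Y)"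
    by (simp add: mmul_minus_left mmul_minus_right)
  then have "fro n (pw n X (Suc (Suc m)) - pw n Y (Suc (Suc m)))
      \<le> fro n (mmul n (?P - ?Q) X) + fro n (mmul n ?Q (X - Y))"
    by (metis fro_plus)
  also have "\<dots> \<le> fro n (?P - ?Q) * s4 n X + fro n ?Q * s4 n (X - Y)"
    by (intro add_mono fro_mmul_s4)
  also have "\<dots> \<le> ((real m + 2) * a ^ (m + 1) * g) * a + a ^ (m + 2) * g"
    by (intro add_mono mult_mono Suc.IH assms fro_pw_le_s4 mult_nonneg_nonneg zero_le_power a) auto
  also have "\<dots> = (real (Suc m) + 2) * a ^ (Suc m + 1) * g"
    by (simp add: algebra_simps)
  finally show ?case .
qed

lemma pw_add: "pw n A (k + m + 1) = mmul n (pw n A k) (pw n A m)"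
  by (induction m) (simp_all add: mmul_assoc)

text \<open>Splitting the power as \<open>A\<^sup>2 A\<^bsup>d-2\<^esup>\<close> requires both factors to be products of at least two
  matrices, which is where \<open>d \<ge> 4\<close> enters.\<close>
lemma mtr_pw_diff_le:
  assumes "s4 n X \<le> a" "s4 n Y \<le> a" "s4 n (X - Y) \<le> g"
  shows "\<bar>mtr n (pw n X (m + 3)) - mtr n (pw n Y (m + 3))\<bar> \<le> (real m + 4) * a ^ (m + 3) * g"
proof -
  have a: "0 \<le> a" "0 \<le> g" using order.trans[OF s4_nonneg] assms by blast+
  let ?X1 = "pw n X (Suc 0)" and ?X2 = "pw n X (Suc m)"
  let ?Y1 = "pw n Y (Suc 0)" and ?Y2 = "pw n Y (Suc m)"
  have split: "pw n Z (m + 3) = mmul n (pw n Z (Suc 0)) (pw n Z (Suc m))" for Z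
    using pw_add[of n Z "Suc 0" "Suc m"] by (simp add: numeral_eq_Suc)
  have eq: "mtr n (pw n X (m + 3)) - mtr n (pw n Y (m + 3))
      = mtr n (mmul n (?X1 - ?Y1) ?X2) + mtr n (mmul n ?Y1 (?X2 - ?Y2))"
    unfolding split by (simp add: mmul_minus_left mmul_minus_right mtr_minus mtr_plus del: pw.simps)
  have "\<bar>mtr n (pw n X (m + 3)) - mtr n (pw n Y (m + 3))\<bar>
      \<le> fro n (?X1 - ?Y1) * fro n ?X2 + fro n ?Y1 * fro n (?X2 - ?Y2)"
    unfolding eq by (rule order.trans[OF abs_triangle_ineq add_mono[OF mtr_mmul_le mtr_mmul_le]])
  also have "\<dots> \<le> (2 * a * g) * a ^ (m + 2) + a ^ 2 * ((real m + 2) * a ^ (m + 1) * g)"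
  proof -
    have "fro n (?X1 - ?Y1) \<le> 2 * a * g"
      using fro_pw_diff_le[OF assms, of 0] by (simp del: pw.simps)
    moreover have "fro n ?Y1 \<le> a ^ 2"
      using fro_pw_le_s4[OF assms(2), of 0] by (simp add: power2_eq_square del: pw.simps)
    ultimately show ?thesis
      by (intro add_mono mult_mono fro_pw_le_s4 assms fro_pw_diff_le) (auto simp: a simp del: pw.simps)
  qed
  also have "\<dots> = (real m + 4) * a ^ (m + 3) * g"
    by (simp add: algebra_simps power_add eval_nat_numeral)
  finally show ?thesis .
qed

text \<open>With \<open>G = X - Y\<close>, cyclicity turns the cube under the trace into Y^3 + 3 Y^2
  G + 3 G^2 Y + G^3. Each mixed term pairs a product of two factors, bounded through 4-norms, with a
  remaining \<open>Y\<close>, whose Frobenius norm is bounded; it is at most a^2 g, hence the 6. No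
  such bound is available for \<open>G\<close>, so tr G^3 stays.\<close>

lemma mtr_cube_le:
  assumes "s4 n Y \<le> a" "fro n Y \<le> a" "s4 n (X - Y) \<le> g" "g \<le> a"
  shows "mtr n (pw n X 2) \<le> mtr n (pw n Y 2) + 6 * a ^ 2 * g + mtr n (pw n (X - Y) 2)"
proof -
  define G where "G = X - Y"
  have X: "X = Y + G" by (simp add: G_def)
  have a: "0 \<le> a" "0 \<le> g" using order.trans[OF s4_nonneg] assms by blast+
  let ?m = "mmul n"
  have p2: "pw n Z 2 = ?m (?m Z Z) Z" for Z by (simp add: numeral_2_eq_2)
  have c1: "mtr n (?m (?m Y G) Y) = mtr n (?m (?m Y Y) G)" "mtr n (?m (?m G Y) Y) = mtr n (?m (?m Y Y) G)"
    by (metis mmul_assoc mtr_mmul_commute)+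
  have c2: "mtr n (?m (?m G Y) G) = mtr n (?m (?m G G) Y)" "mtr n (?m (?m Y G) G) = mtr n (?m (?m G G) Y)"
    by (metis mmul_assoc mtr_mmul_commute)+
  have "mtr n (pw n X 2) = mtr n (pw n Y 2) + 3 * mtr n (?m (?m Y G) Y) + 3 * mtr n (?m (?m G G) Y)
      + mtr n (pw n G 2)"
    unfolding p2 X by (simp add: mmul_plus_left mmul_plus_right mtr_plus c1 c2)
  moreover have "mtr n (?m (?m Y G) Y) \<le> (a * g) * a"
  proof -
    have "mtr n (?m (?m Y G) Y) \<le> (s4 n Y * s4 n G) * fro n Y"
      using mtr_mmul_le[of n "?m Y G" Y] fro_mmul_s4_s4[of n Y G]
      by (meson abs_le_D1 fro_nonneg mult_right_mono order.trans)
    also have "\<dots> \<le> (a * g) * a"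
      using assms a by (intro mult_mono mult_nonneg_nonneg) (auto simp: G_def)
    finally show ?thesis .
  qed
  moreover have "mtr n (?m (?m G G) Y) \<le> (g * g) * a"
  proof -
    have "mtr n (?m (?m G G) Y) \<le> (s4 n G * s4 n G) * fro n Y"
      using mtr_mmul_le[of n "?m G G" Y] fro_mmul_s4_s4[of n G G]
      by (meson abs_le_D1 fro_nonneg mult_right_mono order.trans)
    also have "\<dots> \<le> (g * g) * a"
      using assms a by (intro mult_mono mult_nonneg_nonneg) (auto simp: G_def)
    finally show ?thesis .
  qed
  moreover have "(g * g) * a \<le> (a * g) * a"
    using a assms by (intro mult_right_mono) auto
  moreover have "6 * a ^ 2 * g = 6 * ((a * g) * a)"
    by (simp add: power2_eq_square)
  ultimately show ?thesis
    unfolding G_def by linarith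
qed

section \<open>Independent Bernoulli variables\<close>

text \<open>Convexity is stated pointwise because function types carry no real vector space structure.\<close>
definition cvx :: "('a \<Rightarrow> real) set \<Rightarrow> bool" where
  "cvx C \<longleftrightarrow> (\<forall>u\<in>C. \<forall>v\<in>C. \<forall>l. 0 \<le> l \<and> l \<le> 1 \<longrightarrow> (\<lambda>i. l * u i + (1 - l) * v i) \<in> C)"

text \<open>The values of independent Bernoulli variables indexed by \<open>E\<close> are encoded by the set
  \<open>S \<subseteq> E\<close> of the indices with value 1.\<close>
definition bw :: "real \<Rightarrow> 'a set \<Rightarrow> 'a set \<Rightarrow> real" where
  "bw p E S = p ^ card S * (1 - p) ^ card (E - S)"

definition bprob :: "real \<Rightarrow> 'a set \<Rightarrow> 'a set set \<Rightarrow> real" where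
  "bprob p E \<A> = (\<Sum>S\<in>\<A> \<inter> Pow E. bw p E S)"

definition bern :: "'a set \<Rightarrow> 'a \<Rightarrow> real" where
  "bern S e = of_bool (e \<in> S)"

lemma bw_nonneg: "0 \<le> p \<Longrightarrow> p \<le> 1 \<Longrightarrow> 0 \<le> bw p E S"
  by (simp add: bw_def)

lemma bw_pos: "0 < p \<Longrightarrow> p < 1 \<Longrightarrow> 0 < bw p E S"
  by (simp add: bw_def)

text \<open>Independence: \<open>prod_add\<close> expands the right-hand product over the sets of
  indices where the value 1 is chosen.\<close>

lemma bexp_prod:
  assumes "finite E"
  shows "(\<Sum>S\<in>Pow E. bw p E S * (\<Prod>e\<in>E. f e (bern S e))) = (\<Prod>e\<in>E. p * f e 1 + (1 - p) * f e 0)"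
proof -
  have "(\<Prod>e\<in>E. p * f e 1 + (1 - p) * f e 0)
      = (\<Sum>S\<in>Pow E. (\<Prod>e\<in>S. p * f e 1) * (\<Prod>e\<in>E - S. (1 - p) * f e 0))"
    by (rule prod_add) fact
  also have "\<dots> = (\<Sum>S\<in>Pow E. bw p E S * (\<Prod>e\<in>E. f e (bern S e)))"
  proof (rule sum.cong[OF refl])
    fix S assume "S \<in> Pow E"
    then have S: "S \<subseteq> E" by simp
    have "(\<Prod>e\<in>E. f e (bern S e)) = (\<Prod>e\<in>S. f e (bern S e)) * (\<Prod>e\<in>E - S. f e (bern S e))"
      using prod.subset_diff[OF S assms] by (simp add: mult.commute)
    also have "\<dots> = (\<Prod>e\<in>S. f e 1) * (\<Prod>e\<in>E - S. f e 0)"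
      by (simp add: bern_def)
    finally show "(\<Prod>e\<in>S. p * f e 1) * (\<Prod>e\<in>E - S. (1 - p) * f e 0)
        = bw p E S * (\<Prod>e\<in>E. f e (bern S e))"
      by (simp add: prod.distrib bw_def mult_ac)
  qed
  finally show ?thesis by simp
qed

lemma bexp_prod_subset:
  assumes "finite E" "T \<subseteq> E"
  shows "(\<Sum>S\<in>Pow E. bw p E S * (\<Prod>e\<in>T. f e (bern S e))) = (\<Prod>e\<in>T. p * f e 1 + (1 - p) * f e 0)"
proof -
  define g where "g e x = (if e \<in> T then f e x else 1)" for e and x :: real
  have "(\<Sum>S\<in>Pow E. bw p E S * (\<Prod>e\<in>E. g e (bern S e))) = (\<Prod>e\<in>E. p * g e 1 + (1 - p) * g e 0)"
    by (rule bexp_prod) fact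
  moreover have "(\<Prod>e\<in>E. g e (bern S e)) = (\<Prod>e\<in>T. f e (bern S e))" for S
    unfolding g_def using assms by (simp add: prod.If_cases Int_absorb1)
  moreover have "(\<Prod>e\<in>E. p * g e 1 + (1 - p) * g e 0) = (\<Prod>e\<in>E. if e \<in> T then p * f e 1 + (1 - p) * f e 0 else 1)"
    unfolding g_def by (intro prod.cong) auto
  moreover have "\<dots> = (\<Prod>e\<in>T. p * f e 1 + (1 - p) * f e 0)"
    using assms by (simp add: prod.If_cases Int_absorb1)
  ultimately show ?thesis by simp
qed

lemma bw_total: "finite E \<Longrightarrow> (\<Sum>S\<in>Pow E. bw p E S) = 1"
  using bexp_prod_subset[of E "{}" p] by simp

lemma bprob_nonneg: "0 \<le> p \<Longrightarrow> p \<le> 1 \<Longrightarrow> 0 \<le> bprob p E \<A>"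
  by (auto simp: bprob_def intro!: sum_nonneg bw_nonneg)

lemma bprob_mono:
  assumes "finite E" "0 \<le> p" "p \<le> 1" "\<A> \<inter> Pow E \<subseteq> \<B>"
  shows "bprob p E \<A> \<le> bprob p E \<B>"
  unfolding bprob_def using assms by (intro sum_mono2) (auto intro: bw_nonneg)

lemma bprob_Un:
  assumes "finite E" "0 \<le> p" "p \<le> 1"
  shows "bprob p E (\<A> \<union> \<B>) \<le> bprob p E \<A> + bprob p E \<B>"
proof -
  have "(\<Sum>S\<in>(\<A> \<inter> Pow E) \<union> (\<B> \<inter> Pow E). bw p E S) + (\<Sum>S\<in>(\<A> \<inter> Pow E) \<inter> (\<B> \<inter> Pow E). bw p E S)
      = bprob p E \<A> + bprob p E \<B>"
    unfolding bprob_def using assms by (intro sum.union_inter) auto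
  moreover have "0 \<le> (\<Sum>S\<in>(\<A> \<inter> Pow E) \<inter> (\<B> \<inter> Pow E). bw p E S)"
    using assms by (intro sum_nonneg bw_nonneg)
  ultimately show ?thesis by (simp add: bprob_def Int_Un_distrib2)
qed

lemma bprob_UN:
  assumes "finite E" "0 \<le> p" "p \<le> 1" "finite I"
  shows "bprob p E (\<Union>i\<in>I. \<A> i) \<le> (\<Sum>i\<in>I. bprob p E (\<A> i))"
  using \<open>finite I\<close>
proof induction
  case (insert i I)
  then show ?case
    using bprob_Un[OF assms(1-3), of "\<A> i" "\<Union>i\<in>I. \<A> i"] by simp
qed (simp add: bprob_def)

lemma bprob_markov:
  assumes "finite E" "0 \<le> p" "p \<le> 1" "0 < c"
    and f: "\<And>S. S \<subseteq> E \<Longrightarrow> 0 \<le> f S"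
    and "\<And>S. S \<in> \<A> \<Longrightarrow> S \<subseteq> E \<Longrightarrow> c \<le> f S"
  shows "bprob p E \<A> \<le> (\<Sum>S\<in>Pow E. bw p E S * f S) / c"
proof -
  have "bprob p E \<A> \<le> (\<Sum>S\<in>\<A> \<inter> Pow E. bw p E S * (f S / c))"
    unfolding bprob_def
  proof (rule sum_mono)
    fix S assume "S \<in> \<A> \<inter> Pow E"
    then have "1 \<le> f S / c" using assms by simp
    then show "bw p E S \<le> bw p E S * (f S / c)"
      using bw_nonneg[OF assms(2,3)] by (metis mult.right_neutral mult_left_mono)
  qed
  also have "\<dots> \<le> (\<Sum>S\<in>Pow E. bw p E S * (f S / c))"
    using assms by (intro sum_mono2) (auto intro!: mult_nonneg_nonneg bw_nonneg divide_nonneg_pos)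
  finally show ?thesis by (simp add: sum_divide_distrib)
qed

lemma bw_insert_in:
  assumes "finite E" "e \<notin> E" "S \<subseteq> E"
  shows "bw p (insert e E) (insert e S) = p * bw p E S"
proof -
  have "insert e E - insert e S = E - S" using assms by auto
  moreover have "card (insert e S) = Suc (card S)"
    using assms finite_subset[of S E] by (subst card_insert_disjoint) auto
  ultimately show ?thesis by (simp add: bw_def)
qed

lemma bw_insert_notin:
  assumes "finite E" "e \<notin> E" "S \<subseteq> E"
  shows "bw p (insert e E) S = (1 - p) * bw p E S"
proof -
  have "insert e E - S = insert e (E - S)" using assms by auto
  moreover have "card (insert e (E - S)) = Suc (card (E - S))"
    using assms by (subst card_insert_disjoint) auto
  ultimately show ?thesis by (simp add: bw_def)
qed

lemma sum_Pow_insert: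
  fixes g :: "'a set \<Rightarrow> real"
  assumes "finite E" "e \<notin> E"
  shows "(\<Sum>S\<in>Pow (insert e E). g S) = (\<Sum>S\<in>Pow E. g (insert e S)) + (\<Sum>S\<in>Pow E. g S)"
proof -
  have "(\<Sum>S\<in>Pow (insert e E). g S) = (\<Sum>S\<in>Pow E. g S) + (\<Sum>S\<in>insert e ` Pow E. g S)"
    unfolding Pow_insert using assms by (intro sum.union_disjoint) auto
  also have "(\<Sum>S\<in>insert e ` Pow E. g S) = (\<Sum>S\<in>Pow E. g (insert e S))"
    using assms by (subst sum.reindex) (auto simp: inj_on_def insert_ident)
  finally show ?thesis by simp
qed

lemma bexp_insert:
  assumes "finite E" "e \<notin> E"
  shows "(\<Sum>S\<in>Pow (insert e E). bw p (insert e E) S * g S)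
    = p * (\<Sum>S\<in>Pow E. bw p E S * g (insert e S)) + (1 - p) * (\<Sum>S\<in>Pow E. bw p E S * g S)"
proof -
  have "(\<Sum>S\<in>Pow E. bw p (insert e E) (insert e S) * g (insert e S)) = (\<Sum>S\<in>Pow E. p * (bw p E S * g (insert e S)))"
    using assms by (intro sum.cong refl) (auto simp: bw_insert_in)
  moreover have "(\<Sum>S\<in>Pow E. bw p (insert e E) S * g S) = (\<Sum>S\<in>Pow E. (1 - p) * (bw p E S * g S))"
    using assms by (intro sum.cong refl) (auto simp: bw_insert_notin)
  ultimately show ?thesis
    using assms by (simp add: sum_Pow_insert sum_distrib_left)
qed

text \<open>Fubini for two disjoint families of variables; it later allows conditioning on the edges
  that meet a vertex set.\<close>

lemma bexp_Un:
  assumes "finite E" "finite F" "E \<inter> F = {}"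
  shows "(\<Sum>S\<in>Pow (E \<union> F). bw p (E \<union> F) S * g S)
    = (\<Sum>S\<in>Pow E. bw p E S * (\<Sum>T\<in>Pow F. bw p F T * g (S \<union> T)))"
  using assms(2,1,3)
proof (induction F arbitrary: g)
  case empty
  then show ?case by (simp add: bw_def)
next
  case (insert e F)
  have "(\<Sum>S\<in>Pow (E \<union> insert e F). bw p (E \<union> insert e F) S * g S)
      = p * (\<Sum>S\<in>Pow (E \<union> F). bw p (E \<union> F) S * g (insert e S))
        + (1 - p) * (\<Sum>S\<in>Pow (E \<union> F). bw p (E \<union> F) S * g S)"
    using insert.prems insert.hyps by (simp add: bexp_insert)
  also have "\<dots> = (\<Sum>S\<in>Pow E. bw p E S * (p * (\<Sum>T\<in>Pow F. bw p F T * g (S \<union> insert e T))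
        + (1 - p) * (\<Sum>T\<in>Pow F. bw p F T * g (S \<union> T))))"
    using insert.prems insert.hyps insert.IH[of "\<lambda>S. g (insert e S)"] insert.IH[of g]
    by (simp add: sum_distrib_left distrib_left sum.distrib mult_ac)
  also have "\<dots> = (\<Sum>S\<in>Pow E. bw p E S * (\<Sum>T\<in>Pow (insert e F). bw p (insert e F) T * g (S \<union> T)))"
    using insert.hyps by (simp add: bexp_insert)
  finally show ?case .
qed

section \<open>Hoeffding's inequality\<close>

lemma bernoulli_mgf_le:
  fixes p h :: real
  assumes "0 \<le> p" "p \<le> 1" "0 \<le> h"
  shows "p * exp (h * (1 - p)) + (1 - p) * exp (h * (0 - p)) \<le> exp (h\<^sup>2 / 8)"
proof -
  have pos: "0 < 1 + p * (exp h - 1)"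
    using assms by (intro add_pos_nonneg mult_nonneg_nonneg) auto
  have "p * exp (h * (1 - p)) + (1 - p) * exp (h * (0 - p)) = exp (- h * p) * (1 + p * (exp h - 1))"
    by (simp add: algebra_simps flip: exp_add)
  also have "\<dots> = exp (- h * p + ln (1 + p * (exp h - 1)))"
    using pos by (simp only: exp_add exp_ln)
  also have "\<dots> \<le> exp (h\<^sup>2 / 8)"
    using Hoeffdings_lemma_aux[OF assms(3,1)] by simp
  finally show ?thesis .
qed

text \<open>Exchanging the values 0 and 1 replaces \<open>p\<close> by \<open>1 - p\<close> and
  \<open>h\<close> by \<open>- h\<close>, which covers negative \<open>h\<close>.\<close>

lemma bernoulli_mgf_le':
  fixes p h :: real
  assumes "0 \<le> p" "p \<le> 1"
  shows "p * exp (h * (1 - p)) + (1 - p) * exp (h * (0 - p)) \<le> exp (h\<^sup>2 / 8)"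
proof (cases "0 \<le> h")
  case False
  then show ?thesis
    using bernoulli_mgf_le[of "1 - p" "- h"] assms by (simp add: algebra_simps)
qed (use bernoulli_mgf_le assms in auto)

lemma bprob_hoeffding:
  assumes "finite E" "0 \<le> p" "p \<le> 1" "0 \<le> a" "(\<Sum>e\<in>E. (w e)\<^sup>2) \<le> s" "0 < s"
  shows "bprob p E {S. a \<le> (\<Sum>e\<in>E. (bern S e - p) * w e)} \<le> exp (- 2 * a\<^sup>2 / s)"
proof -
  \<comment> \<open>The minimiser of h^2 s / 8 - h a.\<close>
  define h where "h = 4 * a / s"
  have h: "0 \<le> h" using assms by (simp add: h_def)
  let ?X = "\<lambda>S. \<Sum>e\<in>E. (bern S e - p) * w e"
  have "bprob p E {S. a \<le> ?X S} \<le> (\<Sum>S\<in>Pow E. bw p E S * exp (h * ?X S)) / exp (h * a)"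
    using assms h by (intro bprob_markov) (auto intro: mult_left_mono)
  also have "(\<Sum>S\<in>Pow E. bw p E S * exp (h * ?X S))
      = (\<Sum>S\<in>Pow E. bw p E S * (\<Prod>e\<in>E. exp ((h * w e) * (bern S e - p))))"
    using assms(1) by (simp add: sum_distrib_left exp_sum mult_ac)
  also have "\<dots> = (\<Prod>e\<in>E. p * exp ((h * w e) * (1 - p)) + (1 - p) * exp ((h * w e) * (0 - p)))"
    by (rule bexp_prod) fact
  also have "\<dots> \<le> (\<Prod>e\<in>E. exp ((h * w e)\<^sup>2 / 8))"
    using assms by (intro prod_mono conjI bernoulli_mgf_le' add_nonneg_nonneg mult_nonneg_nonneg) auto
  also have "\<dots> = exp (h\<^sup>2 / 8 * (\<Sum>e\<in>E. (w e)\<^sup>2))"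
    using assms(1) by (simp add: exp_sum[symmetric] sum_distrib_left power_mult_distrib)
  also have "\<dots> \<le> exp (h\<^sup>2 / 8 * s)"
    using assms by (intro iffD2[OF exp_le_cancel_iff] mult_left_mono) auto
  finally have "bprob p E {S. a \<le> ?X S} \<le> exp (h\<^sup>2 / 8 * s) / exp (h * a)"
    by (simp add: divide_right_mono)
  also have "\<dots> = exp (h\<^sup>2 / 8 * s - h * a)"
    by (simp add: exp_diff)
  also have "h\<^sup>2 / 8 * s - h * a = - 2 * a\<^sup>2 / s"
    using assms by (simp add: h_def field_simps power2_eq_square)
  finally show ?thesis .
qed

section \<open>Talagrand's convex distance inequality\<close>

lemma exp_neg_le_quadratic:
  fixes u :: real
  assumes "0 \<le> u"
  shows "exp (- u) \<le> 1 - u + u\<^sup>2 / 2"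
proof -
  have pos: "0 < 1 + u + u\<^sup>2 / 2"
    using assms by (intro add_pos_nonneg) auto
  have "exp (- u) = 1 / exp u"
    by (simp add: exp_minus inverse_eq_divide)
  also have "\<dots> \<le> 1 / (1 + u + u\<^sup>2 / 2)"
    using exp_lower_Taylor_quadratic[OF assms] pos by (intro divide_left_mono) auto
  also have "\<dots> \<le> 1 - u + u\<^sup>2 / 2"
  proof -
    have "(1 - u + u\<^sup>2 / 2) * (1 + u + u\<^sup>2 / 2) = 1 + (u\<^sup>2 / 2)\<^sup>2"
      by (simp add: power2_eq_square algebra_simps)
    then have "1 \<le> (1 - u + u\<^sup>2 / 2) * (1 + u + u\<^sup>2 / 2)"
      by simp
    then show ?thesis using pos by (simp only: pos_divide_le_eq)
  qed
  finally show ?thesis .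
qed

text \<open>Optimises the mixing weight in the induction for Talagrand's inequality, with
  \<open>exp (- u)\<close> the ratio of the two slice probabilities. The exponent is minimal at
  \<open>l = 1 - 4 * u\<close>, admissible for \<open>u\<close> up to 1/4; beyond that
  \<open>l = 0\<close> suffices. The classical constant is 1/4 in place of 1/8; with 1/8, quadratic
  bounds on exp settle both cases.\<close>

lemma talagrand_two_point:
  fixes u :: real
  assumes "0 \<le> u"
  shows "\<exists>l. 0 \<le> l \<and> l \<le> 1 \<and> exp ((1 - l)\<^sup>2 / 8 + l * u) \<le> 2 - exp (- u)"
proof (cases "u \<le> 1 / 4")
  case True
  define x where "x = u - 2 * u\<^sup>2"
  have "u * u \<le> (1/4) * u" using True assms by (intro mult_right_mono) auto
  then have x: "0 \<le> x" "x \<le> 1" "x \<le> u"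
    using True assms zero_le_square[of u] unfolding x_def power2_eq_square by linarith+
  have eq: "(1 - (1 - 4 * u))\<^sup>2 / 8 + (1 - 4 * u) * u = x"
    by (simp add: x_def power2_eq_square algebra_simps)
  have "exp x \<le> 1 + x + x\<^sup>2"
    using x by (intro exp_bound) auto
  moreover have "x\<^sup>2 \<le> u\<^sup>2" using x by (intro power_mono) auto
  moreover have "exp (- u) \<le> 1 - u + u\<^sup>2 / 2"
    by (rule exp_neg_le_quadratic) fact
  moreover have "0 \<le> u\<^sup>2" by simp
  ultimately have "exp ((1 - (1 - 4 * u))\<^sup>2 / 8 + (1 - 4 * u) * u) \<le> 2 - exp (- u)"
    unfolding eq using x_def by linarith
  then show ?thesis
    using True assms by (intro exI[of _ "1 - 4 * u"]) auto
next
  case False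
  have "exp (1 / 8 :: real) \<le> 1 + 1 / 8 + (1 / 8)\<^sup>2"
    by (intro exp_bound) auto
  moreover have "exp (- u) \<le> exp (- (1 / 4))"
    using False by simp
  moreover have "exp (- (1 / 4 :: real)) \<le> 1 - 1 / 4 + (1 / 4)\<^sup>2 / 2"
    by (rule exp_neg_le_quadratic) simp
  moreover have "(1 / 8 :: real)\<^sup>2 = 1 / 64" "(1 / 4 :: real)\<^sup>2 / 2 = 1 / 32"
    by (simp_all add: power2_eq_square)
  ultimately have "exp (1 / 8) \<le> 2 - exp (- u)"
    by linarith
  then have "exp ((1 - 0)\<^sup>2 / 8 + 0 * u) \<le> 2 - exp (- u)"
    by simp
  then show ?thesis by (intro exI[of _ 0]) auto
qed

text \<open>Hoelder's inequality with exponents 1/l and 1/(1-l); the bound is a^(-l) b^(-(1-l)).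
  After shifting \<open>f\<close> by \<open>ln a\<close> and \<open>g\<close> by
  \<open>ln b\<close>, it follows pointwise from the convexity of exp.\<close>

lemma bexp_exp_convex_comb:
  assumes "finite E" "0 \<le> p" "p \<le> 1" "0 \<le> l" "l \<le> 1" "0 < a" "0 < b"
    and f: "(\<Sum>S\<in>Pow E. bw p E S * exp (f S)) \<le> 1 / a"
    and g: "(\<Sum>S\<in>Pow E. bw p E S * exp (g S)) \<le> 1 / b"
  shows "(\<Sum>S\<in>Pow E. bw p E S * exp (l * f S + (1 - l) * g S)) \<le> exp (l * ln (b / a)) / b"
proof -
  have amgm: "exp (l * x + (1 - l) * y) \<le> l * exp x + (1 - l) * exp y" for x y :: real
    using convex_onD[OF convex_on_exp[of 1], of "1 - l" x y] assms(4,5)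
    by (simp add: algebra_simps)
  let ?c = "exp (l * ln (b / a)) / b"
  have eq: "exp (l * f S + (1 - l) * g S)
      = ?c * exp (l * (f S + ln a) + (1 - l) * (g S + ln b))" for S
  proof -
    have "1 / b = exp (- ln b)" using assms by (simp add: exp_minus inverse_eq_divide)
    then have "?c = exp (l * (ln b - ln a) - ln b)"
      using assms by (simp add: ln_div exp_diff)
    then show ?thesis
      by (simp add: algebra_simps flip: exp_add)
  qed
  have "exp (l * f S + (1 - l) * g S) \<le> ?c * (l * (a * exp (f S)) + (1 - l) * (b * exp (g S)))" for S
    unfolding eq using amgm[of "f S + ln a" "g S + ln b"] assms
    by (intro mult_left_mono) (auto simp: exp_add mult_ac)
  then have "(\<Sum>S\<in>Pow E. bw p E S * exp (l * f S + (1 - l) * g S))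
      \<le> (\<Sum>S\<in>Pow E. bw p E S * (?c * (l * (a * exp (f S)) + (1 - l) * (b * exp (g S)))))"
    using bw_nonneg[OF assms(2,3)] by (intro sum_mono mult_left_mono) auto
  also have "\<dots> = ?c * (l * a * (\<Sum>S\<in>Pow E. bw p E S * exp (f S))
      + (1 - l) * b * (\<Sum>S\<in>Pow E. bw p E S * exp (g S)))"
  proof -
    have "(\<Sum>S\<in>Pow E. bw p E S * (c * (l * (a * exp (f S)) + (1 - l) * (b * exp (g S)))))
        = c * (l * a * (\<Sum>S\<in>Pow E. bw p E S * exp (f S)) + (1 - l) * b * (\<Sum>S\<in>Pow E. bw p E S * exp (g S)))" for c
      by (simp add: sum_distrib_left distrib_left sum.distrib mult_ac)
    then show ?thesis .
  qed
  also have "\<dots> \<le> ?c * (l * a * (1 / a) + (1 - l) * b * (1 / b))"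
    using assms by (intro mult_left_mono add_mono f g) auto
  also have "\<dots> = ?c" using assms by simp
  finally show ?thesis .
qed

lemma square_convex_comb:
  fixes x y l :: real
  assumes "0 \<le> l" "l \<le> 1"
  shows "(l * x + (1 - l) * y)\<^sup>2 \<le> l * x\<^sup>2 + (1 - l) * y\<^sup>2"
proof -
  have "l * x\<^sup>2 + (1 - l) * y\<^sup>2 - (l * x + (1 - l) * y)\<^sup>2 = l * (1 - l) * (x - y)\<^sup>2"
    by (simp add: power2_eq_square algebra_simps)
  moreover have "0 \<le> l * (1 - l) * (x - y)\<^sup>2"
    using assms by simp
  ultimately show ?thesis by linarith
qed

text \<open>Treats the configurations with value \<open>b\<close> at \<open>e\<close>, the value of
  the lighter slice; \<open>a\<close> and \<open>b\<close> will be 1 and 0 in either order. Mixing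
  points of the two slices gives an error \<open>1 - l\<close> at \<open>e\<close>, while the other
  squared errors are bounded by convex combinations, so Hoelder's inequality and
  \<open>talagrand_two_point\<close> apply. If the lighter slice is empty only \<open>za\<close> is
  available, and the wrong coordinate costs exp (1/8) <= 2.\<close>

lemma talagrand_slice:
  fixes a b p :: real
  assumes "finite E" "0 \<le> p" "p \<le> 1" "e \<notin> E" "cvx C" "(a - b)\<^sup>2 = 1" "0 < Pa" "0 \<le> Pb" "Pb \<le> Pa"
    and za: "\<And>S. S \<subseteq> E \<Longrightarrow> (za S)(e := a) \<in> C"
    and za_sum: "(\<Sum>S\<in>Pow E. bw p E S * exp ((\<Sum>i\<in>E. (bern S i - za S i)\<^sup>2) / 8)) \<le> 1 / Pa"
    and zb: "\<And>S. 0 < Pb \<Longrightarrow> S \<subseteq> E \<Longrightarrow> (zb S)(e := b) \<in> C"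
    and zb_sum: "0 < Pb \<Longrightarrow> (\<Sum>S\<in>Pow E. bw p E S * exp ((\<Sum>i\<in>E. (bern S i - zb S i)\<^sup>2) / 8)) \<le> 1 / Pb"
  shows "\<exists>z. (\<forall>S. S \<subseteq> E \<longrightarrow> z S \<in> C) \<and>
    (\<Sum>S\<in>Pow E. bw p E S * exp (((b - z S e)\<^sup>2 + (\<Sum>i\<in>E. (bern S i - z S i)\<^sup>2)) / 8)) \<le> (2 - Pb / Pa) / Pa"
proof (cases "0 < Pb")
  case True
  define u where "u = ln (Pa / Pb)"
  have u: "0 \<le> u" "exp (- u) = Pb / Pa"
    using True assms by (auto simp: u_def exp_minus)
  obtain l where l: "0 \<le> l" "l \<le> 1" "exp ((1 - l)\<^sup>2 / 8 + l * u) \<le> 2 - exp (- u)"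
    using talagrand_two_point[OF u(1)] by blast
  define z where "z S = (\<lambda>i. l * ((zb S)(e := b)) i + (1 - l) * ((za S)(e := a)) i)" for S
  let ?f = "\<lambda>S. (\<Sum>i\<in>E. (bern S i - zb S i)\<^sup>2) / 8"
  let ?g = "\<lambda>S. (\<Sum>i\<in>E. (bern S i - za S i)\<^sup>2) / 8"
  have "((b - z S e)\<^sup>2 + (\<Sum>i\<in>E. (bern S i - z S i)\<^sup>2)) / 8 \<le> (1 - l)\<^sup>2 / 8 + (l * ?f S + (1 - l) * ?g S)" for S
  proof -
    have "b - z S e = (1 - l) * (b - a)" by (simp add: z_def algebra_simps)
    then have "(b - z S e)\<^sup>2 = (1 - l)\<^sup>2"
      using assms(6) by (simp add: power_mult_distrib power2_commute)
    moreover have "(\<Sum>i\<in>E. (bern S i - z S i)\<^sup>2)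
        \<le> (\<Sum>i\<in>E. l * (bern S i - zb S i)\<^sup>2 + (1 - l) * (bern S i - za S i)\<^sup>2)"
    proof (rule sum_mono)
      fix i assume "i \<in> E"
      then have "bern S i - z S i = l * (bern S i - zb S i) + (1 - l) * (bern S i - za S i)"
        using assms(4) by (auto simp: z_def algebra_simps)
      then show "(bern S i - z S i)\<^sup>2 \<le> l * (bern S i - zb S i)\<^sup>2 + (1 - l) * (bern S i - za S i)\<^sup>2"
        using square_convex_comb[OF l(1,2)] by simp
    qed
    moreover have "\<dots> = l * (\<Sum>i\<in>E. (bern S i - zb S i)\<^sup>2) + (1 - l) * (\<Sum>i\<in>E. (bern S i - za S i)\<^sup>2)"
      by (simp add: sum.distrib sum_distrib_left)
    ultimately show ?thesis by simp
  qed
  then have "(\<Sum>S\<in>Pow E. bw p E S * exp (((b - z S e)\<^sup>2 + (\<Sum>i\<in>E. (bern S i - z S i)\<^sup>2)) / 8))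
      \<le> (\<Sum>S\<in>Pow E. bw p E S * exp ((1 - l)\<^sup>2 / 8 + (l * ?f S + (1 - l) * ?g S)))"
    using bw_nonneg[OF assms(2,3)] by (intro sum_mono mult_left_mono) auto
  also have "\<dots> = exp ((1 - l)\<^sup>2 / 8) * (\<Sum>S\<in>Pow E. bw p E S * exp (l * ?f S + (1 - l) * ?g S))"
    by (simp add: exp_add sum_distrib_left mult_ac)
  also have "\<dots> \<le> exp ((1 - l)\<^sup>2 / 8) * (exp (l * ln (Pa / Pb)) / Pa)"
    using assms True l by (intro mult_left_mono bexp_exp_convex_comb) auto
  also have "\<dots> = exp ((1 - l)\<^sup>2 / 8 + l * u) / Pa"
    by (simp add: u_def exp_add)
  also have "\<dots> \<le> (2 - Pb / Pa) / Pa"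
    using l u assms by (intro divide_right_mono) auto
  finally have "(\<Sum>S\<in>Pow E. bw p E S * exp (((b - z S e)\<^sup>2 + (\<Sum>i\<in>E. (bern S i - z S i)\<^sup>2)) / 8)) \<le> (2 - Pb / Pa) / Pa" .
  moreover have "z S \<in> C" if "S \<subseteq> E" for S
    using assms(5) za[OF that] zb[OF True that] l unfolding cvx_def z_def by blast
  ultimately show ?thesis by blast
next
  case False
  then have Pb: "Pb = 0" using assms by simp
  define z where "z S = (za S)(e := a)" for S
  have "(\<Sum>i\<in>E. (bern S i - z S i)\<^sup>2) = (\<Sum>i\<in>E. (bern S i - za S i)\<^sup>2)" for S
    using assms(4) by (intro sum.cong) (auto simp: z_def)
  moreover have "(b - z S e)\<^sup>2 = 1" for S
    using assms(6) by (simp add: z_def power2_commute)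
  ultimately have "(\<Sum>S\<in>Pow E. bw p E S * exp (((b - z S e)\<^sup>2 + (\<Sum>i\<in>E. (bern S i - z S i)\<^sup>2)) / 8))
      = exp (1 / 8) * (\<Sum>S\<in>Pow E. bw p E S * exp ((\<Sum>i\<in>E. (bern S i - za S i)\<^sup>2) / 8))"
    by (simp add: add_divide_distrib exp_add sum_distrib_left mult_ac)
  also have "\<dots> \<le> 2 * (1 / Pa)"
  proof (rule mult_mono[OF _ za_sum])
    have "exp (1 / 8 :: real) \<le> 1 + 1 / 8 + (1 / 8)\<^sup>2"
      by (intro exp_bound) auto
    then show "exp (1 / 8 :: real) \<le> 2" by (simp add: power2_eq_square)
  qed (use assms in \<open>auto intro!: sum_nonneg mult_nonneg_nonneg bw_nonneg\<close>)
  finally have "(\<Sum>S\<in>Pow E. bw p E S * exp (((b - z S e)\<^sup>2 + (\<Sum>i\<in>E. (bern S i - z S i)\<^sup>2)) / 8)) \<le> (2 - Pb / Pa) / Pa"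
    by (simp add: Pb)
  then show ?thesis
    using za by (intro exI[of _ z]) (auto simp: z_def)
qed

text \<open>With \<open>x\<close> the ratio of the total mass to \<open>Pa\<close>, everything
  reduces to 2 - x <= 1 / x.\<close>

lemma talagrand_weights:
  fixes p P Pa Pb q :: real
  assumes "0 < Pa" "0 \<le> Pb" "Pb \<le> Pa" "0 < q" "q < 1"
    and "A \<le> 1 / Pa" "B \<le> (2 - Pb / Pa) / Pa"
  shows "q * A + (1 - q) * B \<le> 1 / (q * Pa + (1 - q) * Pb)"
proof -
  define x where "x = q + (1 - q) * (Pb / Pa)"
  have x: "0 < x" using assms by (auto simp: x_def intro!: add_pos_nonneg)
  have "q * A + (1 - q) * B \<le> q * (1 / Pa) + (1 - q) * ((2 - Pb / Pa) / Pa)"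
    using assms by (intro add_mono mult_left_mono) auto
  also have "\<dots> = (q + (1 - q) * (2 - Pb / Pa)) / Pa"
    by (simp add: add_divide_distrib)
  also have "q + (1 - q) * (2 - Pb / Pa) = 2 - x"
    unfolding x_def by (simp only: algebra_simps)
  also have "(2 - x) / Pa \<le> (1 / x) / Pa"
  proof (intro divide_right_mono)
    have "0 \<le> (x - 1)\<^sup>2" by simp
    then show "2 - x \<le> 1 / x"
      using x by (simp add: field_simps power2_eq_square)
  qed (use assms in auto)
  also have "\<dots> = 1 / (x * Pa)"
    by simp
  also have "x * Pa = q * Pa + (1 - q) * Pb"
    using assms(1) by (simp add: x_def distrib_right)
  finally show ?thesis .
qed

lemma bprob_insert:
  assumes "finite E" "e \<notin> E"
  shows "bprob p (insert e E) \<A> = p * bprob p E {S \<in> Pow E. insert e S \<in> \<A>} + (1 - p) * bprob p E \<A>"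
proof -
  have ind: "bprob p F \<B> = (\<Sum>S\<in>Pow F. bw p F S * of_bool (S \<in> \<B>))" if "finite F" for F :: "'a set" and \<B>
    unfolding bprob_def using that by (intro sum.mono_neutral_cong_left) auto
  show ?thesis
    unfolding ind[OF assms(1)] ind[OF finite.insertI[OF assms(1)]] bexp_insert[OF assms]
    by (auto intro!: arg_cong2[where f = "(+)"] sum.cong)
qed

lemma bprob_pos:
  assumes "finite E" "0 < p" "p < 1" "\<A> \<subseteq> Pow E" "\<A> \<noteq> {}"
  shows "0 < bprob p E \<A>"
proof -
  have "finite \<A>" using assms finite_subset by blast
  then show ?thesis
    unfolding bprob_def using assms by (intro sum_pos) (auto intro!: bw_pos simp: Int_absorb2)
qed

text \<open>In the induction the heavier of the two slices keeps its points; in the other one they are mixed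
  with those of the heavier slice, with the weight of \<open>talagrand_two_point\<close>.\<close>
theorem talagrand_convex:
  fixes p :: real
  assumes "finite E" "0 < p" "p < 1" "cvx C" "\<A> \<subseteq> Pow E" "\<A> \<noteq> {}" "\<And>S. S \<in> \<A> \<Longrightarrow> bern S \<in> C"
  shows "\<exists>z. (\<forall>S. S \<subseteq> E \<longrightarrow> z S \<in> C) \<and>
    (\<Sum>S\<in>Pow E. bw p E S * exp ((\<Sum>i\<in>E. (bern S i - z S i)\<^sup>2) / 8)) \<le> 1 / bprob p E \<A>"
  using assms(1,4-7)
proof (induction E arbitrary: C \<A>)
  case empty
  then have "\<A> = {{}}" by auto
  then show ?case
    using empty by (intro exI[of _ bern]) (auto simp: bprob_def bw_def)
next
  case (insert e E)
  define A1 where "A1 = {S \<in> Pow E. insert e S \<in> \<A>}"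
  define A0 where "A0 = \<A> \<inter> Pow E"
  \<comment> \<open>The section of \<open>C\<close> at value \<open>a\<close> of the new coordinate;
    the induction hypothesis is applied to these convex sets.\<close>
  define C' where "C' a = {u. u(e := a) \<in> C}" for a :: real
  have cvx': "cvx (C' a)" for a
    unfolding cvx_def
  proof (intro ballI allI impI)
    fix u v and l :: real
    assume *: "u \<in> C' a" "v \<in> C' a" "0 \<le> l \<and> l \<le> 1"
    have eq: "(\<lambda>i. l * u i + (1 - l) * v i)(e := a) = (\<lambda>i. l * (u(e := a)) i + (1 - l) * (v(e := a)) i)"
      by (auto simp: fun_eq_iff algebra_simps)
    then show "(\<lambda>i. l * u i + (1 - l) * v i) \<in> C' a"
      using * insert.prems(1) unfolding C'_def cvx_def mem_Collect_eq eq by blast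
  qed
  have in1: "bern S \<in> C' 1" if "S \<in> A1" for S
  proof -
    have "(bern S)(e := 1) = bern (insert e S)" by (auto simp: bern_def fun_eq_iff)
    then show ?thesis using that insert.prems(4) by (auto simp: C'_def A1_def)
  qed
  have in0: "bern S \<in> C' 0" if "S \<in> A0" for S
  proof -
    have "(bern S)(e := 0) = bern S" using that insert.hyps by (auto simp: bern_def fun_eq_iff A0_def)
    then show ?thesis using that insert.prems(4) by (auto simp: C'_def A0_def)
  qed
  have IH1: "\<exists>z. (\<forall>S. S \<subseteq> E \<longrightarrow> (z S)(e := 1) \<in> C) \<and>
      (\<Sum>S\<in>Pow E. bw p E S * exp ((\<Sum>i\<in>E. (bern S i - z S i)\<^sup>2) / 8)) \<le> 1 / bprob p E A1"
    if "A1 \<noteq> {}"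
    using insert.IH[OF cvx' _ that in1] by (auto simp: C'_def A1_def)
  have IH0: "\<exists>z. (\<forall>S. S \<subseteq> E \<longrightarrow> (z S)(e := 0) \<in> C) \<and>
      (\<Sum>S\<in>Pow E. bw p E S * exp ((\<Sum>i\<in>E. (bern S i - z S i)\<^sup>2) / 8)) \<le> 1 / bprob p E A0"
    if "A0 \<noteq> {}"
    using insert.IH[OF cvx' _ that in0] by (auto simp: C'_def A0_def)
  let ?P1 = "bprob p E A1" and ?P0 = "bprob p E A0"
  have P: "bprob p (insert e E) \<A> = p * ?P1 + (1 - p) * ?P0"
    using insert.hyps by (simp add: bprob_insert A1_def A0_def) (simp add: bprob_def)
  have ne: "A \<noteq> {} \<longleftrightarrow> 0 < bprob p E A" if "A \<subseteq> Pow E" for A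
    using bprob_pos[OF insert.hyps(1) assms(2,3) that] by (auto simp: bprob_def)
  have sub: "A1 \<subseteq> Pow E" "A0 \<subseteq> Pow E" by (auto simp: A1_def A0_def)
  \<comment> \<open>The implication stands under the quantifier so that an empty slice, about which
    the induction hypothesis says nothing, still has some \<open>z\<close>.\<close>
  have IH1': "\<exists>z. 0 < ?P1 \<longrightarrow> (\<forall>S. S \<subseteq> E \<longrightarrow> (z S)(e := 1) \<in> C) \<and>
      (\<Sum>S\<in>Pow E. bw p E S * exp ((\<Sum>i\<in>E. (bern S i - z S i)\<^sup>2) / 8)) \<le> 1 / ?P1"
  proof (cases "0 < ?P1")
    case True
    then have "A1 \<noteq> {}" using ne[OF sub(1)] by simp
    from IH1[OF this] show ?thesis by blast
  qed auto
  have IH0': "\<exists>z. 0 < ?P0 \<longrightarrow> (\<forall>S. S \<subseteq> E \<longrightarrow> (z S)(e := 0) \<in> C) \<and>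
      (\<Sum>S\<in>Pow E. bw p E S * exp ((\<Sum>i\<in>E. (bern S i - z S i)\<^sup>2) / 8)) \<le> 1 / ?P0"
  proof (cases "0 < ?P0")
    case True
    then have "A0 \<noteq> {}" using ne[OF sub(2)] by simp
    from IH0[OF this] show ?thesis by blast
  qed auto
  have nonneg: "0 \<le> ?P1" "0 \<le> ?P0" using assms by (auto intro: bprob_nonneg)
  have "A1 \<noteq> {} \<or> A0 \<noteq> {}"
  proof -
    obtain S where S: "S \<in> \<A>" using insert.prems by blast
    then have "S \<subseteq> insert e E" using insert.prems by blast
    then show ?thesis
      using S by (cases "e \<in> S") (auto simp: A1_def A0_def insert_absorb intro!: exI[of _ "S - {e}"])
  qed
  then have pos: "0 < ?P1 \<or> 0 < ?P0" using ne sub by blast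
  have "\<exists>z1 z0. (\<forall>S. S \<subseteq> E \<longrightarrow> z1 S \<in> C \<and> z0 S \<in> C) \<and>
     p * (\<Sum>S\<in>Pow E. bw p E S * exp (((1 - z1 S e)\<^sup>2 + (\<Sum>i\<in>E. (bern S i - z1 S i)\<^sup>2)) / 8))
     + (1 - p) * (\<Sum>S\<in>Pow E. bw p E S * exp (((0 - z0 S e)\<^sup>2 + (\<Sum>i\<in>E. (bern S i - z0 S i)\<^sup>2)) / 8))
     \<le> 1 / (p * ?P1 + (1 - p) * ?P0)"
  proof (cases "?P0 \<le> ?P1")
    case True
    then have P1: "0 < ?P1" using pos nonneg by linarith
    obtain za where za: "\<And>S. S \<subseteq> E \<Longrightarrow> (za S)(e := 1) \<in> C"
      "(\<Sum>S\<in>Pow E. bw p E S * exp ((\<Sum>i\<in>E. (bern S i - za S i)\<^sup>2) / 8)) \<le> 1 / ?P1"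
      using IH1' P1 by blast
    obtain zb where zb: "\<And>S. 0 < ?P0 \<Longrightarrow> S \<subseteq> E \<Longrightarrow> (zb S)(e := 0) \<in> C"
      "0 < ?P0 \<Longrightarrow> (\<Sum>S\<in>Pow E. bw p E S * exp ((\<Sum>i\<in>E. (bern S i - zb S i)\<^sup>2) / 8)) \<le> 1 / ?P0"
      using IH0' by blast
    obtain z0 where z0: "\<And>S. S \<subseteq> E \<Longrightarrow> z0 S \<in> C"
      "(\<Sum>S\<in>Pow E. bw p E S * exp (((0 - z0 S e)\<^sup>2 + (\<Sum>i\<in>E. (bern S i - z0 S i)\<^sup>2)) / 8))
        \<le> (2 - ?P0 / ?P1) / ?P1"
      using talagrand_slice[of E p e C 1 0 ?P1 ?P0 za zb] insert.hyps insert.prems(1) assms(2,3) True P1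
        nonneg za zb by (auto simp: )
    define z1 where "z1 S = (za S)(e := 1)" for S
    have "(\<Sum>i\<in>E. (bern S i - z1 S i)\<^sup>2) = (\<Sum>i\<in>E. (bern S i - za S i)\<^sup>2)" for S
      using insert.hyps by (intro sum.cong) (auto simp: z1_def)
    then have z1: "(\<Sum>S\<in>Pow E. bw p E S * exp (((1 - z1 S e)\<^sup>2 + (\<Sum>i\<in>E. (bern S i - z1 S i)\<^sup>2)) / 8)) \<le> 1 / ?P1"
      using za(2) by (simp add: z1_def)
    have "z1 S \<in> C" if "S \<subseteq> E" for S using za(1)[OF that] by (simp add: z1_def)
    then show ?thesis
      using talagrand_weights[OF P1 nonneg(2) True assms(2,3) z1 z0(2)] z0(1) by blast
  next
    case False
    then have P0: "0 < ?P0" and le: "?P1 \<le> ?P0" using nonneg by linarith+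
    obtain za where za: "\<And>S. S \<subseteq> E \<Longrightarrow> (za S)(e := 0) \<in> C"
      "(\<Sum>S\<in>Pow E. bw p E S * exp ((\<Sum>i\<in>E. (bern S i - za S i)\<^sup>2) / 8)) \<le> 1 / ?P0"
      using IH0' P0 by blast
    obtain zb where zb: "\<And>S. 0 < ?P1 \<Longrightarrow> S \<subseteq> E \<Longrightarrow> (zb S)(e := 1) \<in> C"
      "0 < ?P1 \<Longrightarrow> (\<Sum>S\<in>Pow E. bw p E S * exp ((\<Sum>i\<in>E. (bern S i - zb S i)\<^sup>2) / 8)) \<le> 1 / ?P1"
      using IH1' by blast
    obtain z1 where z1: "\<And>S. S \<subseteq> E \<Longrightarrow> z1 S \<in> C"
      "(\<Sum>S\<in>Pow E. bw p E S * exp (((1 - z1 S e)\<^sup>2 + (\<Sum>i\<in>E. (bern S i - z1 S i)\<^sup>2)) / 8))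
        \<le> (2 - ?P1 / ?P0) / ?P0"
      using talagrand_slice[of E p e C 0 1 ?P0 ?P1 za zb] insert.hyps insert.prems(1) assms(2,3) le P0
        nonneg za zb by (auto simp: )
    define z0 where "z0 S = (za S)(e := 0)" for S
    have "(\<Sum>i\<in>E. (bern S i - z0 S i)\<^sup>2) = (\<Sum>i\<in>E. (bern S i - za S i)\<^sup>2)" for S
      using insert.hyps by (intro sum.cong) (auto simp: z0_def)
    then have z0: "(\<Sum>S\<in>Pow E. bw p E S * exp (((0 - z0 S e)\<^sup>2 + (\<Sum>i\<in>E. (bern S i - z0 S i)\<^sup>2)) / 8)) \<le> 1 / ?P0"
      using za(2) by (simp add: z0_def)
    have "z0 S \<in> C" if "S \<subseteq> E" for S using za(1)[OF that] by (simp add: z0_def)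
    then show ?thesis
      using talagrand_weights[OF P0 nonneg(1) le _ _ z0 z1(2), of "1 - p"] z1(1) assms(2,3)
      by (simp add: add.commute) blast
  qed
  then obtain z1 z0 where z: "\<And>S. S \<subseteq> E \<Longrightarrow> z1 S \<in> C" "\<And>S. S \<subseteq> E \<Longrightarrow> z0 S \<in> C"
    and z_sum: "p * (\<Sum>S\<in>Pow E. bw p E S * exp (((1 - z1 S e)\<^sup>2 + (\<Sum>i\<in>E. (bern S i - z1 S i)\<^sup>2)) / 8))
     + (1 - p) * (\<Sum>S\<in>Pow E. bw p E S * exp (((0 - z0 S e)\<^sup>2 + (\<Sum>i\<in>E. (bern S i - z0 S i)\<^sup>2)) / 8))
     \<le> 1 / (p * ?P1 + (1 - p) * ?P0)"
    by blast
  define z where "z S = (if e \<in> S then z1 (S - {e}) else z0 S)" for S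
  have "(\<Sum>S\<in>Pow (insert e E). bw p (insert e E) S * exp ((\<Sum>i\<in>insert e E. (bern S i - z S i)\<^sup>2) / 8))
    = p * (\<Sum>S\<in>Pow E. bw p E S * exp (((1 - z1 S e)\<^sup>2 + (\<Sum>i\<in>E. (bern S i - z1 S i)\<^sup>2)) / 8))
     + (1 - p) * (\<Sum>S\<in>Pow E. bw p E S * exp (((0 - z0 S e)\<^sup>2 + (\<Sum>i\<in>E. (bern S i - z0 S i)\<^sup>2)) / 8))"
  proof -
    have 1: "(\<Sum>i\<in>insert e E. (bern (insert e S) i - z (insert e S) i)\<^sup>2)
        = (1 - z1 S e)\<^sup>2 + (\<Sum>i\<in>E. (bern S i - z1 S i)\<^sup>2)" if "S \<subseteq> E" for S
    proof -
      have S: "insert e S - {e} = S" using that insert.hyps by auto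
      have "(\<Sum>i\<in>E. (bern (insert e S) i - z1 S i)\<^sup>2) = (\<Sum>i\<in>E. (bern S i - z1 S i)\<^sup>2)"
        using insert.hyps by (intro sum.cong) (auto simp: bern_def)
      then show ?thesis using insert.hyps S by (simp add: z_def) (simp add: bern_def)
    qed
    have 0: "(\<Sum>i\<in>insert e E. (bern S i - z S i)\<^sup>2)
        = (0 - z0 S e)\<^sup>2 + (\<Sum>i\<in>E. (bern S i - z0 S i)\<^sup>2)" if "S \<subseteq> E" for S
    proof -
      have S: "e \<notin> S" using that insert.hyps by auto
      then show ?thesis using insert.hyps by (simp add: z_def) (simp add: bern_def)
    qed
    have "(\<Sum>S\<in>Pow E. bw p E S * exp ((\<Sum>i\<in>insert e E. (bern (insert e S) i - z (insert e S) i)\<^sup>2) / 8))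
      = (\<Sum>S\<in>Pow E. bw p E S * exp (((1 - z1 S e)\<^sup>2 + (\<Sum>i\<in>E. (bern S i - z1 S i)\<^sup>2)) / 8))"
      by (intro sum.cong refl) (simp only: 1 Pow_iff)
    moreover have "(\<Sum>S\<in>Pow E. bw p E S * exp ((\<Sum>i\<in>insert e E. (bern S i - z S i)\<^sup>2) / 8))
      = (\<Sum>S\<in>Pow E. bw p E S * exp (((0 - z0 S e)\<^sup>2 + (\<Sum>i\<in>E. (bern S i - z0 S i)\<^sup>2)) / 8))"
      by (intro sum.cong refl) (simp only: 0 Pow_iff)
    ultimately show ?thesis
      by (simp only: bexp_insert[OF insert.hyps])
  qed
  then have "(\<Sum>S\<in>Pow (insert e E). bw p (insert e E) S * exp ((\<Sum>i\<in>insert e E. (bern S i - z S i)\<^sup>2) / 8))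
      \<le> 1 / bprob p (insert e E) \<A>"
    using z_sum P by simp
  moreover have "z S \<in> C" if "S \<subseteq> insert e E" for S
    using z(1)[of "S - {e}"] z(2)[of S] that by (auto simp: z_def)
  ultimately show ?case by blast
qed

section \<open>The entropy bound\<close>

text \<open>The finite branch of \<open>rate_I\<close>, meant for \<open>x\<close> in
  [0, 1].\<close>

definition rI :: "real \<Rightarrow> real \<Rightarrow> real" where
  "rI p x = x * ln (x / p) + (1 - x) * ln ((1 - x) / (1 - p))"

definition cmean :: "real \<Rightarrow> 'a set \<Rightarrow> 'a set set \<Rightarrow> 'a \<Rightarrow> real" where
  "cmean p E \<A> e = (\<Sum>S\<in>\<A>. bw p E S * bern S e) / bprob p E \<A>"

lemma cmean_range:
  assumes "finite E" "0 < p" "p < 1" "\<A> \<subseteq> Pow E" "\<A> \<noteq> {}"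
  shows "0 \<le> cmean p E \<A> e" "cmean p E \<A> e \<le> 1"
proof -
  have pos: "0 < bprob p E \<A>" by (rule bprob_pos) fact+
  have "(\<Sum>S\<in>\<A>. bw p E S * bern S e) \<le> (\<Sum>S\<in>\<A>. bw p E S)"
    using assms by (intro sum_mono) (auto simp: bern_def bw_nonneg)
  also have "\<dots> = bprob p E \<A>"
    using assms by (simp add: bprob_def Int_absorb2)
  finally show "cmean p E \<A> e \<le> 1" using pos by (simp add: cmean_def)
  show "0 \<le> cmean p E \<A> e"
    using assms pos by (auto simp: cmean_def bern_def bw_nonneg intro!: divide_nonneg_pos sum_nonneg)
qed

text \<open>The relative entropy of the conditional law with respect to the product law is
  \<open>- ln (bprob p E \<A>)\<close>, and it dominates the relative entropies of the marginals.\<close>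
theorem bprob_le_exp_rate:
  fixes p :: real
  assumes "finite E" "0 < p" "p < 1" "\<A> \<subseteq> Pow E" "\<A> \<noteq> {}"
  shows "bprob p E \<A> \<le> exp (- (\<Sum>e\<in>E. rI p (cmean p E \<A> e)))"
proof -
  define y where "y = cmean p E \<A>"
  define \<mu> where "\<mu> = bprob p E \<A>"
  have fin: "finite \<A>" using assms finite_subset by blast
  have pos: "0 < \<mu>" unfolding \<mu>_def by (rule bprob_pos) fact+
  have y01: "0 \<le> y e" "y e \<le> 1" for e
    using cmean_range[OF assms] by (auto simp: y_def)
  have mu: "\<mu> = (\<Sum>S\<in>\<A>. bw p E S)"
    using assms by (simp add: \<mu>_def bprob_def Int_absorb2)
  have ysum: "(\<Sum>S\<in>\<A>. bw p E S * bern S e) = \<mu> * y e" for e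
    using pos by (simp add: y_def cmean_def \<mu>_def)
  have ysum': "(\<Sum>S\<in>\<A>. bw p E S * (1 - bern S e)) = \<mu> * (1 - y e)" for e
    using ysum[of e] mu by (simp add: right_diff_distrib sum_subtractf)
  \<comment> \<open>\<open>l S\<close> is the log-density at \<open>S\<close>, relative to
    \<open>bw\<close>, of the product law with marginals \<open>y\<close>; its conditional average
    is the total rate \<open>m\<close>.\<close>
  define l where "l S = (\<Sum>e\<in>E. bern S e * ln (y e / p) + (1 - bern S e) * ln ((1 - y e) / (1 - p)))" for S
  define m where "m = (\<Sum>e\<in>E. rI p (y e))"
  have avg: "(\<Sum>S\<in>\<A>. bw p E S * l S) = \<mu> * m"
  proof -
    have "(\<Sum>S\<in>\<A>. bw p E S * l S) = (\<Sum>e\<in>E. \<Sum>S\<in>\<A>. bw p E S * bern S e * ln (y e / p)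
        + bw p E S * (1 - bern S e) * ln ((1 - y e) / (1 - p)))"
      unfolding l_def sum_distrib_left by (subst sum.swap) (simp add: algebra_simps)
    also have "\<dots> = (\<Sum>e\<in>E. \<mu> * y e * ln (y e / p) + \<mu> * (1 - y e) * ln ((1 - y e) / (1 - p)))"
      by (simp only: sum.distrib flip: sum_distrib_right) (simp only: ysum ysum')
    finally show ?thesis
      by (simp add: m_def rI_def sum_distrib_left algebra_simps)
  qed
  \<comment> \<open>Since \<open>S\<close> itself has positive conditional weight, \<open>y\<close>
    is positive on \<open>S\<close> and below 1 off \<open>S\<close>, so no logarithm of 0
    occurs.\<close>
  have dens: "bw p E S * exp (l S) = (\<Prod>e\<in>S. y e) * (\<Prod>e\<in>E - S. 1 - y e)" if "S \<in> \<A>" for S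
  proof -
    have S: "S \<subseteq> E" using that assms by auto
    have ne: "bw p E S \<noteq> 0" using assms bw_pos[of p E S] by simp
    have yin: "0 < y e" if "e \<in> S" for e
    proof -
      have "0 < (\<Sum>S\<in>\<A>. bw p E S * bern S e)"
        by (rule sum_pos2[OF fin \<open>S \<in> \<A>\<close>])
          (use that assms bw_pos[of p E] in \<open>auto simp: bern_def less_imp_le\<close>)
      then show ?thesis using pos by (simp add: ysum zero_less_mult_iff)
    qed
    have yout: "y e < 1" if "e \<in> E - S" for e
    proof -
      have "0 < (\<Sum>S\<in>\<A>. bw p E S * (1 - bern S e))"
        by (rule sum_pos2[OF fin \<open>S \<in> \<A>\<close>])
          (use that assms bw_pos[of p E] in \<open>auto simp: bern_def less_imp_le\<close>)
      then show ?thesis using pos by (simp add: ysum' zero_less_mult_iff)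
    qed
    have "l S = (\<Sum>e\<in>S. ln (y e / p)) + (\<Sum>e\<in>E - S. ln ((1 - y e) / (1 - p)))"
      unfolding l_def by (subst sum.subset_diff[OF S assms(1)]) (simp add: bern_def)
    then have "exp (l S) = (\<Prod>e\<in>S. exp (ln (y e / p))) * (\<Prod>e\<in>E - S. exp (ln ((1 - y e) / (1 - p))))"
      using finite_subset[OF S assms(1)] assms(1) by (simp add: exp_add exp_sum)
    also have "\<dots> = (\<Prod>e\<in>S. y e / p) * (\<Prod>e\<in>E - S. (1 - y e) / (1 - p))"
      using yin yout assms by (intro arg_cong2[where f = "(*)"] prod.cong refl exp_ln) auto
    also have "\<dots> = (\<Prod>e\<in>S. y e) * (\<Prod>e\<in>E - S. 1 - y e) / bw p E S"
      by (simp add: prod_dividef bw_def)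
    finally show ?thesis using ne by simp
  qed
  \<comment> \<open>Jensen's inequality through the tangent of exp at \<open>m\<close>: the linear
    function averages to \<open>exp m\<close>, while the terms with exp are masses of a product law
    and sum to at most 1.\<close>
  have "exp m * \<mu> = (\<Sum>S\<in>\<A>. bw p E S * (exp m * (1 + (l S - m))))"
  proof -
    have "(\<Sum>S\<in>\<A>. bw p E S * (exp m * (1 + (l S - m))))
        = exp m * ((\<Sum>S\<in>\<A>. bw p E S) + (\<Sum>S\<in>\<A>. bw p E S * l S) - m * (\<Sum>S\<in>\<A>. bw p E S))"
      by (simp add: sum_distrib_left sum.distrib sum_subtractf algebra_simps)
    then show ?thesis by (simp only: avg flip: mu) (simp add: algebra_simps)
  qed
  also have "\<dots> \<le> (\<Sum>S\<in>\<A>. bw p E S * exp (l S))"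
  proof (intro sum_mono mult_left_mono)
    fix S
    have "exp m * (1 + (l S - m)) \<le> exp m * exp (l S - m)"
      by (intro mult_left_mono exp_ge_add_one_self) auto
    then show "exp m * (1 + (l S - m)) \<le> exp (l S)"
      by (simp add: exp_diff)
  qed (use assms in \<open>auto intro: bw_nonneg\<close>)
  also have "\<dots> = (\<Sum>S\<in>\<A>. (\<Prod>e\<in>S. y e) * (\<Prod>e\<in>E - S. 1 - y e))"
    by (simp add: dens)
  also have "\<dots> \<le> (\<Sum>S\<in>Pow E. (\<Prod>e\<in>S. y e) * (\<Prod>e\<in>E - S. 1 - y e))"
    using assms y01 by (intro sum_mono2) (auto intro!: mult_nonneg_nonneg prod_nonneg)
  also have "\<dots> = (\<Prod>e\<in>E. y e + (1 - y e))"
    by (rule prod_add[symmetric]) fact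
  finally have "exp m * \<mu> \<le> 1" by simp
  then have "\<mu> \<le> exp (- m)"
    by (simp add: exp_minus field_simps)
  then show ?thesis by (simp add: \<mu>_def m_def y_def)
qed

section \<open>Approximation by matrices of small rank\<close>

text \<open>\<open>c\<close> bounds the square of the operator norm; the quadratic form stands in
  for singular values.\<close>

definition opb :: "nat \<Rightarrow> fmat \<Rightarrow> real \<Rightarrow> bool" where
  "opb n R c \<longleftrightarrow> (\<forall>x. (\<Sum>i<n. (\<Sum>j<n. R i j * x j)\<^sup>2) \<le> c * (\<Sum>j<n. (x j)\<^sup>2))"

definition lowrank :: "nat \<Rightarrow> (nat \<Rightarrow> nat \<Rightarrow> real) \<Rightarrow> (nat \<Rightarrow> nat \<Rightarrow> real) \<Rightarrow> fmat" where
  "lowrank k w u = (\<lambda>i j. \<Sum>l<k. w l i * u l j)"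

lemma fro_rank_one_update:
  fixes R :: fmat and u :: "nat \<Rightarrow> real"
  assumes "(\<Sum>j<n. (u j)\<^sup>2) = 1"
  defines "w \<equiv> \<lambda>i. \<Sum>j<n. R i j * u j"
  shows "(fro n (R - (\<lambda>i j. w i * u j)))\<^sup>2 = (fro n R)\<^sup>2 - (\<Sum>i<n. (w i)\<^sup>2)"
proof -
  have "(\<Sum>j<n. (R i j - w i * u j)\<^sup>2) = (\<Sum>j<n. (R i j)\<^sup>2) - (w i)\<^sup>2" for i
  proof -
    have "(\<Sum>j<n. (R i j - w i * u j)\<^sup>2)
        = (\<Sum>j<n. (R i j)\<^sup>2 - 2 * w i * (R i j * u j) + (w i)\<^sup>2 * (u j)\<^sup>2)"
      by (simp add: power2_eq_square algebra_simps)
    also have "\<dots> = (\<Sum>j<n. (R i j)\<^sup>2) - 2 * w i * (\<Sum>j<n. R i j * u j) + (w i)\<^sup>2 * (\<Sum>j<n. (u j)\<^sup>2)"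
      by (simp add: sum.distrib sum_subtractf sum_distrib_left)
    also have "(\<Sum>j<n. R i j * u j) = w i" by (simp add: w_def)
    finally show ?thesis using assms(1) by (simp add: power2_eq_square)
  qed
  then show ?thesis by (simp add: fro_sq' sum_subtractf)
qed

text \<open>If \<open>|R x|\<^sup>2 > c |x|\<^sup>2\<close>, subtracting \<open>(R u) u\<^sup>T\<close> with \<open>u = x / |x|\<close> lowers the squared Frobenius
  norm by more than \<open>c\<close>.\<close>
lemma lowrank_greedy:
  "\<exists>w u. (\<forall>l<k. \<forall>i<n. \<bar>w l i\<bar> \<le> fro n D \<and> \<bar>u l i\<bar> \<le> 1) \<and>
     fro n (D - lowrank k w u) \<le> fro n D \<and>
     (opb n (D - lowrank k w u) c \<or> (fro n (D - lowrank k w u))\<^sup>2 \<le> (fro n D)\<^sup>2 - k * c)"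
proof (induction k)
  case 0
  have "D - lowrank 0 w u = D" for w u
    by (simp add: lowrank_def fun_eq_iff)
  then show ?case by simp
next
  case (Suc k)
  then obtain w u where wu: "\<And>l i. l < k \<Longrightarrow> i < n \<Longrightarrow> \<bar>w l i\<bar> \<le> fro n D \<and> \<bar>u l i\<bar> \<le> 1"
    "fro n (D - lowrank k w u) \<le> fro n D"
    "opb n (D - lowrank k w u) c \<or> (fro n (D - lowrank k w u))\<^sup>2 \<le> (fro n D)\<^sup>2 - k * c"
    by blast
  define R where "R = D - lowrank k w u"
  have ext: "D - lowrank (Suc k) (w(k := w')) (u(k := u')) = R - (\<lambda>i j. w' i * u' j)" for w' u'
    by (simp add: lowrank_def R_def fun_eq_iff)
  have step: ?case
    if "\<And>i. i < n \<Longrightarrow> \<bar>w' i\<bar> \<le> fro n D \<and> \<bar>u' i\<bar> \<le> 1" "fro n (R - (\<lambda>i j. w' i * u' j)) \<le> fro n D"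
      "opb n (R - (\<lambda>i j. w' i * u' j)) c
        \<or> (fro n (R - (\<lambda>i j. w' i * u' j)))\<^sup>2 \<le> (fro n D)\<^sup>2 - real (Suc k) * c" for w' u'
  proof (intro exI conjI)
    show "\<forall>l<Suc k. \<forall>i<n. \<bar>(w(k := w')) l i\<bar> \<le> fro n D \<and> \<bar>(u(k := u')) l i\<bar> \<le> 1"
      using wu(1) that(1) by (simp add: less_Suc_eq)
  qed (use that(2,3) in \<open>simp_all only: ext\<close>)
  show ?case
  proof (cases "opb n R c")
    case True
    \<comment> \<open>Once the operator bound holds, a zero term pads the sum to
      \<open>Suc k\<close> terms.\<close>
    have eq: "R - (\<lambda>i j. 0 * 0) = R" by (simp add: fun_eq_iff)
    show ?thesis
      by (rule step[of "\<lambda>_. 0" "\<lambda>_. 0"]; (unfold eq)?) (use wu(2) True in \<open>simp_all add: R_def\<close>)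
  next
    case False
    then obtain x where x: "c * (\<Sum>j<n. (x j)\<^sup>2) < (\<Sum>i<n. (\<Sum>j<n. R i j * x j)\<^sup>2)"
      unfolding opb_def by (auto simp: not_le)
    define q where "q = (\<Sum>j<n. (x j)\<^sup>2)"
    have "q \<noteq> 0"
    proof
      assume "q = 0"
      then have "\<forall>j\<in>{..<n}. (x j)\<^sup>2 = 0"
        unfolding q_def by (subst (asm) sum_nonneg_eq_0_iff) auto
      then have "(\<Sum>i<n. (\<Sum>j<n. R i j * x j)\<^sup>2) = 0" by simp
      then show False using x \<open>q = 0\<close> by (simp add: q_def)
    qed
    moreover have "0 \<le> q" unfolding q_def by (intro sum_nonneg) auto
    ultimately have q: "0 < q" by simp
    define u' where "u' j = x j / sqrt q" for j
    define w' where "w' i = (\<Sum>j<n. R i j * u' j)" for i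
    have u1: "(\<Sum>j<n. (u' j)\<^sup>2) = 1"
      using q by (simp add: u'_def power_divide sum_divide_distrib[symmetric] flip: q_def)
    have "w' i = (\<Sum>j<n. R i j * x j) / sqrt q" for i
      by (simp add: w'_def u'_def sum_divide_distrib)
    then have "(w' i)\<^sup>2 = (\<Sum>j<n. R i j * x j)\<^sup>2 / q" for i
      using q by (simp only: power_divide) simp
    then have "(\<Sum>i<n. (w' i)\<^sup>2) = (\<Sum>i<n. (\<Sum>j<n. R i j * x j)\<^sup>2) / q"
      by (simp only: sum_divide_distrib)
    then have w_gt: "c < (\<Sum>i<n. (w' i)\<^sup>2)"
      using x q by (simp add: pos_less_divide_eq flip: q_def)
    have upd: "(fro n (R - (\<lambda>i j. w' i * u' j)))\<^sup>2 = (fro n R)\<^sup>2 - (\<Sum>i<n. (w' i)\<^sup>2)"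
      using fro_rank_one_update[OF u1, of R] by (simp add: w'_def)
    have nonneg: "0 \<le> (\<Sum>i<n. (w' i)\<^sup>2)" by (intro sum_nonneg) auto
    have le: "fro n (R - (\<lambda>i j. w' i * u' j)) \<le> fro n R"
      by (rule power2_le_imp_le) (use upd nonneg in linarith, simp)
    have RD: "fro n R \<le> fro n D" using wu by (simp add: R_def)
    have u'_le: "\<bar>u' i\<bar> \<le> 1" if "i < n" for i
    proof -
      have "(u' i)\<^sup>2 \<le> (\<Sum>j<n. (u' j)\<^sup>2)"
        using that by (intro member_le_sum) auto
      then show ?thesis using u1 by (simp add: abs_square_le_1)
    qed
    have w'_le: "\<bar>w' i\<bar> \<le> fro n D" if "i < n" for i
    proof -
      have "(w' i)\<^sup>2 \<le> (\<Sum>i<n. (w' i)\<^sup>2)"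
        using that by (intro member_le_sum) auto
      also have "\<dots> \<le> (fro n R)\<^sup>2"
        using upd zero_le_power2[of "fro n (R - (\<lambda>i j. w' i * u' j))"] by linarith
      finally have "\<bar>w' i\<bar> \<le> \<bar>fro n R\<bar>" by (simp only: abs_le_square_iff)
      then show ?thesis using RD by simp
    qed
    have "opb n R c \<or> (fro n R)\<^sup>2 \<le> (fro n D)\<^sup>2 - k * c" using wu by (simp add: R_def)
    then have "(fro n (R - (\<lambda>i j. w' i * u' j)))\<^sup>2 \<le> (fro n D)\<^sup>2 - real (Suc k) * c"
      using False upd w_gt by (simp add: algebra_simps)
    then show ?thesis
      using le RD u'_le w'_le by (intro step[of w' u']) auto
  qed
qed

lemma s4_pow4: "s4 n A ^ 4 = (fro n (mmul n A (tp A)))\<^sup>2"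
proof -
  have "s4 n A ^ 4 = ((s4 n A)\<^sup>2)\<^sup>2" by (simp flip: power_mult)
  then show ?thesis by (simp only: s4_sq)
qed

text \<open>The squared norm of R R^T is the sum of |R r|^2 over the rows r of \<open>R\<close>, and
  each summand is at most c |r|^2.\<close>

lemma s4_pow4_le_of_opb:
  assumes "opb n R c"
  shows "s4 n R ^ 4 \<le> c * (fro n R)\<^sup>2"
proof -
  have "s4 n R ^ 4 = (fro n (mmul n R (tp R)))\<^sup>2"
    by (rule s4_pow4)
  also have "\<dots> = (\<Sum>j<n. \<Sum>i<n. (\<Sum>k<n. R i k * R j k)\<^sup>2)"
    unfolding fro_sq' mmul_def tp_def by (rule sum.swap)
  also have "\<dots> \<le> (\<Sum>j<n. c * (\<Sum>k<n. (R j k)\<^sup>2))"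
    using assms unfolding opb_def by (intro sum_mono) blast
  also have "\<dots> = c * (fro n R)\<^sup>2" by (simp add: fro_sq' sum_distrib_left)
  finally show ?thesis .
qed

text \<open>The threshold c = s^2 / r^4 balances the two outcomes of \<open>lowrank_greedy\<close>:
  r^4 steps that each gain \<open>c\<close> exhaust the budget s^2, and otherwise the fourth power
  of the 4-norm is at most c s^2 = (s / r)^4.\<close>

lemma lowrank_s4:
  assumes "0 < r" "fro n D \<le> s"
  shows "\<exists>w u. (\<forall>l<r ^ 4. \<forall>i<n. \<bar>w l i\<bar> \<le> s \<and> \<bar>u l i\<bar> \<le> 1) \<and> s4 n (D - lowrank (r ^ 4) w u) \<le> s / real r"
proof -
  define c where "c = s\<^sup>2 / real r ^ 4"
  have s: "0 \<le> s" using assms(2) order.trans[OF fro_nonneg] by blast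
  obtain w u where wu: "\<And>l i. l < r ^ 4 \<Longrightarrow> i < n \<Longrightarrow> \<bar>w l i\<bar> \<le> fro n D \<and> \<bar>u l i\<bar> \<le> 1"
    "fro n (D - lowrank (r ^ 4) w u) \<le> fro n D"
    "opb n (D - lowrank (r ^ 4) w u) c
      \<or> (fro n (D - lowrank (r ^ 4) w u))\<^sup>2 \<le> (fro n D)\<^sup>2 - real (r ^ 4) * c"
    using lowrank_greedy[of "r ^ 4" n D c] by blast
  let ?R = "D - lowrank (r ^ 4) w u"
  have "s4 n ?R \<le> s / real r"
    using wu(3)
  proof
    assume "opb n ?R c"
    then have "s4 n ?R ^ 4 \<le> c * (fro n ?R)\<^sup>2" by (rule s4_pow4_le_of_opb)
    also have "\<dots> \<le> c * s\<^sup>2"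
      using wu(2) assms by (intro mult_left_mono power_mono) (auto simp: c_def)
    also have "\<dots> = (s / real r) ^ 4"
      by (simp add: c_def power_divide eval_nat_numeral)
    finally show ?thesis
      using power_le_imp_le_base[of "s4 n ?R" 3 "s / real r"] s by simp
  next
    assume "(fro n ?R)\<^sup>2 \<le> (fro n D)\<^sup>2 - real (r ^ 4) * c"
    moreover have "real (r ^ 4) * c = s\<^sup>2" using assms by (simp add: c_def)
    moreover have "(fro n D)\<^sup>2 \<le> s\<^sup>2" using assms by (intro power_mono) auto
    ultimately have "(fro n ?R)\<^sup>2 \<le> 0" by linarith
    then have "fro n ?R = 0" by simp
    moreover have "0 \<le> s / real r" using s by simp
    ultimately show ?thesis using s4_le_fro[of n ?R] by linarith
  qed
  then show ?thesis using wu(1) assms(2) by (meson order.trans)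
qed

lemma abs_floor_grid:
  fixes h x :: real
  assumes "0 < h"
  shows "\<bar>x - h * of_int \<lfloor>x / h\<rfloor>\<bar> \<le> h"
proof -
  have "of_int \<lfloor>x / h\<rfloor> \<le> x / h" "x / h < of_int \<lfloor>x / h\<rfloor> + 1" by linarith+
  then have "h * of_int \<lfloor>x / h\<rfloor> \<le> h * (x / h)" "h * (x / h) \<le> h * (of_int \<lfloor>x / h\<rfloor> + 1)"
    using assms by (intro mult_left_mono; simp)+
  then show ?thesis using assms by (simp add: algebra_simps)
qed

lemma floor_grid_range:
  fixes h x c :: real
  assumes "0 < h" "\<bar>x\<bar> \<le> c" "c / h + 1 \<le> real Q"
  shows "\<lfloor>x / h\<rfloor> \<in> {- int Q..int Q}"
proof -
  have "\<bar>x / h\<bar> \<le> c / h" using assms by (simp add: divide_right_mono)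
  then have "x / h \<le> real Q" "- real Q \<le> x / h" using assms by linarith+
  then show ?thesis by (auto simp: le_floor_iff floor_le_iff)
qed

lemma fro_entry_bound:
  assumes "\<And>i j. i < n \<Longrightarrow> j < n \<Longrightarrow> \<bar>A i j\<bar> \<le> b" "0 \<le> b"
  shows "fro n A \<le> n * b"
proof (rule power2_le_imp_le)
  have "(fro n A)\<^sup>2 \<le> (\<Sum>i<n. \<Sum>j<n. b\<^sup>2)"
    unfolding fro_sq' using assms by (intro sum_mono) (auto simp flip: abs_le_square_iff)
  then show "(fro n A)\<^sup>2 \<le> (n * b)\<^sup>2" by (simp add: power2_eq_square mult_ac)
qed (use assms in auto)

text \<open>Rounds the r^4 pairs of vectors of \<open>lowrank_s4\<close> to a grid of mesh
  \<open>h\<close>: 2 r^4 n integers, each between - Q and Q. The first error term comes from the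
  truncated rank, the second from rounding, estimated entrywise and turned into a Frobenius norm at
  the price of a factor \<open>n\<close>.\<close>

lemma lowrank_net:
  fixes h s :: real
  assumes "0 < r" "0 < h" "h \<le> 1" "0 \<le> s" "s / h + 1 \<le> real Q" "1 / h + 1 \<le> real Q"
  shows "\<exists>N. finite N \<and> card N \<le> (2 * Q + 1) ^ (2 * r ^ 4 * n) \<and>
    (\<forall>D. fro n D \<le> s \<longrightarrow> (\<exists>A\<in>N. s4 n (D - A) \<le> s / real r + n * (real r ^ 4 * (h * (s + 2)))))"
proof -
  let ?k = "r ^ 4"
  define F where "F = ({..<?k} \<times> {..<n}) \<rightarrow>\<^sub>E {- int Q..int Q}"
  define g where "g a = (\<lambda>l i. h * of_int (a (l, i)))" for a :: "nat \<times> nat \<Rightarrow> int"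
  define N where "N = (\<lambda>(a, b). lowrank ?k (g a) (g b)) ` (F \<times> F)"
  have finF: "finite F" unfolding F_def by (intro finite_PiE) auto
  have cardF: "card F = (2 * Q + 1) ^ (?k * n)"
    unfolding F_def by (subst card_PiE) (auto simp: card_cartesian_product nat_add_distrib nat_mult_distrib)
  have "card N \<le> card (F \<times> F)"
    unfolding N_def using finF by (intro card_image_le) auto
  also have "\<dots> = (2 * Q + 1) ^ (2 * ?k * n)"
    by (simp add: card_cartesian_product cardF mult_2 add_mult_distrib flip: power_add)
  finally have card: "card N \<le> (2 * Q + 1) ^ (2 * ?k * n)" .
  moreover have "finite N" unfolding N_def using finF by auto
  moreover have "\<exists>A\<in>N. s4 n (D - A) \<le> s / real r + n * (real r ^ 4 * (h * (s + 2)))"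
    if bnd: "fro n D \<le> s" for D
  proof -
    obtain w u where wu: "\<And>l i. l < ?k \<Longrightarrow> i < n \<Longrightarrow> \<bar>w l i\<bar> \<le> s \<and> \<bar>u l i\<bar> \<le> 1"
      and D: "s4 n (D - lowrank ?k w u) \<le> s / real r"
      using lowrank_s4[OF assms(1) bnd] by blast
    define a where "a = restrict (\<lambda>(l, i). \<lfloor>w l i / h\<rfloor>) ({..<?k} \<times> {..<n})"
    define b where "b = restrict (\<lambda>(l, i). \<lfloor>u l i / h\<rfloor>) ({..<?k} \<times> {..<n})"
    have "a \<in> F"
      unfolding a_def F_def using wu
      by (auto intro!: restrict_PiE_iff[THEN iffD2] floor_grid_range[OF assms(2) _ assms(5)]
          simp del: atLeastAtMost_iff)
    moreover have "b \<in> F"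
      unfolding b_def F_def using wu
      by (auto intro!: restrict_PiE_iff[THEN iffD2] floor_grid_range[OF assms(2) _ assms(6)]
          simp del: atLeastAtMost_iff)
    ultimately have N: "lowrank ?k (g a) (g b) \<in> N" unfolding N_def by auto
    have entry: "\<bar>w l i * u l j - g a l i * g b l j\<bar> \<le> h * (s + 2)" if "l < ?k" "i < n" "j < n" for l i j
    proof -
      have ga: "\<bar>w l i - g a l i\<bar> \<le> h" and gb: "\<bar>u l j - g b l j\<bar> \<le> h"
        using that abs_floor_grid[OF assms(2)] by (auto simp: g_def a_def b_def)
      have gb': "\<bar>g b l j\<bar> \<le> 2"
        using gb wu[of l j] that assms(3) by linarith
      have "w l i * u l j - g a l i * g b l j = w l i * (u l j - g b l j) + (w l i - g a l i) * g b l j"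
        by (simp add: algebra_simps)
      also have "\<bar>\<dots>\<bar> \<le> \<bar>w l i\<bar> * \<bar>u l j - g b l j\<bar> + \<bar>w l i - g a l i\<bar> * \<bar>g b l j\<bar>"
        by (metis abs_mult abs_triangle_ineq)
      also have "\<dots> \<le> s * h + h * 2"
        using ga gb gb' wu[of l i] that assms by (intro add_mono mult_mono) auto
      finally show ?thesis by (simp add: algebra_simps)
    qed
    have "fro n (lowrank ?k w u - lowrank ?k (g a) (g b)) \<le> n * (real r ^ 4 * (h * (s + 2)))"
    proof (rule fro_entry_bound)
      fix i j assume ij: "i < n" "j < n"
      have "\<bar>(lowrank ?k w u - lowrank ?k (g a) (g b)) i j\<bar>
          = \<bar>\<Sum>l<?k. w l i * u l j - g a l i * g b l j\<bar>"
        by (simp add: lowrank_def sum_subtractf)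
      also have "\<dots> \<le> (\<Sum>l<?k. h * (s + 2))"
        using entry ij by (intro order.trans[OF sum_abs] sum_mono) auto
      finally show "\<bar>(lowrank ?k w u - lowrank ?k (g a) (g b)) i j\<bar> \<le> real r ^ 4 * (h * (s + 2))"
        by simp
    qed (use assms in auto)
    then have "s4 n (lowrank ?k w u - lowrank ?k (g a) (g b)) \<le> n * (real r ^ 4 * (h * (s + 2)))"
      using s4_le_fro order.trans by blast
    then have "s4 n (D - lowrank ?k (g a) (g b)) \<le> s / real r + n * (real r ^ 4 * (h * (s + 2)))"
      using D s4_triangle[of n D "lowrank ?k (g a) (g b)" "lowrank ?k w u"] by linarith
    then show ?thesis using N by blast
  qed
  ultimately show ?thesis by blast
qed

section \<open>Adjacency matrices and the fourth moment\<close>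

definition sm :: "(nat \<times> nat \<Rightarrow> real) \<Rightarrow> fmat" where
  "sm x = (\<lambda>i j. if i < j then x (i, j) else if j < i then x (j, i) else 0)"

text \<open>The index of the variable behind an off-diagonal entry, so that coincidences between
  entries are decided by \<open>edge_eq_iff\<close>.\<close>

definition edge :: "nat \<Rightarrow> nat \<Rightarrow> nat \<times> nat" where
  "edge i j = (min i j, max i j)"

lemma sm_edge: "sm x i j = (if i = j then 0 else x (edge i j))"
  by (auto simp: sm_def edge_def min_def max_def)

lemma edge_eq_iff: "edge i j = edge k l \<longleftrightarrow> (i = k \<and> j = l) \<or> (i = l \<and> j = k)"
  by (auto simp: edge_def min_def max_def split: if_splits)

lemma edge_mem: "i < n \<Longrightarrow> j < n \<Longrightarrow> i \<noteq> j \<Longrightarrow> edge i j \<in> index_pairs n"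
  by (auto simp: edge_def index_pairs_def min_def max_def)

lemma finite_index_pairs [simp]: "finite (index_pairs n)"
  by (rule finite_subset[of _ "{..<n} \<times> {..<n}"]) (auto simp: index_pairs_def)

lemma sm_minus: "sm x - sm y = sm (\<lambda>e. x e - y e)"
  by (auto simp: sm_def fun_eq_iff)

lemma sum_sm:
  fixes g :: "nat \<Rightarrow> nat \<Rightarrow> real"
  assumes "\<And>i j. g i j = g j i" "\<And>i. g i i = 0"
  shows "(\<Sum>i<n. \<Sum>j<n. g i j) = 2 * (\<Sum>(i, j)\<in>index_pairs n. g i j)"
proof -
  let ?U = "{..<n} \<times> {..<n}"
  let ?L = "(\<lambda>(i, j). (j, i)) ` index_pairs n"
  let ?D = "(\<lambda>i. (i, i)) ` {..<n}"
  let ?g = "\<lambda>(i, j). g i j"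
  have U: "?U = (index_pairs n \<union> ?L) \<union> ?D"
    by (auto simp: index_pairs_def image_iff)
  have "(\<Sum>i<n. \<Sum>j<n. g i j) = sum ?g ?U"
    by (simp add: sum.cartesian_product)
  also have "\<dots> = sum ?g (index_pairs n \<union> ?L) + sum ?g ?D"
    unfolding U by (rule sum.union_disjoint) (simp_all, auto simp: index_pairs_def)
  also have "sum ?g (index_pairs n \<union> ?L) = sum ?g (index_pairs n) + sum ?g ?L"
    by (rule sum.union_disjoint) (simp_all, auto simp: index_pairs_def)
  also have "sum ?g ?L = sum ?g (index_pairs n)"
    using assms(1) by (subst sum.reindex) (auto simp: inj_on_def intro!: sum.cong)
  also have "sum ?g ?D = 0"
    using assms(2) by (subst sum.reindex) (auto simp: inj_on_def)
  finally show ?thesis by simp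
qed

lemma fro_sm: "(fro n (sm x))\<^sup>2 = 2 * (\<Sum>e\<in>index_pairs n. (x e)\<^sup>2)"
proof -
  have "(fro n (sm x))\<^sup>2 = 2 * (\<Sum>(i, j)\<in>index_pairs n. (sm x i j)\<^sup>2)"
    unfolding fro_sq' by (rule sum_sm) (auto simp: sm_def)
  also have "(\<Sum>(i, j)\<in>index_pairs n. (sm x i j)\<^sup>2) = (\<Sum>e\<in>index_pairs n. (x e)\<^sup>2)"
    by (intro sum.cong) (auto simp: sm_def index_pairs_def)
  finally show ?thesis .
qed

abbreviation bexp :: "real \<Rightarrow> 'a set \<Rightarrow> ('a set \<Rightarrow> real) \<Rightarrow> real" where
  "bexp p E f \<equiv> (\<Sum>S\<in>Pow E. bw p E S * f S)"

lemma bexp_single: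
  assumes "finite E" "e \<in> E"
  shows "bexp p E (\<lambda>S. f (bern S e)) = p * f 1 + (1 - p) * f 0"
  using bexp_prod_subset[of E "{e}" p "\<lambda>_. f"] assms by simp

lemma bexp_centered_prod4_zero:
  assumes "finite E" "distinct [a, b, c, d]" "{a, b, c, d} \<subseteq> E"
  shows "bexp p E (\<lambda>S. (bern S a - p) * (bern S b - p) * (bern S c - p) * (bern S d - p)) = 0"
proof -
  have "bexp p E (\<lambda>S. \<Prod>e\<in>{a, b, c, d}. bern S e - p) = (\<Prod>e\<in>{a, b, c, d}. p * (1 - p) + (1 - p) * (0 - p))"
    using assms by (rule_tac bexp_prod_subset) auto
  then show ?thesis using assms(2) by (simp add: mult.assoc)
qed

lemma bexp_centered_sq2_le:
  assumes "finite E" "a \<noteq> b" "{a, b} \<subseteq> E" "0 \<le> p" "p \<le> 1"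
  shows "bexp p E (\<lambda>S. (bern S a - p)\<^sup>2 * (bern S b - p)\<^sup>2) \<le> p\<^sup>2"
proof -
  have "bexp p E (\<lambda>S. \<Prod>e\<in>{a, b}. (bern S e - p)\<^sup>2) = (\<Prod>e\<in>{a, b}. p * (1 - p)\<^sup>2 + (1 - p) * (0 - p)\<^sup>2)"
    using assms by (rule_tac bexp_prod_subset) auto
  also have "p * (1 - p)\<^sup>2 + (1 - p) * (0 - p)\<^sup>2 = p * (1 - p)"
    by (simp add: power2_eq_square algebra_simps)
  also have "(\<Prod>e\<in>{a, b}. p * (1 - p)) = (p * (1 - p))\<^sup>2"
    using assms by (simp add: power2_eq_square)
  also have "\<dots> \<le> p\<^sup>2"
    using assms by (intro power_mono mult_nonneg_nonneg mult_left_le) auto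
  finally show ?thesis using assms by simp
qed

lemma bexp_centered_pow4_le:
  assumes "finite E" "a \<in> E" "0 \<le> p" "p \<le> 1"
  shows "bexp p E (\<lambda>S. (bern S a - p) ^ 4) \<le> p"
proof -
  have "bexp p E (\<lambda>S. (bern S a - p) ^ 4) = p * (1 - p) ^ 4 + (1 - p) * (0 - p) ^ 4"
    using bexp_single[OF assms(1,2), of p "\<lambda>x. (x - p) ^ 4"] .
  also have "\<dots> = p * ((1 - p) ^ 4 + (1 - p) * p ^ 3)"
    by (simp add: algebra_simps eval_nat_numeral)
  also have "\<dots> \<le> p * ((1 - p) * 1 + 1 * p)"
  proof (intro mult_left_mono add_mono)
    show "(1 - p) ^ 4 \<le> (1 - p) * 1"
      using assms power_decreasing[of 1 4 "1 - p"] by simp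
    have "(1 - p) * p ^ 3 \<le> 1 * p ^ 1"
      using assms by (intro mult_mono power_decreasing) auto
    then show "(1 - p) * p ^ 3 \<le> 1 * p" by simp
  qed (use assms in auto)
  finally show ?thesis by simp
qed

text \<open>The fourth power is a sum over closed walks i, k, j, l. Walks with four distinct edges
  have expectation 0. Among the others only those with i = j or k = l avoid the diagonal, and they
  contribute at most p if they use a single edge and p^2 if they use two.\<close>

lemma bexp_s4_le:
  assumes "0 \<le> p" "p \<le> 1"
  shows "bexp p (index_pairs n) (\<lambda>S. s4 n (sm (bern S) - sm (\<lambda>_. p)) ^ 4) \<le> 2 * real n ^ 3 * p\<^sup>2 + real n ^ 2 * p"
proof -
  let ?E = "index_pairs n"
  let ?A = "\<lambda>S. sm (\<lambda>e. bern S e - p)"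
  have expand: "s4 n (sm (bern S) - sm (\<lambda>_. p)) ^ 4
      = (\<Sum>i<n. \<Sum>j<n. \<Sum>k<n. \<Sum>l<n. ?A S i k * ?A S j k * ?A S i l * ?A S j l)" for S
  proof -
    have "s4 n (?A S) ^ 4 = (fro n (mmul n (?A S) (tp (?A S))))\<^sup>2"
      by (rule s4_pow4)
    also have "\<dots> = (\<Sum>i<n. \<Sum>j<n. (\<Sum>k<n. ?A S i k * ?A S j k) * (\<Sum>l<n. ?A S i l * ?A S j l))"
      unfolding fro_sq' by (simp only: tp_def mmul_def power2_eq_square)
    finally show ?thesis by (simp only: sm_minus sum_product mult.assoc)
  qed
  have summand: "bexp p ?E (\<lambda>S. ?A S i k * ?A S j k * ?A S i l * ?A S j l)
      \<le> of_bool (i = j \<and> k = l) * p + of_bool (i = j) * p\<^sup>2 + of_bool (k = l) * p\<^sup>2"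
    if "i < n" "j < n" "k < n" "l < n" for i j k l
  proof -
    have rhs: "0 \<le> of_bool (i = j \<and> k = l) * p + of_bool (i = j) * p\<^sup>2 + of_bool (k = l) * p\<^sup>2"
      using assms by simp
    \<comment> \<open>The first case meets the null diagonal; then come one edge four times, two
      edges twice each (in two ways), and four distinct edges.\<close>
    consider "i = k \<or> j = k \<or> i = l \<or> j = l"
      | "i = j" "k = l" "i \<noteq> k" | "i = j" "k \<noteq> l" "i \<noteq> k" "i \<noteq> l"
      | "i \<noteq> j" "k = l" "i \<noteq> k" "j \<noteq> k"
      | "i \<noteq> j" "k \<noteq> l" "i \<noteq> k" "j \<noteq> k" "i \<noteq> l" "j \<noteq> l" by blast
    then show ?thesis
    proof cases
      case 1
      then have zero: "?A S i k * ?A S j k * ?A S i l * ?A S j l = 0" for S by (auto simp: sm_edge)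
      show ?thesis unfolding zero using rhs by simp
    next
      case 2
      then have "?A S i k * ?A S j k * ?A S i l * ?A S j l = (bern S (edge i k) - p) ^ 4" for S
        by (simp add: sm_edge eval_nat_numeral mult.assoc)
      then show ?thesis
        using bexp_centered_pow4_le[OF finite_index_pairs edge_mem[of i n k] assms] 2 that assms
        by (simp add: add_increasing)
    next
      case 3
      then have "?A S i k * ?A S j k * ?A S i l * ?A S j l
          = (bern S (edge i k) - p)\<^sup>2 * (bern S (edge i l) - p)\<^sup>2" for S
        by (simp add: sm_edge power2_eq_square mult.assoc)
      then show ?thesis
        using bexp_centered_sq2_le[OF finite_index_pairs, of "edge i k" "edge i l" n p] 3 that assms
          edge_mem[of i n k] edge_mem[of i n l] by (simp add: edge_eq_iff)
    next
      case 4
      then have "?A S i k * ?A S j k * ?A S i l * ?A S j l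
          = (bern S (edge i k) - p)\<^sup>2 * (bern S (edge j k) - p)\<^sup>2" for S
        by (simp add: sm_edge power2_eq_square mult_ac)
      then show ?thesis
        using bexp_centered_sq2_le[OF finite_index_pairs, of "edge i k" "edge j k" n p] 4 that assms
          edge_mem[of i n k] edge_mem[of j n k] by (simp add: edge_eq_iff)
    next
      case 5
      then have "bexp p ?E (\<lambda>S. ?A S i k * ?A S j k * ?A S i l * ?A S j l) = 0"
        using bexp_centered_prod4_zero[OF finite_index_pairs, of "edge i k" "edge j k" "edge i l" "edge j l" n p]
          that by (simp add: sm_edge edge_eq_iff edge_mem)
      then show ?thesis using rhs by simp
    qed
  qed
  have "bexp p ?E (\<lambda>S. s4 n (sm (bern S) - sm (\<lambda>_. p)) ^ 4)
      = (\<Sum>i<n. \<Sum>j<n. \<Sum>k<n. \<Sum>l<n. bexp p ?E (\<lambda>S. ?A S i k * ?A S j k * ?A S i l * ?A S j l))"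
    unfolding expand sum_distrib_left
    by (simp only: sum.swap[of _ _ "Pow ?E"])
  also have "\<dots> \<le> (\<Sum>i<n. \<Sum>j<n. \<Sum>k<n. \<Sum>l<n.
      of_bool (i = j \<and> k = l) * p + of_bool (i = j) * p\<^sup>2 + of_bool (k = l) * p\<^sup>2)"
    by (intro sum_mono summand) auto
  also have "\<dots> = 2 * real n ^ 3 * p\<^sup>2 + real n ^ 2 * p"
  proof -
    have d: "(\<Sum>j<n. of_bool (i = j) * c) = c" if "i < n" for i :: nat and c :: real
      using that by simp
    have "(\<Sum>i<n. \<Sum>j<n. \<Sum>k<n. \<Sum>l<n. of_bool (i = j \<and> k = l) * p) = (\<Sum>i<n. \<Sum>k<n. p)"
      by (simp add: of_bool_conj mult.assoc flip: sum_distrib_left) 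
    moreover have "(\<Sum>i<n. \<Sum>j<n. \<Sum>k<n. \<Sum>l<n. of_bool (i = j) * p\<^sup>2) = real n ^ 3 * p\<^sup>2"
      by (simp add: power3_eq_cube mult_ac flip: sum_distrib_left)
    moreover have "(\<Sum>i<n. \<Sum>j<n. \<Sum>k<n. \<Sum>l<n. of_bool (k = l) * p\<^sup>2) = real n ^ 3 * p\<^sup>2"
      by (simp add: power3_eq_cube mult_ac flip: sum_distrib_left)
    ultimately show ?thesis
      by (simp add: sum.distrib power2_eq_square algebra_simps)
  qed
  finally show ?thesis .
qed

section \<open>Covering and the cubic remainder\<close>

lemma s4_ball_cvx: "cvx {x. s4 n (sm x - B) \<le> m}"
  unfolding cvx_def
proof (intro ballI allI impI CollectI)
  fix u v and l :: real
  assume u: "u \<in> {x. s4 n (sm x - B) \<le> m}" and v: "v \<in> {x. s4 n (sm x - B) \<le> m}"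
    and l: "0 \<le> l \<and> l \<le> 1"
  have "sm (\<lambda>i. l * u i + (1 - l) * v i) - B
      = (\<lambda>i j. l * (sm u - B) i j) + (\<lambda>i j. (1 - l) * (sm v - B) i j)"
    by (auto simp: fun_eq_iff sm_def algebra_simps)
  then have "s4 n (sm (\<lambda>i. l * u i + (1 - l) * v i) - B)
      \<le> s4 n (\<lambda>i j. l * (sm u - B) i j) + s4 n (\<lambda>i j. (1 - l) * (sm v - B) i j)"
    by (simp only: s4_plus)
  also have "\<dots> = l * s4 n (sm u - B) + (1 - l) * s4 n (sm v - B)"
    using l by (simp only: s4_scale abs_of_nonneg diff_ge_0_iff_ge)
  also have "\<dots> \<le> l * m + (1 - l) * m"
    using u v l by (intro add_mono mult_left_mono) auto
  finally show "s4 n (sm (\<lambda>i. l * u i + (1 - l) * v i) - B) \<le> m"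
    by (simp add: algebra_simps)
qed

text \<open>The fourth moment of the 4-norm of the noise is at most 3 n^3 p^2, so by Markov's
  inequality the ball \<open>C\<close> of radius \<open>m\<close> around the mean has probability at
  least 1/2. Talagrand's inequality then bounds the exponential moment of the squared distance to
  \<open>C\<close>. The 16 is twice the 8 found there, because each edge gives two entries of the
  matrix.\<close>

theorem bulk_decomposition:
  fixes p m s :: real
  assumes "0 < p" "p < 1" "1 \<le> real n * p" "6 * real n ^ 3 * p\<^sup>2 \<le> m ^ 4" "0 \<le> m" "0 \<le> s"
  shows "bprob p (index_pairs n)
    {S. \<not> (\<exists>z. s4 n (sm z - sm (\<lambda>_. p)) \<le> m \<and> fro n (sm (bern S) - sm z) \<le> s)} \<le> 2 * exp (- s\<^sup>2 / 16)"
proof -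
  let ?E = "index_pairs n"
  define C where "C = {x. s4 n (sm x - sm (\<lambda>_. p)) \<le> m}"
  define A where "A = {S \<in> Pow ?E. bern S \<in> C}"
  have n: "0 < real n" using assms by (metis mult_zero_left not_one_le_zero of_nat_0_less_iff of_nat_0 gr0I)
  have "0 < m ^ 4"
    using assms n by (intro less_le_trans[OF _ assms(4)]) auto
  have np: "real n ^ 2 * p \<le> real n ^ 3 * p\<^sup>2"
  proof -
    have "(real n ^ 2 * p) * 1 \<le> (real n ^ 2 * p) * (real n * p)"
      using assms by (intro mult_left_mono) auto
    then show ?thesis by (simp add: power2_eq_square power3_eq_cube mult_ac)
  qed
  have "bprob p ?E {S. bern S \<notin> C} \<le> bexp p ?E (\<lambda>S. s4 n (sm (bern S) - sm (\<lambda>_. p)) ^ 4) / m ^ 4"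
    using assms \<open>0 < m ^ 4\<close> by (intro bprob_markov) (auto simp: C_def intro!: power_mono)
  also have "\<dots> \<le> (2 * real n ^ 3 * p\<^sup>2 + real n ^ 2 * p) / m ^ 4"
    using assms by (intro divide_right_mono bexp_s4_le) auto
  also have "\<dots> \<le> 1 / 2"
    using assms(4) np \<open>0 < m ^ 4\<close> by (simp add: field_simps)
  finally have "bprob p ?E {S. bern S \<notin> C} \<le> 1 / 2" .
  moreover have "1 \<le> bprob p ?E A + bprob p ?E {S. bern S \<notin> C}"
  proof -
    have "1 = bprob p ?E UNIV" by (simp add: bprob_def bw_total)
    also have "\<dots> \<le> bprob p ?E (A \<union> {S. bern S \<notin> C})"
      using assms by (intro bprob_mono) (auto simp: A_def)
    also have "\<dots> \<le> bprob p ?E A + bprob p ?E {S. bern S \<notin> C}"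
      using assms by (intro bprob_Un) auto
    finally show ?thesis .
  qed
  ultimately have half: "1 / 2 \<le> bprob p ?E A" by linarith
  then have "A \<noteq> {}" by (auto simp: bprob_def)
  have "\<exists>z. (\<forall>S. S \<subseteq> ?E \<longrightarrow> z S \<in> C) \<and>
    (\<Sum>S\<in>Pow ?E. bw p ?E S * exp ((\<Sum>i\<in>?E. (bern S i - z S i)\<^sup>2) / 8)) \<le> 1 / bprob p ?E A"
    by (rule talagrand_convex) (use assms \<open>A \<noteq> {}\<close> in \<open>auto simp: A_def C_def s4_ball_cvx\<close>)
  then obtain z where z: "\<And>S. S \<subseteq> ?E \<Longrightarrow> z S \<in> C"
    "(\<Sum>S\<in>Pow ?E. bw p ?E S * exp ((\<Sum>i\<in>?E. (bern S i - z S i)\<^sup>2) / 8)) \<le> 1 / bprob p ?E A"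
    by blast
  let ?B = "{S. \<not> (\<exists>z. s4 n (sm z - sm (\<lambda>_. p)) \<le> m \<and> fro n (sm (bern S) - sm z) \<le> s)}"
  have "bprob p ?E ?B \<le> (\<Sum>S\<in>Pow ?E. bw p ?E S * exp ((\<Sum>i\<in>?E. (bern S i - z S i)\<^sup>2) / 8)) / exp (s\<^sup>2 / 16)"
  proof (rule bprob_markov)
    fix S assume S: "S \<in> ?B" "S \<subseteq> ?E"
    then have "s < fro n (sm (bern S) - sm (z S))"
      using z(1)[of S] by (auto simp: C_def)
    then have "s\<^sup>2 \<le> (fro n (sm (bern S) - sm (z S)))\<^sup>2"
      using assms by (intro power_mono) auto
    also have "\<dots> = 2 * (\<Sum>i\<in>?E. (bern S i - z S i)\<^sup>2)"
      by (simp only: sm_minus fro_sm)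
    finally show "exp (s\<^sup>2 / 16) \<le> exp ((\<Sum>i\<in>?E. (bern S i - z S i)\<^sup>2) / 8)"
      by simp
  qed (use assms in auto)
  also have "\<dots> \<le> (1 / bprob p ?E A) / exp (s\<^sup>2 / 16)"
    by (intro divide_right_mono z) auto
  also have "\<dots> \<le> 2 / exp (s\<^sup>2 / 16)"
    using half by (intro divide_right_mono) (auto simp: field_simps)
  finally show ?thesis by (simp add: exp_minus field_simps)
qed

text \<open>The centres are the mean plus a matrix of the net for the Frobenius part; the bulk part
  is absorbed in the radius.\<close>

theorem s4_cover:
  fixes p m s h :: real
  assumes "0 < p" "p < 1" "1 \<le> real n * p" "6 * real n ^ 3 * p\<^sup>2 \<le> m ^ 4" "0 \<le> m" "0 \<le> s"
    and "0 < r" "0 < h" "h \<le> 1" "s / h + 1 \<le> real Q" "1 / h + 1 \<le> real Q"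
    and g: "m + (s / real r + n * (real r ^ 4 * (h * (s + 2)))) \<le> g"
  shows "\<exists>N. finite N \<and> card N \<le> (2 * Q + 1) ^ (2 * r ^ 4 * n) \<and>
    bprob p (index_pairs n) {S. \<forall>A\<in>N. g < s4 n (sm (bern S) - A)} \<le> 2 * exp (- s\<^sup>2 / 16)"
proof -
  let ?\<eta> = "s / real r + n * (real r ^ 4 * (h * (s + 2)))"
  obtain N where N: "finite N" "card N \<le> (2 * Q + 1) ^ (2 * r ^ 4 * n)"
    "\<And>D. fro n D \<le> s \<Longrightarrow> \<exists>A\<in>N. s4 n (D - A) \<le> ?\<eta>"
    using lowrank_net[OF assms(7-9,6,10,11), of n] by blast
  define N' where "N' = (\<lambda>A. sm (\<lambda>_. p) + A) ` N"
  have "card N' \<le> (2 * Q + 1) ^ (2 * r ^ 4 * n)"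
    unfolding N'_def using card_image_le[OF N(1)] N(2) order.trans by blast
  moreover have "finite N'" using N by (simp add: N'_def)
  moreover have "bprob p (index_pairs n) {S. \<forall>A\<in>N'. g < s4 n (sm (bern S) - A)}
      \<le> bprob p (index_pairs n)
          {S. \<not> (\<exists>z. s4 n (sm z - sm (\<lambda>_. p)) \<le> m \<and> fro n (sm (bern S) - sm z) \<le> s)}"
  proof (intro bprob_mono subsetI CollectI notI)
    fix S assume S: "S \<in> {S. \<forall>A\<in>N'. g < s4 n (sm (bern S) - A)} \<inter> Pow (index_pairs n)"
      and "\<exists>z. s4 n (sm z - sm (\<lambda>_. p)) \<le> m \<and> fro n (sm (bern S) - sm z) \<le> s"
    then obtain z where z: "s4 n (sm z - sm (\<lambda>_. p)) \<le> m" "fro n (sm (bern S) - sm z) \<le> s"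
      by blast
    obtain A where A: "A \<in> N" "s4 n (sm (bern S) - sm z - A) \<le> ?\<eta>"
      using N(3)[OF z(2)] by blast
    have eq: "sm (bern S) - (sm (\<lambda>_. p) + A) = (sm z - sm (\<lambda>_. p)) + (sm (bern S) - sm z - A)"
      by (simp add: fun_eq_iff)
    have "s4 n (sm (bern S) - (sm (\<lambda>_. p) + A)) \<le> s4 n (sm z - sm (\<lambda>_. p)) + s4 n (sm (bern S) - sm z - A)"
      unfolding eq by (rule s4_plus)
    also have "\<dots> \<le> g" using z(1) A(2) g by linarith
    finally show False using S A(1) by (auto simp: N'_def not_less[symmetric])
  qed (use assms in auto)
  moreover have "\<dots> \<le> 2 * exp (- s\<^sup>2 / 16)"
    by (rule bulk_decomposition) fact+
  ultimately show ?thesis by (meson order.trans)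
qed

section \<open>The cubic remainder\<close>

definition wedge :: "nat \<Rightarrow> nat set \<Rightarrow> fmat \<Rightarrow> fmat" where
  "wedge n V H = (\<lambda>j k. \<Sum>i<n. bern V i * (H j i * H k i))"

text \<open>\<open>wedge n V H\<close> is H D H^T for the diagonal indicator D of \<open>V\<close>.
  For symmetric \<open>H\<close>, \<open>cutcube\<close> keeps from tr H^3 the triangles whose
  marked vertex lies in \<open>V\<close> and whose other two vertices lie outside.\<close>

definition cutcube :: "nat \<Rightarrow> nat set \<Rightarrow> fmat \<Rightarrow> real" where
  "cutcube n V H = (\<Sum>j<n. \<Sum>k<n. (1 - bern V j) * (1 - bern V k) * (H j k * wedge n V H j k))"

text \<open>With B = H D, the norm of B B^T equals that of B^T B, and the latter is H^T H with the
  entries outside V x V erased.\<close>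

lemma fro_wedge: "fro n (wedge n V H) \<le> (s4 n H)\<^sup>2"
proof -
  define B where "B = (\<lambda>j i. bern V i * H j i)"
  have "bern V i * (H j i * H k i) = B j i * tp B i k" for i j k
    by (simp add: B_def tp_def bern_def)
  then have "wedge n V H = mmul n B (tp B)"
    by (simp add: wedge_def mmul_def)
  then have "fro n (wedge n V H) = fro n (mmul n (tp B) B)"
    by (simp only: fro_gram)
  also have "\<dots> \<le> fro n (mmul n (tp H) H)"
  proof (rule fro_mono)
    fix i j
    have "mmul n (tp B) B i j = (bern V i * bern V j) * mmul n (tp H) H i j"
      by (simp add: mmul_def tp_def B_def sum_distrib_left mult_ac)
    then show "\<bar>mmul n (tp B) B i j\<bar> \<le> \<bar>mmul n (tp H) H i j\<bar>"
      by (simp add: bern_def)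
  qed
  finally show ?thesis by (simp only: s4_sq fro_gram)
qed

text \<open>For uniformly random \<open>V\<close>, an ordered triple of distinct vertices is kept
  with probability 1/8, and triples with a repetition vanish by the null diagonal. So
  \<open>cutcube\<close> averages to an eighth of the trace.\<close>

lemma exists_cut_ge:
  assumes "8 * a \<le> mtr n (pw n (sm x) 2)"
  shows "\<exists>V\<subseteq>{..<n}. a \<le> cutcube n V (sm x)"
proof (rule ccontr)
  assume "\<not> ?thesis"
  then have lt: "cutcube n V (sm x) < a" if "V \<subseteq> {..<n}" for V using that by auto
  let ?H = "sm x"
  have sym: "?H i j = ?H j i" for i j by (simp add: sm_def)
  have tr: "mtr n (pw n ?H 2) = (\<Sum>j<n. \<Sum>k<n. \<Sum>i<n. ?H j k * ?H j i * ?H k i)"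
    by (simp add: numeral_2_eq_2 mtr_def mmul_def sum_distrib_right sum_distrib_left)
      (intro sum.cong refl, simp add: sym mult_ac)
  have avg: "bexp (1 / 2) {..<n} (\<lambda>V. bern V i * ((1 - bern V j) * (1 - bern V k))) * (?H j k * ?H j i * ?H k i)
      = 1 / 8 * (?H j k * ?H j i * ?H k i)" if "i < n" "j < n" "k < n" for i j k
  proof (cases "i = j \<or> j = k \<or> i = k")
    case True
    then have zero: "?H j k * ?H j i * ?H k i = 0" by (auto simp: sm_def)
    show ?thesis unfolding zero by simp
  next
    case False
    define f :: "nat \<Rightarrow> real \<Rightarrow> real" where "f e y = (if e = i then y else 1 - y)" for e y
    have "bexp (1 / 2) {..<n} (\<lambda>V. \<Prod>e\<in>{i, j, k}. f e (bern V e))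
        = (\<Prod>e\<in>{i, j, k}. 1 / 2 * f e 1 + (1 - 1 / 2) * f e 0)"
      using that by (intro bexp_prod_subset) auto
    also have "\<dots> = 1 / 8" using False by (simp add: f_def)
    finally show ?thesis using False by (simp add: f_def)
  qed
  have "bexp (1 / 2) {..<n} (\<lambda>V. cutcube n V ?H) = (\<Sum>j<n. \<Sum>k<n. \<Sum>i<n.
      bexp (1 / 2) {..<n} (\<lambda>V. bern V i * ((1 - bern V j) * (1 - bern V k))) * (?H j k * ?H j i * ?H k i))"
  proof -
    have "cutcube n V ?H = (\<Sum>j<n. \<Sum>k<n. \<Sum>i<n.
        bern V i * ((1 - bern V j) * (1 - bern V k)) * (?H j k * ?H j i * ?H k i))" for V
      unfolding cutcube_def wedge_def sum_distrib_left by (intro sum.cong refl) (simp add: mult_ac)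
    then show ?thesis
      by (simp only: sum_distrib_left sum_distrib_right sum.swap[of _ _ "Pow {..<n}"] mult.assoc)
  qed
  also have "\<dots> = (\<Sum>j<n. \<Sum>k<n. \<Sum>i<n. 1 / 8 * (?H j k * ?H j i * ?H k i))"
    by (intro sum.cong refl avg) auto
  also have "\<dots> = mtr n (pw n ?H 2) / 8"
    by (simp add: tr sum_divide_distrib)
  finally have "a \<le> bexp (1 / 2) {..<n} (\<lambda>V. cutcube n V ?H)" using assms by simp
  also have "\<dots> < bexp (1 / 2) {..<n} (\<lambda>V. a)"
    using lt by (intro sum_strict_mono) (auto intro!: mult_strict_left_mono bw_pos)
  also have "\<dots> = a"
    using bw_total[of "{..<n}" "1 / 2"] by (simp flip: sum_distrib_right)
  finally show False by simp
qed

lemma sum_mult_le_of_squares: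
  fixes f g :: "'a \<Rightarrow> real"
  assumes "(\<Sum>e\<in>E. (f e)\<^sup>2) \<le> b\<^sup>2" "(\<Sum>e\<in>E. (g e)\<^sup>2) \<le> c\<^sup>2" "0 \<le> b" "0 \<le> c"
  shows "(\<Sum>e\<in>E. f e * g e) \<le> b * c"
proof -
  have "(\<Sum>e\<in>E. f e * g e)\<^sup>2 \<le> (\<Sum>e\<in>E. (f e)\<^sup>2) * (\<Sum>e\<in>E. (g e)\<^sup>2)"
    by (rule Cauchy_Schwarz_ineq_sum)
  also have "\<dots> \<le> (b * c)\<^sup>2"
    using assms by (simp add: power_mult_distrib mult_mono sum_nonneg)
  finally show ?thesis by (rule power2_le_imp_le) (use assms in simp)
qed

text \<open>Conditionally on the edges that meet \<open>V\<close>, \<open>cutcube\<close> is linear in the remaining ones.\<close>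
lemma cutcube_tail:
  fixes p a b g :: real
  assumes "0 < p" "p < 1" "0 \<le> a" "0 \<le> b" "0 < g" "4 * b * g\<^sup>2 \<le> a"
    and y: "fro n (sm y - sm (\<lambda>_. p)) \<le> b"
  shows "bprob p (index_pairs n)
    {S. s4 n (sm (bern S) - sm y) \<le> g \<and> a \<le> cutcube n V (sm (bern S) - sm y)} \<le> exp (- a\<^sup>2 / (8 * g ^ 4))"
proof -
  let ?E = "index_pairs n"
  let ?B = "{S. s4 n (sm (bern S) - sm y) \<le> g \<and> a \<le> cutcube n V (sm (bern S) - sm y)}"
  define E1 where "E1 = {e \<in> ?E. fst e \<notin> V \<and> snd e \<notin> V}"
  define E0 where "E0 = ?E - E1"
  have E: "?E = E0 \<union> E1" "finite E0" "finite E1" "E0 \<inter> E1 = {}"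
    using finite_index_pairs[of n] by (auto simp: E0_def E1_def intro: finite_subset[OF _ finite_index_pairs[of n]])
  define H where "H S = sm (\<lambda>e. bern S e - y e)" for S
  have H: "sm (bern S) - sm y = H S" for S by (simp add: H_def sm_minus)
  define W where "W S e = wedge n V (H S) (fst e) (snd e)" for S e
  have Wsq: "(\<Sum>e\<in>E1. (W S e)\<^sup>2) \<le> (g\<^sup>2)\<^sup>2" if "s4 n (H S) \<le> g" for S
  proof -
    have "(\<Sum>e\<in>E1. (W S e)\<^sup>2) \<le> (\<Sum>e\<in>{..<n} \<times> {..<n}. (W S e)\<^sup>2)"
      by (intro sum_mono2) (auto simp: E1_def index_pairs_def)
    also have "\<dots> = (fro n (wedge n V (H S)))\<^sup>2"
      by (simp add: fro_sq' sum.cartesian_product W_def case_prod_beta)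
    also have "\<dots> \<le> ((s4 n (H S))\<^sup>2)\<^sup>2"
      by (intro power_mono fro_wedge) auto
    also have "\<dots> \<le> (g\<^sup>2)\<^sup>2"
      using that by (intro power_mono) auto
    finally show ?thesis .
  qed
  have cut: "cutcube n V (H S) = 2 * (\<Sum>e\<in>E1. (bern S e - y e) * W S e)" for S
  proof -
    have "cutcube n V (H S) = 2 * (\<Sum>(j, k)\<in>?E. (1 - bern V j) * (1 - bern V k) * (H S j k * wedge n V (H S) j k))"
      unfolding cutcube_def
      by (rule sum_sm) (auto simp: H_def sm_def wedge_def mult_ac)
    also have "(\<Sum>(j, k)\<in>?E. (1 - bern V j) * (1 - bern V k) * (H S j k * wedge n V (H S) j k))
        = (\<Sum>e\<in>?E. if e \<in> E1 then (bern S e - y e) * W S e else 0)"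
      by (intro sum.cong refl) (auto simp: E1_def H_def sm_def bern_def[of V] W_def index_pairs_def)
    also have "\<dots> = (\<Sum>e\<in>E1. (bern S e - y e) * W S e)"
      by (simp add: sum.If_cases) (simp add: E(1) Int_absorb1 Int_Un_distrib2 Un_Int_distrib)
    finally show ?thesis .
  qed
  \<comment> \<open>\<open>wedge\<close> only reads entries with an index in \<open>V\<close>, and
    no edge of \<open>E1\<close> has an end there.\<close>
  have Wdep: "W (S0 \<union> S1) e = W S0 e" if "S1 \<subseteq> E1" "e \<in> E1" for S0 S1 e
  proof -
    have "bern V i * (H (S0 \<union> S1) j i * H (S0 \<union> S1) k i) = bern V i * (H S0 j i * H S0 k i)" for i j k
    proof (cases "i \<in> V")
      case True
      then have "H (S0 \<union> S1) j i = H S0 j i" for j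
        using that(1) by (auto simp: H_def sm_def bern_def E1_def)
      then show ?thesis by simp
    qed (simp add: bern_def)
    then show ?thesis by (simp only: W_def wedge_def)
  qed
  have yE: "(\<Sum>e\<in>E1. (p - y e)\<^sup>2) \<le> b\<^sup>2"
  proof -
    have "(\<Sum>e\<in>E1. (p - y e)\<^sup>2) \<le> (\<Sum>e\<in>?E. (y e - p)\<^sup>2)"
      unfolding power2_commute[of p] by (intro sum_mono2) (auto simp: E1_def)
    also have "\<dots> \<le> (fro n (sm y - sm (\<lambda>_. p)))\<^sup>2"
      by (simp only: sm_minus fro_sm) (simp add: sum_nonneg)
    also have "\<dots> \<le> b\<^sup>2" using y by (intro power_mono) auto
    finally show ?thesis .
  qed
  have inner: "(\<Sum>T\<in>Pow E1. bw p E1 T * of_bool (S \<union> T \<in> ?B)) \<le> exp (- a\<^sup>2 / (8 * g ^ 4))"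
    if "S \<subseteq> E0" for S
  \<comment> \<open>The 4-norm constraint depends on \<open>T\<close> but the weights
    \<open>W S\<close> do not: if a single \<open>T\<close> satisfies it, the weights are small for
    all \<open>T\<close>; if none does, the sum is 0.\<close>
  proof (cases "\<exists>T\<subseteq>E1. S \<union> T \<in> ?B")
    case False
    then have "(\<Sum>T\<in>Pow E1. bw p E1 T * of_bool (S \<union> T \<in> ?B)) = 0"
      by (intro sum.neutral) auto
    then show ?thesis by simp
  next
    case True
    then obtain T' where T': "T' \<subseteq> E1" "s4 n (H (S \<union> T')) \<le> g" by (auto simp: H)
    have Ws: "(\<Sum>e\<in>E1. (W S e)\<^sup>2) \<le> (g\<^sup>2)\<^sup>2"
      using Wsq[OF T'(2)] Wdep[OF T'(1)] by simp
    have "(\<Sum>T\<in>Pow E1. bw p E1 T * of_bool (S \<union> T \<in> ?B)) = bprob p E1 {T. S \<union> T \<in> ?B}"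
      unfolding bprob_def using E by (intro sum.mono_neutral_cong_right) auto
    \<comment> \<open>The factor 2 of \<open>cut\<close> leaves a / 2, and recentring the edges from
      \<open>y\<close> to \<open>p\<close> costs at most b g^2 <= a / 4.\<close>
    also have "\<dots> \<le> bprob p E1 {T. a / 4 \<le> (\<Sum>e\<in>E1. (bern T e - p) * W S e)}"
    proof (intro bprob_mono subsetI CollectI)
      fix T assume T: "T \<in> {T. S \<union> T \<in> ?B} \<inter> Pow E1"
      then have "a \<le> cutcube n V (H (S \<union> T))" by (auto simp: H)
      also have "\<dots> = 2 * (\<Sum>e\<in>E1. (bern T e - p) * W S e + (p - y e) * W S e)"
      proof -
        have "(bern (S \<union> T) e - y e) * W (S \<union> T) e = (bern T e - p) * W S e + (p - y e) * W S e"
          if "e \<in> E1" for e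
        proof -
          have "e \<notin> S" using \<open>S \<subseteq> E0\<close> that E(4) by blast
          then have "bern (S \<union> T) e = bern T e" by (simp add: bern_def)
          then show ?thesis using T that Wdep[of T e S] by (simp add: algebra_simps)
        qed
        then show ?thesis unfolding cut by (intro arg_cong[where f = "(*) 2"] sum.cong) auto
      qed
      also have "\<dots> = 2 * (\<Sum>e\<in>E1. (bern T e - p) * W S e) + 2 * (\<Sum>e\<in>E1. (p - y e) * W S e)"
        by (simp add: sum.distrib)
      finally have "a \<le> 2 * (\<Sum>e\<in>E1. (bern T e - p) * W S e) + 2 * (\<Sum>e\<in>E1. (p - y e) * W S e)" .
      moreover have "(\<Sum>e\<in>E1. (p - y e) * W S e) \<le> b * g\<^sup>2"
        using sum_mult_le_of_squares[OF yE Ws] assms by simp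
      ultimately show "a / 4 \<le> (\<Sum>e\<in>E1. (bern T e - p) * W S e)"
        using assms(6) by simp
    qed (use E assms in auto)
    also have "\<dots> \<le> exp (- 2 * (a / 4)\<^sup>2 / (g\<^sup>2)\<^sup>2)"
      using E assms Ws by (intro bprob_hoeffding) auto
    also have "- 2 * (a / 4)\<^sup>2 / (g\<^sup>2)\<^sup>2 = - a\<^sup>2 / (8 * g ^ 4)"
      by (simp add: power_divide flip: power_mult)
    finally show ?thesis .
  qed
  have "bprob p ?E ?B = bexp p ?E (\<lambda>S. of_bool (S \<in> ?B))"
    unfolding bprob_def by (intro sum.mono_neutral_cong_left) auto
  also have "\<dots> = bexp p E0 (\<lambda>S. \<Sum>T\<in>Pow E1. bw p E1 T * of_bool (S \<union> T \<in> ?B))"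
    unfolding E(1) by (rule bexp_Un) (use E in auto)
  also have "\<dots> \<le> bexp p E0 (\<lambda>S. exp (- a\<^sup>2 / (8 * g ^ 4)))"
    using assms by (intro sum_mono mult_left_mono inner) (auto intro: bw_nonneg)
  also have "\<dots> = exp (- a\<^sup>2 / (8 * g ^ 4))"
    using E bw_total[of E0 p] by (simp flip: sum_distrib_right)
  finally show ?thesis .
qed

text \<open>The cut supplied by \<open>exists_cut_ge\<close> depends on the graph, hence the union
  over all 2^n vertex sets.\<close>

theorem cube_tail:
  fixes p a b g :: real
  assumes "0 < p" "p < 1" "0 \<le> a" "0 \<le> b" "0 < g" "4 * b * g\<^sup>2 \<le> a"
    and "fro n (sm y - sm (\<lambda>_. p)) \<le> b"
  shows "bprob p (index_pairs n)
    {S. s4 n (sm (bern S) - sm y) \<le> g \<and> 8 * a \<le> mtr n (pw n (sm (bern S) - sm y) 2)}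
    \<le> 2 ^ n * exp (- a\<^sup>2 / (8 * g ^ 4))"
proof -
  let ?B = "\<lambda>V. {S. s4 n (sm (bern S) - sm y) \<le> g \<and> a \<le> cutcube n V (sm (bern S) - sm y)}"
  have "bprob p (index_pairs n)
      {S. s4 n (sm (bern S) - sm y) \<le> g \<and> 8 * a \<le> mtr n (pw n (sm (bern S) - sm y) 2)}
      \<le> bprob p (index_pairs n) (\<Union>V\<in>Pow {..<n}. ?B V)"
    using assms by (intro bprob_mono) (auto simp: sm_minus dest!: exists_cut_ge)
  also have "\<dots> \<le> (\<Sum>V\<in>Pow {..<n}. bprob p (index_pairs n) (?B V))"
    using assms by (intro bprob_UN) auto
  also have "\<dots> \<le> (\<Sum>V\<in>Pow {..<n}. exp (- a\<^sup>2 / (8 * g ^ 4)))"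
    by (intro sum_mono cutcube_tail[OF assms])
  finally show ?thesis by (simp add: card_Pow)
qed

section \<open>The rate function and planted cliques\<close>

lemma rI_lower:
  assumes "0 < p" "p < 1" "0 \<le> x" "x \<le> 1"
  shows "x * ln (x / p) - x + p \<le> rI p x" "x - p \<le> x * ln (x / p)"
proof -
  have *: "a - b \<le> a * ln (a / b)" if "0 \<le> a" "0 < b" for a b :: real
  proof (cases "a = 0")
    case False
    then have a: "0 < a" using that by simp
    have "ln (b / a) \<le> b / a - 1"
      using a that by (intro ln_le_minus_one) auto
    then have "a * ln (b / a) \<le> a * (b / a - 1)"
      using a by (intro mult_left_mono) auto
    then show ?thesis
      using a that by (simp add: ln_div algebra_simps)
  qed (use that in auto)
  show "x - p \<le> x * ln (x / p)" using assms by (intro *) auto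
  show "x * ln (x / p) - x + p \<le> rI p x"
    using *[of "1 - x" "1 - p"] assms by (simp add: rI_def)
qed

lemma rI_nonneg: "0 < p \<Longrightarrow> p < 1 \<Longrightarrow> 0 \<le> x \<Longrightarrow> x \<le> 1 \<Longrightarrow> 0 \<le> rI p x"
  using rI_lower[of p x] by linarith

lemma rI_one: "0 < p \<Longrightarrow> rI p 1 = ln (1 / p)"
  by (simp add: rI_def)

lemma rI_p: "0 < p \<Longrightarrow> p < 1 \<Longrightarrow> rI p p = 0"
  by (simp add: rI_def)

text \<open>Three ranges of \<open>x\<close>. Up to 9 p the error term suffices. Beyond, 9 >= exp 2
  gives ln (x / p) >= 2, so the rate is at least half of x ln (x / p); then ln (x / p) >= ln (1 / p)
  / 2 if x >= sqrt p, and x ln (1 / p) <= 2 if x < sqrt p.\<close>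

lemma rI_quadratic:
  assumes "0 < p" "p < 1" "0 \<le> x" "x \<le> 1"
  shows "x\<^sup>2 * ln (1 / p) \<le> 4 * rI p x + 81 * p\<^sup>2 * ln (1 / p)"
proof -
  define L where "L = ln (1 / p)"
  have L: "0 < L" using assms by (simp add: L_def)
  have nonneg: "0 \<le> rI p x" by (rule rI_nonneg) fact+
  consider "x \<le> 9 * p" | "9 * p < x" "sqrt p \<le> x" | "9 * p < x" "x < sqrt p" by linarith
  then have "x\<^sup>2 * L \<le> 4 * rI p x + 81 * p\<^sup>2 * L"
  proof cases
    case 1
    have "x\<^sup>2 * L \<le> (9 * p)\<^sup>2 * L"
      using 1 assms L by (intro mult_right_mono power_mono) auto
    then show ?thesis using nonneg by (simp add: power_mult_distrib)
  next
    case 2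
    have ln2: "2 \<le> ln (x / p)"
    proof -
      have "exp 2 = exp 1 * exp (1 :: real)" by (simp flip: exp_add)
      also have "\<dots> \<le> 3 * 3" using exp_le by (intro mult_mono) auto
      also have "\<dots> \<le> x / p" using 2 assms by (simp add: field_simps)
      finally show ?thesis using 2 assms by (subst ln_ge_iff) auto
    qed
    have "sqrt p / p = 1 / sqrt p" using assms by (simp add: real_div_sqrt field_simps)
    then have "L / 2 = ln (sqrt p / p)"
      using assms by (simp add: L_def ln_div ln_sqrt)
    also have "\<dots> \<le> ln (x / p)"
      using 2 assms by (intro ln_mono divide_right_mono) auto
    finally have "x * (L / 2) \<le> x * ln (x / p)" using assms by (intro mult_left_mono) auto
    moreover have "x * 2 \<le> x * ln (x / p)" using ln2 assms by (intro mult_left_mono) auto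
    moreover have "x * ln (x / p) - x + p \<le> rI p x" by (rule rI_lower) fact+
    moreover have "x * x * L \<le> 1 * x * L" using assms L by (intro mult_right_mono) auto
    moreover have "0 \<le> 81 * p\<^sup>2 * L" using L by simp
    moreover have "x * (L / 2) = x * L / 2" by simp
    ultimately show ?thesis using assms(1) unfolding power2_eq_square[of x] by linarith
  next
    case 3
    have ln2: "2 \<le> ln (x / p)"
    proof -
      have "exp 2 = exp 1 * exp (1 :: real)" by (simp flip: exp_add)
      also have "\<dots> \<le> 3 * 3" using exp_le by (intro mult_mono) auto
      also have "\<dots> \<le> x / p" using 3 assms by (simp add: field_simps)
      finally show ?thesis using 3 assms by (subst ln_ge_iff) auto
    qed
    have "L = 2 * ln (1 / sqrt p)" using assms by (simp add: L_def ln_div ln_sqrt)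
    also have "\<dots> \<le> 2 * (1 / sqrt p)"
      using assms ln_le_minus_one[of "1 / sqrt p"] by simp
    finally have "sqrt p * L \<le> 2" using assms by (simp add: field_simps)
    moreover have "x * L \<le> sqrt p * L" using 3 L by (intro mult_right_mono) auto
    ultimately have "x * (x * L) \<le> x * 2" using assms by (intro mult_left_mono) auto
    moreover have "x * 2 \<le> x * ln (x / p)" using ln2 assms by (intro mult_left_mono) auto
    moreover have "x * ln (x / p) - x + p \<le> rI p x" by (rule rI_lower) fact+
    moreover have "0 \<le> 81 * p\<^sup>2 * L" using L by simp
    ultimately show ?thesis using assms unfolding power2_eq_square[of x] mult.assoc[of x x] by linarith
  qed
  then show ?thesis by (simp add: L_def)
qed

lemma card_index_pairs_le: "card (index_pairs n) \<le> n\<^sup>2"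
proof -
  have "card (index_pairs n) \<le> card ({..<n} \<times> {..<n})"
    by (intro card_mono) (auto simp: index_pairs_def)
  then show ?thesis by (simp add: card_cartesian_product power2_eq_square)
qed

text \<open>Sums \<open>rI_quadratic\<close> over at most n^2 pairs, each giving two matrix entries:
  8 and 162 are twice 4 and 81.\<close>

lemma fro_le_of_rate:
  assumes "0 < p" "p < 1" "\<And>e. 0 \<le> x e \<and> x e \<le> 1"
    and "(\<Sum>e\<in>index_pairs n. rI p (x e)) \<le> K * (real n ^ 2 * p\<^sup>2 * ln (1 / p))" "0 \<le> K"
  shows "fro n (sm x) \<le> sqrt (8 * K + 162) * (n * p)"
proof (rule power2_le_imp_le)
  define L where "L = ln (1 / p)"
  have L: "0 < L" using assms by (simp add: L_def)
  have "(fro n (sm x))\<^sup>2 * L = 2 * (\<Sum>e\<in>index_pairs n. (x e)\<^sup>2 * L)"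
    by (simp add: fro_sm sum_distrib_right)
  also have "\<dots> \<le> 2 * (\<Sum>e\<in>index_pairs n. 4 * rI p (x e) + 81 * p\<^sup>2 * L)"
    using assms rI_quadratic[OF assms(1,2)] by (intro mult_left_mono sum_mono) (auto simp: L_def)
  also have "\<dots> = 8 * (\<Sum>e\<in>index_pairs n. rI p (x e)) + 162 * p\<^sup>2 * L * card (index_pairs n)"
    by (simp add: sum.distrib sum_distrib_left algebra_simps)
  also have "\<dots> \<le> 8 * (K * (real n ^ 2 * p\<^sup>2 * L)) + 162 * p\<^sup>2 * L * real (n\<^sup>2)"
    using assms(4) L card_index_pairs_le[of n] unfolding L_def[symmetric]
    by (intro add_mono mult_left_mono) auto
  also have "\<dots> = ((8 * K + 162) * (n * p)\<^sup>2) * L"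
    by (simp add: power_mult_distrib algebra_simps)
  finally show "(fro n (sm x))\<^sup>2 \<le> (sqrt (8 * K + 162) * (n * p))\<^sup>2"
    using L assms(5) by (simp add: power_mult_distrib)
qed (use assms in auto)

lemma fro_sm_const: "0 \<le> p \<Longrightarrow> fro n (sm (\<lambda>_. p)) \<le> n * p"
  by (rule fro_entry_bound) (auto simp: sm_def)

section \<open>Entrywise monotonicity and planted cliques\<close>

lemma pw_nonneg: "(\<And>i j. 0 \<le> A i j) \<Longrightarrow> 0 \<le> pw n A m i j"
  by (induction m arbitrary: i j) (auto simp: mmul_def intro!: sum_nonneg mult_nonneg_nonneg)

lemma pw_mono:
  assumes "\<And>i j. 0 \<le> A i j" "\<And>i j. A i j \<le> B i j"
  shows "pw n A m i j \<le> pw n B m i j"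
proof (induction m arbitrary: i j)
  case (Suc m)
  have B: "0 \<le> B i j" for i j using assms order.trans by blast
  show ?case
    unfolding pw.simps mmul_def
    by (intro sum_mono mult_mono Suc.IH assms pw_nonneg B)
qed (use assms in auto)

text \<open>The increment is a polynomial with nonnegative coefficients in the entries of the base
  and of \<open>D\<close>, hence grows with the base. It lets walks created inside a block be
  counted without the rest of the matrix.\<close>

lemma pw_increment_mono:
  assumes nonneg: "\<And>i j. 0 \<le> A i j" "\<And>i j. 0 \<le> D i j" and le: "\<And>i j. A i j \<le> Y i j"
  shows "pw n (A + D) m i j - pw n A m i j \<le> pw n (Y + D) m i j - pw n Y m i j"
proof (induction m arbitrary: i j)
  case (Suc m)
  have Y: "0 \<le> Y i j" for i j using nonneg le order.trans by blast
  have expand: "pw n (Z + D) (Suc m) i j - pw n Z (Suc m) i j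
      = (\<Sum>k<n. (pw n (Z + D) m i k - pw n Z m i k) * (Z k j + D k j) + pw n Z m i k * D k j)" for Z
    by (simp add: mmul_def sum_subtractf[symmetric] algebra_simps)
  show ?case
    unfolding expand
  proof (rule sum_mono)
    fix k
    have "pw n Y m i k \<le> pw n (Y + D) m i k"
      using Y nonneg by (intro pw_mono) auto
    then have pos: "0 \<le> pw n (Y + D) m i k - pw n Y m i k" by linarith
    have "(pw n (A + D) m i k - pw n A m i k) * (A k j + D k j)
        \<le> (pw n (Y + D) m i k - pw n Y m i k) * (Y k j + D k j)"
      by (rule mult_mono[OF Suc.IH _ pos]) (use le nonneg in auto)
    moreover have "pw n A m i k * D k j \<le> pw n Y m i k * D k j"
      using nonneg le by (intro mult_right_mono pw_mono) auto
    ultimately show "(pw n (A + D) m i k - pw n A m i k) * (A k j + D k j) + pw n A m i k * D k j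
        \<le> (pw n (Y + D) m i k - pw n Y m i k) * (Y k j + D k j) + pw n Y m i k * D k j"
      by (rule add_mono)
  qed
qed simp

definition clique :: "nat set \<Rightarrow> fmat" where
  "clique I = sm (\<lambda>(i, j). of_bool (i \<in> I \<and> j \<in> I))"

lemma clique_entry: "clique I i j = of_bool (i \<noteq> j \<and> i \<in> I \<and> j \<in> I)"
  by (auto simp: clique_def sm_def)

text \<open>\<open>pw n A (Suc m)\<close> is the power m + 2, so walks have m + 1 inner vertices;
  each can be chosen in at least card I - 2 ways.\<close>

lemma pw_clique_ge:
  assumes "I \<subseteq> {..<n}" "2 \<le> card I" "i \<in> I" "j \<in> I"
  shows "(real (card I) - 2) ^ (m + 1) \<le> pw n (clique I) (Suc m) i j"
  using assms(3,4)
proof (induction m arbitrary: i j)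
  case 0
  have fin: "finite I" using assms(1) finite_subset by blast
  have "real (card I) - 2 \<le> real (card (I - {i, j}))"
    using card_Diff_subset[of "{i, j}" I] 0 fin card_insert_le_m1[of 2 "{j}" i] by (cases "i = j") auto
  also have "\<dots> = (\<Sum>k\<in>I - {i, j}. clique I i k * clique I k j)"
    using 0 by (simp add: clique_entry)
  also have "\<dots> \<le> (\<Sum>k<n. clique I i k * clique I k j)"
    using assms(1) by (intro sum_mono2) (auto simp: clique_entry)
  finally show ?case by (simp add: mmul_def)
next
  case (Suc m)
  have fin: "finite I" using assms(1) finite_subset by blast
  have s: "0 \<le> real (card I) - 2" using assms(2) by simp
  have "(real (card I) - 2) ^ (Suc m + 1) = (real (card I) - 2) * (real (card I) - 2) ^ (m + 1)"
    by simp
  also have "\<dots> \<le> real (card (I - {j})) * (real (card I) - 2) ^ (m + 1)"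
    using s Suc.prems fin by (intro mult_right_mono) auto
  also have "\<dots> = (\<Sum>k\<in>I - {j}. (real (card I) - 2) ^ (m + 1) * clique I k j)"
    using Suc.prems by (simp add: clique_entry)
  also have "\<dots> \<le> (\<Sum>k\<in>I - {j}. pw n (clique I) (Suc m) i k * clique I k j)"
    using Suc.prems by (intro sum_mono mult_right_mono Suc.IH) (auto simp: clique_entry)
  also have "\<dots> \<le> (\<Sum>k<n. pw n (clique I) (Suc m) i k * clique I k j)"
    using assms(1) by (intro sum_mono2) (auto intro!: mult_nonneg_nonneg pw_nonneg simp: clique_entry simp del: pw.simps)
  also have "\<dots> = pw n (clique I) (Suc (Suc m)) i j"
    by (simp only: pw.simps(2)[of n "clique I" "Suc m"] mmul_def)
  finally show ?case .
qed

lemma mtr_clique_ge: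
  assumes "I \<subseteq> {..<n}" "2 \<le> card I"
  shows "(real (card I) - 2) ^ (m + 2) \<le> mtr n (pw n (clique I) (Suc m))"
proof -
  have "(real (card I) - 2) ^ (m + 2) = (real (card I) - 2) * (real (card I) - 2) ^ (m + 1)"
    by simp
  also have "\<dots> \<le> real (card I) * (real (card I) - 2) ^ (m + 1)"
    using assms(2) by (intro mult_right_mono) auto
  also have "\<dots> = (\<Sum>i\<in>I. (real (card I) - 2) ^ (m + 1))" by simp
  also have "\<dots> \<le> (\<Sum>i\<in>I. pw n (clique I) (Suc m) i i)"
    using assms by (intro sum_mono pw_clique_ge) auto
  also have "\<dots> \<le> (\<Sum>i<n. pw n (clique I) (Suc m) i i)"
    using assms by (intro sum_mono2) (auto intro!: pw_nonneg simp: clique_entry simp del: pw.simps)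
  finally show ?thesis by (simp only: mtr_def)
qed

lemma mtr_pw_le_fro: "mtr n (pw n A (Suc m)) \<le> fro n A ^ (m + 2)"
proof -
  have "mtr n (pw n A (Suc m)) \<le> fro n (pw n A m) * fro n A"
    using mtr_mmul_le[of n "pw n A m" A] by simp
  also have "\<dots> \<le> fro n A ^ (m + 1) * fro n A"
    by (intro mult_right_mono fro_pw_le_fro) auto
  finally show ?thesis by (simp add: mult.commute)
qed

text \<open>Closed walks that use a planted clique \<open>I\<close>: the only loss is the contribution of the
  original matrix inside \<open>I\<close>.\<close>
lemma plant_clique:
  fixes x :: "nat \<times> nat \<Rightarrow> real"
  assumes "0 < p" "p < 1" "\<And>e. 0 \<le> x e \<and> x e \<le> 1" "I \<subseteq> {..<n}" "2 \<le> card I"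
    and c: "fro n (sm (\<lambda>(i, j). if i \<in> I \<and> j \<in> I then x (i, j) else 0)) \<le> c"
  shows "\<exists>x'. (\<forall>e. 0 \<le> x' e \<and> x' e \<le> 1) \<and>
    (\<Sum>e\<in>index_pairs n. rI p (x' e)) \<le> (\<Sum>e\<in>index_pairs n. rI p (x e)) + real (card I) ^ 2 * ln (1 / p) \<and>
    mtr n (pw n (sm x) (Suc m)) + (real (card I) - 2) ^ (m + 2) - c ^ (m + 2) \<le> mtr n (pw n (sm x') (Suc m))"
proof -
  define xI where "xI = (\<lambda>(i, j). if i \<in> I \<and> j \<in> I then x (i, j) else 0)"
  define x' where "x' = (\<lambda>(i, j). if i \<in> I \<and> j \<in> I then 1 else x (i, j))"
  define D where "D = clique I - sm xI"
  have D: "0 \<le> D i j" for i j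
    using assms(3) by (auto simp: D_def clique_def xI_def sm_def)
  have A: "0 \<le> sm xI i j" "sm xI i j \<le> sm x i j" for i j
    using assms(3) by (auto simp: xI_def sm_def)
  have K: "sm xI + D = clique I" by (simp add: D_def)
  have Y': "sm x + D = sm x'"
    by (auto simp: D_def clique_def xI_def x'_def sm_def fun_eq_iff)
  have "mtr n (pw n (clique I) (Suc m)) - mtr n (pw n (sm xI) (Suc m))
      \<le> mtr n (pw n (sm x') (Suc m)) - mtr n (pw n (sm x) (Suc m))"
    unfolding mtr_def sum_subtractf[symmetric]
    using pw_increment_mono[of "sm xI" D "sm x" n "Suc m"] A D unfolding K Y'
    by (intro sum_mono) auto
  moreover have "(real (card I) - 2) ^ (m + 2) \<le> mtr n (pw n (clique I) (Suc m))"
    by (rule mtr_clique_ge) fact+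
  moreover have "mtr n (pw n (sm xI) (Suc m)) \<le> c ^ (m + 2)"
    using mtr_pw_le_fro[of n "sm xI" m] power_mono[of "fro n (sm xI)" c "m + 2"] c
    by (simp add: xI_def del: pw.simps power_Suc)
  ultimately have tr: "mtr n (pw n (sm x) (Suc m)) + (real (card I) - 2) ^ (m + 2) - c ^ (m + 2)
      \<le> mtr n (pw n (sm x') (Suc m))" by linarith
  have fin: "finite I" using assms(4) finite_subset by blast
  have L: "0 \<le> ln (1 / p)" using assms by simp
  have "(\<Sum>e\<in>index_pairs n. rI p (x' e))
      \<le> (\<Sum>e\<in>index_pairs n. rI p (x e) + of_bool (e \<in> I \<times> I) * ln (1 / p))"
  proof (rule sum_mono)
    fix e
    have "0 \<le> rI p (x e)" using assms(1-3) by (simp add: rI_nonneg)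
    then show "rI p (x' e) \<le> rI p (x e) + of_bool (e \<in> I \<times> I) * ln (1 / p)"
      using rI_one[OF assms(1)] by (cases "e \<in> I \<times> I") (auto simp: x'_def split: prod.splits)
  qed
  also have "\<dots> = (\<Sum>e\<in>index_pairs n. rI p (x e)) + (\<Sum>e\<in>index_pairs n. of_bool (e \<in> I \<times> I)) * ln (1 / p)"
    by (simp add: sum.distrib sum_distrib_right)
  also have "(\<Sum>e\<in>index_pairs n. of_bool (e \<in> I \<times> I)) = real (card (index_pairs n \<inter> I \<times> I))"
    by (simp add: of_bool_def sum.If_cases Int_def)
  also have "card (index_pairs n \<inter> I \<times> I) \<le> card (I \<times> I)"
    using fin by (intro card_mono) auto
  also have "\<dots> = (card I)\<^sup>2" by (simp add: card_cartesian_product power2_eq_square)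
  finally have "(\<Sum>e\<in>index_pairs n. rI p (x' e))
      \<le> (\<Sum>e\<in>index_pairs n. rI p (x e)) + real ((card I)\<^sup>2) * ln (1 / p)"
    using L by (simp add: mult_right_mono)
  moreover have "\<forall>e. 0 \<le> x' e \<and> x' e \<le> 1" using assms(3) by (auto simp: x'_def)
  ultimately show ?thesis using tr by (intro exI[of _ x'] conjI) (auto simp del: pw.simps power_Suc)
qed

text \<open>The restrictions to \<open>B\<close> disjoint intervals of \<open>s\<close> vertices
  involve disjoint sets of edges, so their squared norms sum to at most c^2 and the smallest is at
  most c^2 / B.\<close>

lemma exists_light_block:
  fixes x :: "nat \<times> nat \<Rightarrow> real"
  assumes "0 < B" "B * s \<le> n" "0 < s" "fro n (sm x) \<le> c"
  shows "\<exists>I\<subseteq>{..<n}. card I = s \<and> fro n (sm (\<lambda>(i, j). if i \<in> I \<and> j \<in> I then x (i, j) else 0)) \<le> c / sqrt (real B)"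
proof -
  define I where "I b = {b * s..<b * s + s}" for b
  define y where "y b = (\<lambda>(i, j). if i \<in> I b \<and> j \<in> I b then x (i, j) else 0)" for b
  have c: "0 \<le> c" using assms(4) order.trans[OF fro_nonneg] by blast
  have Idiv: "i div s = b" if "i \<in> I b" for i b
    using that assms(3) unfolding I_def
    by (metis atLeastLessThan_iff div_nat_eqI mult.commute mult_Suc_right add.commute)
  have pt: "(\<Sum>b<B. (y b e)\<^sup>2) \<le> (x e)\<^sup>2" for e
  proof -
    obtain i j where e: "e = (i, j)" by force
    have "(\<Sum>b<B. (y b e)\<^sup>2) \<le> (\<Sum>b<B. if b = i div s then (x e)\<^sup>2 else 0)"
    proof (rule sum_mono)
      fix b
      show "(y b e)\<^sup>2 \<le> (if b = i div s then (x e)\<^sup>2 else 0)"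
        using Idiv[of i b] by (cases "i \<in> I b") (simp_all add: y_def e)
    qed
    also have "\<dots> \<le> (x e)\<^sup>2" by simp
    finally show ?thesis .
  qed
  have "(\<Sum>b<B. (fro n (sm (y b)))\<^sup>2) = 2 * (\<Sum>e\<in>index_pairs n. \<Sum>b<B. (y b e)\<^sup>2)"
    by (simp add: fro_sm sum_distrib_left) (rule sum.swap)
  also have "\<dots> \<le> 2 * (\<Sum>e\<in>index_pairs n. (x e)\<^sup>2)"
    using pt by (intro mult_left_mono sum_mono) auto
  also have "\<dots> = (fro n (sm x))\<^sup>2" by (simp add: fro_sm)
  also have "\<dots> \<le> c\<^sup>2" using assms(4) by (intro power_mono) auto
  finally have total: "(\<Sum>b<B. (fro n (sm (y b)))\<^sup>2) \<le> c\<^sup>2" .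
  have "\<exists>b<B. (fro n (sm (y b)))\<^sup>2 \<le> c\<^sup>2 / B"
  proof (rule ccontr)
    assume "\<not> ?thesis"
    then have "(\<Sum>b<B. c\<^sup>2 / B) < (\<Sum>b<B. (fro n (sm (y b)))\<^sup>2)"
      using assms(1) by (intro sum_strict_mono) auto
    then show False using total assms(1) by simp
  qed
  then obtain b where b: "b < B" "(fro n (sm (y b)))\<^sup>2 \<le> c\<^sup>2 / B" by blast
  have "fro n (sm (y b)) \<le> c / sqrt B"
    by (rule power2_le_imp_le) (use b c in \<open>auto simp: power_divide\<close>)
  moreover have "I b \<subseteq> {..<n}"
  proof -
    have "(b + 1) * s \<le> B * s" using b by (intro mult_right_mono) auto
    then show ?thesis using assms(2) by (auto simp: I_def)
  qed
  moreover have "card (I b) = s" by (simp add: I_def)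
  ultimately show ?thesis by (intro exI[of _ "I b"]) (simp add: y_def)
qed

lemma plant_light_clique:
  fixes x :: "nat \<times> nat \<Rightarrow> real"
  assumes "0 < p" "p < 1" "\<And>e. 0 \<le> x e \<and> x e \<le> 1" "0 < B" "B * s \<le> n" "2 \<le> s" "fro n (sm x) \<le> c"
  shows "\<exists>x'. (\<forall>e. 0 \<le> x' e \<and> x' e \<le> 1) \<and>
    (\<Sum>e\<in>index_pairs n. rI p (x' e)) \<le> (\<Sum>e\<in>index_pairs n. rI p (x e)) + real s ^ 2 * ln (1 / p) \<and>
    mtr n (pw n (sm x) (Suc m)) + (real s - 2) ^ (m + 2) - (c / sqrt (real B)) ^ (m + 2) \<le> mtr n (pw n (sm x') (Suc m))"
proof -
  obtain I where I: "I \<subseteq> {..<n}" "card I = s"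
    "fro n (sm (\<lambda>(i, j). if i \<in> I \<and> j \<in> I then x (i, j) else 0)) \<le> c / sqrt (real B)"
    using exists_light_block[OF assms(4,5) _ assms(7)] assms(6) by auto
  then show ?thesis
    using plant_clique[OF assms(1-3) I(1) _ I(3), of m] assms(6) by simp
qed

section \<open>Transfer to random matrices\<close>

abbreviation entries :: "real mat \<Rightarrow> fmat" where
  "entries Y \<equiv> (\<lambda>i j. Y $$ (i, j))"

lemma pw_cong:
  assumes "\<And>i j. i < n \<Longrightarrow> j < n \<Longrightarrow> A i j = B i j" "i < n" "j < n"
  shows "pw n A m i j = pw n B m i j"
  using assms(2,3)
proof (induction m arbitrary: i j)
  case (Suc m)
  then show ?case
    unfolding pw.simps mmul_def by (intro sum.cong refl arg_cong2[where f = "(*)"] assms(1) Suc.IH) auto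
qed (simp add: assms(1))

lemma pow_mat_entry:
  assumes Y: "Y \<in> carrier_mat n n" and "i < n" "j < n"
  shows "(Y ^\<^sub>m Suc m) $$ (i, j) = pw n (entries Y) m i j"
  using assms(2,3)
proof (induction m arbitrary: i j)
  case 0
  then show ?case using Y by simp
next
  case (Suc m)
  have P: "Y ^\<^sub>m Suc m \<in> carrier_mat n n" using Y by (rule pow_carrier_mat)
  have "(Y ^\<^sub>m Suc (Suc m)) $$ (i, j) = (Y ^\<^sub>m Suc m * Y) $$ (i, j)" by simp
  also have "\<dots> = row (Y ^\<^sub>m Suc m) i \<bullet> col Y j"
    using P Y Suc.prems by (subst index_mult_mat) auto
  also have "\<dots> = (\<Sum>k\<in>{0..<n}. (Y ^\<^sub>m Suc m) $$ (i, k) * Y $$ (k, j))"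
    using P Y Suc.prems by (auto simp: scalar_prod_def simp del: pow_mat.simps intro!: sum.cong)
  also have "\<dots> = (\<Sum>k<n. pw n (entries Y) m i k * entries Y k j)"
    using Suc.IH Suc.prems(1) by (intro sum.cong) (auto simp del: pow_mat.simps)
  finally show ?case by (simp add: mmul_def)
qed

lemma mat_trace_pow:
  assumes "Y \<in> carrier_mat n n"
  shows "mat_trace (Y ^\<^sub>m Suc m) = mtr n (pw n (entries Y) m)"
  using pow_carrier_mat[OF assms, of "Suc m"] pow_mat_entry[OF assms, of _ _ m]
  by (auto simp: mat_trace_def mtr_def simp del: pow_mat.simps)

lemma mtr_pw_cong:
  assumes "\<And>i j. i < n \<Longrightarrow> j < n \<Longrightarrow> A i j = B i j"
  shows "mtr n (pw n A m) = mtr n (pw n B m)"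
  unfolding mtr_def using pw_cong[OF assms] by (intro sum.cong) auto

lemma rate_I_eq: "0 \<le> x \<Longrightarrow> x \<le> 1 \<Longrightarrow> rate_I p x = ereal (rI p x)"
  by (simp add: rate_I_def rI_def)

lemma phi_le:
  assumes "\<And>e. 0 \<le> x e \<and> x e \<le> 1" "t * (real n * p) ^ Suc m \<le> mtr n (pw n (sm x) m)"
  shows "phi (Suc m) n p t \<le> ereal (\<Sum>e\<in>index_pairs n. rI p (x e))"
proof -
  define Y where "Y = mat n n (\<lambda>(i, j). sm x i j)"
  have ent: "entries Y i j = sm x i j" if "i < n" "j < n" for i j
    using that by (simp add: Y_def)
  have Yc: "Y \<in> carrier_mat n n" by (simp add: Y_def)
  have "mat_trace (Y ^\<^sub>m Suc m) = mtr n (pw n (sm x) m)"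
    unfolding mat_trace_pow[OF Yc] by (rule mtr_pw_cong) (simp only: ent)
  moreover have "Y \<in> sym_mats0 n"
    unfolding sym_mats0_def using Yc by (auto simp: Y_def sm_def intro!: eq_matI)
  ultimately have "Y \<in> {Y \<in> sym_mats0 n. mat_trace (Y ^\<^sub>m Suc m) \<ge> t * (real n * p) ^ Suc m}"
    using assms(2) by (simp del: pow_mat.simps)
  then have "phi (Suc m) n p t \<le> Lambda_star n p Y"
    unfolding phi_def by (rule INF_lower)
  also have "Lambda_star n p Y = (\<Sum>e\<in>index_pairs n. ereal (rI p (x e)))"
    unfolding Lambda_star_def
  proof (rule sum.cong[OF refl])
    fix e assume e: "e \<in> index_pairs n"
    then have "Y $$ e = x e" by (auto simp: index_pairs_def Y_def sm_def)
    then show "rate_I p (Y $$ e) = ereal (rI p (x e))" using assms(1) by (simp add: rate_I_eq)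
  qed
  finally show ?thesis by simp
qed

lemma phi_nonneg:
  assumes "0 < p" "p < 1"
  shows "0 \<le> phi d n p t"
  unfolding phi_def Lambda_star_def
  by (intro INF_greatest sum_nonneg) (use rI_nonneg[OF assms] in \<open>auto simp: rate_I_def rI_def\<close>)

lemma erdos_renyi_atom:
  assumes ER: "erdos_renyi_adjacency M n p X" and p: "0 < p" "p < 1" and n: "2 \<le> n" and S: "S \<subseteq> index_pairs n"
  defines "A \<equiv> {\<omega> \<in> space M. \<forall>e\<in>index_pairs n. X \<omega> $$ e = bern S e}"
  shows "A \<in> sets M" "measure M A = bw p (index_pairs n) S"
proof -
  interpret prob_space M using ER by (simp add: erdos_renyi_adjacency_def)
  let ?E = "index_pairs n"
  have indep: "indep_vars (\<lambda>_. borel) (\<lambda>e \<omega>. X \<omega> $$ e) ?E"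
    using ER by (simp add: erdos_renyi_adjacency_def)
  have meas: "(\<lambda>\<omega>. X \<omega> $$ e) \<in> borel_measurable M" if "e \<in> ?E" for e
    using indep that unfolding indep_vars_def2 by blast
  \<comment> \<open>Finite intersections and the product rule for independence ask for a nonempty
    index set; this is where \<open>2 \<le> n\<close> enters.\<close>
  have "(0, 1) \<in> ?E" using n by (simp add: index_pairs_def)
  then have ne: "?E \<noteq> {}" by blast
  have Aeq: "A = (\<Inter>e\<in>?E. (\<lambda>\<omega>. X \<omega> $$ e) -` {bern S e} \<inter> space M)"
    using ne by (auto simp: A_def)
  show "A \<in> sets M"
    unfolding Aeq using ne meas by (intro sets.finite_INT) (auto intro: measurable_sets)
  have single: "prob ((\<lambda>\<omega>. X \<omega> $$ e) -` {bern S e} \<inter> space M) = (if e \<in> S then p else 1 - p)" if "e \<in> ?E" for e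
  proof -
    have "prob ((\<lambda>\<omega>. X \<omega> $$ e) -` {bern S e} \<inter> space M) = measure (distr M borel (\<lambda>\<omega>. X \<omega> $$ e)) {bern S e}"
      using meas[OF that] by (simp add: measure_distr)
    also have "distr M borel (\<lambda>\<omega>. X \<omega> $$ e) = distr (measure_pmf (bernoulli_pmf p)) borel (of_bool :: bool \<Rightarrow> real)"
      using ER that by (auto simp: erdos_renyi_adjacency_def)
    also have "measure \<dots> {bern S e} = measure (measure_pmf (bernoulli_pmf p)) ((of_bool :: bool \<Rightarrow> real) -` {bern S e})"
      by (simp add: measure_distr)
    also have "(of_bool :: bool \<Rightarrow> real) -` {bern S e} = {e \<in> S}"
      by (auto simp: bern_def)
    also have "measure (measure_pmf (bernoulli_pmf p)) {e \<in> S} = (if e \<in> S then p else 1 - p)"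
      using p by (simp add: measure_pmf_single)
    finally show ?thesis .
  qed
  have "prob A = (\<Prod>e\<in>?E. prob ((\<lambda>\<omega>. X \<omega> $$ e) -` {bern S e} \<inter> space M))"
    unfolding Aeq using indep ne by (intro indep_varsD) auto
  also have "\<dots> = (\<Prod>e\<in>?E. if e \<in> S then p else 1 - p)"
    by (intro prod.cong refl single)
  also have "\<dots> = bw p ?E S"
    using S by (simp add: prod.If_cases bw_def Int_absorb1 Diff_eq)
  finally show "prob A = bw p ?E S" .
qed

text \<open>The atoms of the edge variables cover the event up to a null set, so that measurability
  is only asked of finite unions of atoms and their complements.\<close>

lemma erdos_renyi_measure_le:
  assumes ER: "erdos_renyi_adjacency M n p X" and p: "0 < p" "p < 1" and n: "2 \<le> n"
  shows "measure M {\<omega> \<in> space M. c \<le> mat_trace (X \<omega> ^\<^sub>m Suc m)}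
    \<le> bprob p (index_pairs n) {S. c \<le> mtr n (pw n (sm (bern S)) m)}"
proof -
  interpret prob_space M using ER by (simp add: erdos_renyi_adjacency_def)
  let ?E = "index_pairs n"
  define A where "A S = {\<omega> \<in> space M. \<forall>e\<in>?E. X \<omega> $$ e = bern S e}" for S
  have A: "A S \<in> sets M" "prob (A S) = bw p ?E S" if "S \<subseteq> ?E" for S
    using erdos_renyi_atom[OF ER p n that] by (simp_all add: A_def)
  have disj: "disjoint_family_on A (Pow ?E)"
    unfolding disjoint_family_on_def
  proof (intro ballI impI)
    fix S T assume S: "S \<in> Pow ?E" and T: "T \<in> Pow ?E" and ST: "S \<noteq> T"
    then obtain e where "e \<in> ?E" "e \<in> S \<longleftrightarrow> e \<notin> T" by blast
    then have "e \<in> ?E" "bern S e \<noteq> bern T e" by (auto simp: bern_def)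
    then show "A S \<inter> A T = {}" by (force simp: A_def)
  qed
  define U where "U = (\<Union>S\<in>Pow ?E. A S)"
  have U: "U \<in> sets M" unfolding U_def using A by (intro sets.finite_UN) auto
  have "prob U = (\<Sum>S\<in>Pow ?E. prob (A S))"
    unfolding U_def using A disj by (intro finite_measure_finite_Union) auto
  also have "\<dots> = 1" using A by (simp add: bw_total)
  finally have "prob (space M - U) = 0" using prob_compl[OF U] by simp
  define G where "G = {S \<in> Pow ?E. c \<le> mtr n (pw n (sm (bern S)) m)}"
  let ?Ev = "{\<omega> \<in> space M. c \<le> mat_trace (X \<omega> ^\<^sub>m Suc m)}"
  have sub: "?Ev \<subseteq> (\<Union>S\<in>G. A S) \<union> (space M - U)"
  proof
    fix \<omega> assume \<omega>: "\<omega> \<in> ?Ev"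
    show "\<omega> \<in> (\<Union>S\<in>G. A S) \<union> (space M - U)"
    proof (cases "\<omega> \<in> U")
      case True
      then obtain S where S: "S \<subseteq> ?E" "\<omega> \<in> A S" by (auto simp: U_def)
      have Xs: "X \<omega> \<in> carrier_mat n n" "transpose_mat (X \<omega>) = X \<omega>" "\<And>i. i < n \<Longrightarrow> X \<omega> $$ (i, i) = 0"
        using ER \<omega> by (auto simp: erdos_renyi_adjacency_def sym_mats0_def)
      have "entries (X \<omega>) i j = sm (bern S) i j" if ij: "i < n" "j < n" for i j
      proof -
        have "X \<omega> $$ (j, i) = X \<omega> $$ (i, j)"
          using Xs(1,2) ij by (metis carrier_matD index_transpose_mat(1))
        moreover have "X \<omega> $$ e = bern S e" if "e \<in> ?E" for e using S(2) that by (simp add: A_def)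
        ultimately show ?thesis
          using ij Xs(3) by (auto simp: sm_def index_pairs_def)
      qed
      then have "mat_trace (X \<omega> ^\<^sub>m Suc m) = mtr n (pw n (sm (bern S)) m)"
        unfolding mat_trace_pow[OF Xs(1)] by (rule mtr_pw_cong)
      then have "S \<in> G" using \<omega> S(1) by (simp add: G_def del: pow_mat.simps)
      then show ?thesis using S(2) by blast
    qed (use \<omega> in auto)
  qed
  have G: "finite G" "\<And>S. S \<in> G \<Longrightarrow> S \<subseteq> ?E" by (auto simp: G_def intro: finite_subset[of _ "Pow ?E"])
  have "prob ?Ev \<le> prob ((\<Union>S\<in>G. A S) \<union> (space M - U))"
    using sub G A U by (intro finite_measure_mono sets.Un sets.finite_UN sets.compl_sets) auto
  also have "\<dots> \<le> prob (\<Union>S\<in>G. A S) + prob (space M - U)"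
    using G A U by (intro measure_Un_le sets.finite_UN sets.compl_sets) auto
  also have "\<dots> = prob (\<Union>S\<in>G. A S)" using \<open>prob (space M - U) = 0\<close> by simp
  also have "\<dots> \<le> (\<Sum>S\<in>G. prob (A S))"
    using G A by (intro finite_measure_subadditive_finite) auto
  also have "\<dots> = bprob p ?E {S. c \<le> mtr n (pw n (sm (bern S)) m)}"
  proof -
    have eq: "{S. c \<le> mtr n (pw n (sm (bern S)) m)} \<inter> Pow ?E = G" by (auto simp: G_def)
    show ?thesis unfolding bprob_def eq by (rule sum.cong[OF refl], rule A(2), rule G(2))
  qed
  finally show ?thesis .
qed

section \<open>Upper bound on the trace\<close>

lemma cvx_weighted_mean:
  assumes "cvx C" "finite F" "F \<noteq> {}" "\<And>S. S \<in> F \<Longrightarrow> 0 < w S" "\<And>S. S \<in> F \<Longrightarrow> u S \<in> C"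
  shows "(\<lambda>e. (\<Sum>S\<in>F. w S * u S e) / (\<Sum>S\<in>F. w S)) \<in> C"
  using assms(2-5)
proof (induction F rule: finite_ne_induct)
  case (singleton S)
  then have "(\<lambda>e. (\<Sum>S\<in>{S}. w S * u S e) / (\<Sum>S\<in>{S}. w S)) = u S"
    by (simp add: fun_eq_iff less_imp_neq[symmetric])
  then show ?case using singleton by simp
next
  case (insert S F)
  let ?W = "\<Sum>S\<in>F. w S"
  have W: "0 < ?W" and w: "0 < w S"
    using insert by (auto intro!: sum_pos)
  have IH: "(\<lambda>e. (\<Sum>S\<in>F. w S * u S e) / ?W) \<in> C"
    using insert by simp
  define l where "l = w S / (w S + ?W)"
  have l: "0 \<le> l" "l \<le> 1" "1 - l = ?W / (w S + ?W)"
    using W w by (auto simp: l_def field_simps)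
  have uS: "u S \<in> C" using insert.prems by simp
  have "(\<lambda>e. l * u S e + (1 - l) * (\<lambda>e. (\<Sum>S\<in>F. w S * u S e) / ?W) e) \<in> C"
    by (rule assms(1)[unfolded cvx_def, rule_format, OF uS IH]) (simp add: l(1,2))
  moreover have "l * u S e + (1 - l) * ((\<Sum>S\<in>F. w S * u S e) / ?W)
      = (\<Sum>S\<in>insert S F. w S * u S e) / (\<Sum>S\<in>insert S F. w S)" for e
    unfolding l(3) using W insert.hyps by (simp add: l_def add_divide_distrib)
  ultimately show ?case by (simp only:)
qed

lemma cmean_in_cvx:
  assumes "finite E" "0 < p" "p < 1" "\<A> \<subseteq> Pow E" "\<A> \<noteq> {}" "cvx C" "\<And>S. S \<in> \<A> \<Longrightarrow> bern S \<in> C"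
  shows "cmean p E \<A> \<in> C"
proof -
  have "finite \<A>" using assms finite_subset by blast
  then have mem: "(\<lambda>e. (\<Sum>S\<in>\<A>. bw p E S * bern S e) / (\<Sum>S\<in>\<A>. bw p E S)) \<in> C"
    using assms by (intro cvx_weighted_mean) (auto intro: bw_pos)
  have "cmean p E \<A> = (\<lambda>e. (\<Sum>S\<in>\<A>. bw p E S * bern S e) / (\<Sum>S\<in>\<A>. bw p E S))"
    using assms(4) by (simp add: fun_eq_iff cmean_def bprob_def Int_absorb2)
  then show ?thesis using mem by simp
qed

text \<open>Case distinction on the mean \<open>y\<close> of the ball around \<open>A\<close>. A
  rate above K v_n gives mass at most \<open>q\<close>; a trace of at least T - err gives mass at
  most exp (- R); otherwise passing from \<open>y\<close> to the graph must gain more than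
  \<open>err\<close>. Both lie within \<open>g\<close> of \<open>A\<close>, hence
  \<open>2 * g\<close>. By the shifted exponent m = 2 means d = 3, where the gain forces a cubic
  remainder of at least 8 a; for larger \<open>m\<close> it is impossible.\<close>

lemma cell_tail:
  fixes p K g a c err T R :: real
  assumes p: "0 < p" "p < 1" and K: "0 \<le> K" and m: "2 \<le> m" and g: "0 < g" and a: "0 \<le> a"
    and c: "c = sqrt (8 * K + 162)"
    and err: "(real m + 4) * (c * (n * p) + 2 * g) ^ m * (2 * g) + 8 * a \<le> err"
    and cub1: "m = 2 \<Longrightarrow> 4 * ((c + 1) * (n * p)) * (2 * g)\<^sup>2 \<le> a"
    and cub2: "m = 2 \<Longrightarrow> 2 ^ n * exp (- a\<^sup>2 / (8 * (2 * g) ^ 4)) \<le> q"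
    and q: "exp (- (K * (real n ^ 2 * p\<^sup>2 * ln (1 / p)))) \<le> q"
    and R: "\<And>x. (\<And>e. 0 \<le> x e \<and> x e \<le> 1) \<Longrightarrow>
      (\<Sum>e\<in>index_pairs n. rI p (x e)) \<le> K * (real n ^ 2 * p\<^sup>2 * ln (1 / p)) \<Longrightarrow>
      T - err \<le> mtr n (pw n (sm x) m) \<Longrightarrow> R \<le> (\<Sum>e\<in>index_pairs n. rI p (x e))"
  shows "bprob p (index_pairs n) {S. s4 n (sm (bern S) - A) \<le> g \<and> T \<le> mtr n (pw n (sm (bern S)) m)}
    \<le> q + exp (- R)"
proof -
  let ?E = "index_pairs n"
  let ?v = "real n ^ 2 * p\<^sup>2 * ln (1 / p)"
  define \<A> where "\<A> = {S \<in> Pow ?E. s4 n (sm (bern S) - A) \<le> g}"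
  let ?B = "{S. s4 n (sm (bern S) - A) \<le> g \<and> T \<le> mtr n (pw n (sm (bern S)) m)}"
  have q0: "0 \<le> q" using q exp_ge_zero order.trans by blast
  have B\<A>: "bprob p ?E ?B \<le> bprob p ?E \<A>"
    using p by (intro bprob_mono) (auto simp: \<A>_def)
  show ?thesis
  proof (cases "\<A> = {}")
    case True
    then have "bprob p ?E ?B \<le> 0" using B\<A> by (simp add: bprob_def)
    then show ?thesis using q0 by (simp add: add_increasing2 order.trans)
  next
    case False
    have sub: "\<A> \<subseteq> Pow ?E" by (auto simp: \<A>_def)
    define y where "y = cmean p ?E \<A>"
    have y01: "0 \<le> y e \<and> y e \<le> 1" for e
      using cmean_range[OF finite_index_pairs p sub False] by (simp add: y_def)
    have mass: "bprob p ?E \<A> \<le> exp (- (\<Sum>e\<in>?E. rI p (y e)))"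
      unfolding y_def by (rule bprob_le_exp_rate) (use p sub False in auto)
    show ?thesis
    proof (cases "(\<Sum>e\<in>?E. rI p (y e)) \<le> K * ?v")
      case False
      then have "exp (- (\<Sum>e\<in>?E. rI p (y e))) \<le> exp (- (K * ?v))" by simp
      then have "bprob p ?E ?B \<le> q" using B\<A> mass q by linarith
      then show ?thesis by (simp add: add_increasing2)
    next
      case low: True
      have yfro: "fro n (sm y) \<le> c * (n * p)"
        unfolding c by (rule fro_le_of_rate) (use p y01 low K in auto)
      have "y \<in> {x. s4 n (sm x - A) \<le> g}"
        unfolding y_def by (rule cmean_in_cvx) (use p sub False in \<open>auto simp: \<A>_def s4_ball_cvx\<close>)
      then have yA: "s4 n (A - sm y) \<le> g" by (simp only: mem_Collect_eq s4_minus_commute[of n A])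
      define a0 where "a0 = c * (n * p) + 2 * g"
      have sy: "s4 n (sm y) \<le> a0" "fro n (sm y) \<le> a0"
        using yfro s4_le_fro[of n "sm y"] g by (auto simp: a0_def)
      have Sy: "s4 n (sm (bern S) - sm y) \<le> 2 * g" if "s4 n (sm (bern S) - A) \<le> g" for S
        using s4_triangle[of n "sm (bern S)" "sm y" A] that yA by linarith
      have sS: "s4 n (sm (bern S)) \<le> a0" if "s4 n (sm (bern S) - A) \<le> g" for S
      proof -
        have "sm (bern S) = (sm (bern S) - sm y) + sm y" by (simp add: fun_eq_iff)
        then have "s4 n (sm (bern S)) \<le> s4 n (sm (bern S) - sm y) + s4 n (sm y)" by (metis s4_plus)
        then show ?thesis using Sy[OF that] s4_le_fro[of n "sm y"] yfro by (simp add: a0_def)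
      qed
      have a0: "0 \<le> a0" "2 * g \<le> a0"
        using order.trans[OF fro_nonneg yfro] g by (auto simp: a0_def)
      have main: "(real m + 4) * a0 ^ m * (2 * g) + 8 * a \<le> err" using err by (simp add: a0_def)
      show ?thesis
      proof (cases "T - err \<le> mtr n (pw n (sm y) m)")
        case True
        have "R \<le> (\<Sum>e\<in>?E. rI p (y e))" by (rule R) (use y01 low True in auto)
        then have "exp (- (\<Sum>e\<in>?E. rI p (y e))) \<le> exp (- R)" by simp
        then have "bprob p ?E ?B \<le> exp (- R)" using B\<A> mass by linarith
        then show ?thesis using q0 by simp
      next
        case yT: False
        show ?thesis
        proof (cases "m = 2")
          case m2: True
          have "bprob p ?E ?B \<le> bprob p ?E {S. s4 n (sm (bern S) - sm y) \<le> 2 * g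
              \<and> 8 * a \<le> mtr n (pw n (sm (bern S) - sm y) 2)}"
          proof (intro bprob_mono subsetI CollectI conjI)
            fix S assume S: "S \<in> ?B \<inter> Pow ?E"
            then have S': "s4 n (sm (bern S) - A) \<le> g" "T \<le> mtr n (pw n (sm (bern S)) 2)"
              by (auto simp: m2)
            show "s4 n (sm (bern S) - sm y) \<le> 2 * g" by (rule Sy[OF S'(1)])
            have "mtr n (pw n (sm (bern S)) 2) \<le> mtr n (pw n (sm y) 2) + 6 * a0 ^ 2 * (2 * g)
                + mtr n (pw n (sm (bern S) - sm y) 2)"
              by (rule mtr_cube_le[OF sy Sy[OF S'(1)] a0(2)])
            moreover have "mtr n (pw n (sm y) 2) < T - err" using yT by (simp add: m2)
            moreover have "6 * a0 ^ 2 * (2 * g) + 8 * a \<le> err" using main by (simp add: m2)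
            ultimately show "8 * a \<le> mtr n (pw n (sm (bern S) - sm y) 2)"
              using S'(2) by linarith
          qed (use p in auto)
          also have "\<dots> \<le> 2 ^ n * exp (- a\<^sup>2 / (8 * (2 * g) ^ 4))"
          proof (rule cube_tail)
            have "sm y - sm (\<lambda>_. p) = sm y + (\<lambda>i j. (-1) * sm (\<lambda>_. p) i j)" by (simp add: fun_eq_iff)
            then have "fro n (sm y - sm (\<lambda>_. p)) \<le> fro n (sm y) + fro n (\<lambda>i j. (-1) * sm (\<lambda>_. p) i j)"
              by (metis fro_plus)
            also have "\<dots> = fro n (sm y) + fro n (sm (\<lambda>_. p))"
              by (simp only: fro_scale abs_minus_cancel abs_one mult_1)
            also have "\<dots> \<le> (c + 1) * (n * p)"
              using yfro fro_sm_const[of p n] p by (simp add: algebra_simps)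
            finally show "fro n (sm y - sm (\<lambda>_. p)) \<le> (c + 1) * (n * p)" .
            show "0 \<le> (c + 1) * (real n * p)" using p K by (simp add: c)
          qed (use p a g cub1[OF m2] in auto)
          also have "\<dots> \<le> q" by (rule cub2) fact
          finally show ?thesis by (simp add: add_increasing2)
        next
          case False
          then obtain k where k: "m = k + 3"
            using m by (metis add.commute le_antisym less_eq_Suc_le not_less_eq_eq numeral_2_eq_2 numeral_3_eq_3 le_Suc_ex)
          have empty: "?B = {}"
          proof (rule ccontr)
            assume "?B \<noteq> {}"
            then obtain S where S: "s4 n (sm (bern S) - A) \<le> g" "T \<le> mtr n (pw n (sm (bern S)) (k + 3))"
              by (auto simp: k)
            have "\<bar>mtr n (pw n (sm (bern S)) (k + 3)) - mtr n (pw n (sm y) (k + 3))\<bar>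
                \<le> (real k + 4) * a0 ^ (k + 3) * (2 * g)"
              by (rule mtr_pw_diff_le[OF sS[OF S(1)] sy(1) Sy[OF S(1)]])
            moreover have "(real k + 4) * a0 ^ (k + 3) * (2 * g) \<le> (real m + 4) * a0 ^ m * (2 * g)"
              unfolding k using a0 g by (intro mult_right_mono) auto
            ultimately show False using S(2) yT main a unfolding k by linarith
          qed
          have "bprob p ?E ?B = 0" unfolding empty by (simp add: bprob_def)
          then show ?thesis using q0 by simp
        qed
      qed
    qed
  qed
qed

lemma bprob_trace_le:
  fixes p K g a c err T R :: real
  assumes p: "0 < p" "p < 1" and K: "0 \<le> K" and m: "2 \<le> m" and g: "0 < g" and a: "0 \<le> a"
    and c: "c = sqrt (8 * K + 162)"
    and err: "(real m + 4) * (c * (n * p) + 2 * g) ^ m * (2 * g) + 8 * a \<le> err"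
    and cub1: "m = 2 \<Longrightarrow> 4 * ((c + 1) * (n * p)) * (2 * g)\<^sup>2 \<le> a"
    and cub2: "m = 2 \<Longrightarrow> 2 ^ n * exp (- a\<^sup>2 / (8 * (2 * g) ^ 4)) \<le> q"
    and q: "exp (- (K * (real n ^ 2 * p\<^sup>2 * ln (1 / p)))) \<le> q"
    and R: "\<And>x. (\<And>e. 0 \<le> x e \<and> x e \<le> 1) \<Longrightarrow>
      (\<Sum>e\<in>index_pairs n. rI p (x e)) \<le> K * (real n ^ 2 * p\<^sup>2 * ln (1 / p)) \<Longrightarrow>
      T - err \<le> mtr n (pw n (sm x) m) \<Longrightarrow> R \<le> (\<Sum>e\<in>index_pairs n. rI p (x e))"
    and N: "finite N" "bprob p (index_pairs n) {S. \<forall>A\<in>N. g < s4 n (sm (bern S) - A)} \<le> 2 * q"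
  shows "bprob p (index_pairs n) {S. T \<le> mtr n (pw n (sm (bern S)) m)} \<le> 2 * q + card N * (q + exp (- R))"
proof -
  let ?E = "index_pairs n"
  let ?B = "\<lambda>A. {S. s4 n (sm (bern S) - A) \<le> g \<and> T \<le> mtr n (pw n (sm (bern S)) m)}"
  let ?U = "{S. \<forall>A\<in>N. g < s4 n (sm (bern S) - A)}"
  have "bprob p ?E {S. T \<le> mtr n (pw n (sm (bern S)) m)} \<le> bprob p ?E (?U \<union> (\<Union>A\<in>N. ?B A))"
    using p by (intro bprob_mono) (auto simp: not_less)
  also have "\<dots> \<le> bprob p ?E ?U + bprob p ?E (\<Union>A\<in>N. ?B A)"
    using p by (intro bprob_Un) auto
  also have "\<dots> \<le> 2 * q + (\<Sum>A\<in>N. bprob p ?E (?B A))"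
    using p N by (intro add_mono bprob_UN) auto
  also have "\<dots> \<le> 2 * q + (\<Sum>A\<in>N. q + exp (- R))"
    by (intro add_mono sum_mono order.refl cell_tail[OF p K m g a c err cub1 cub2 q R])
  finally show ?thesis by simp
qed

section \<open>Continuity of \<open>phi\<close> at scale v_n\<close>

lemma phi_perturb:
  fixes x :: "nat \<times> nat \<Rightarrow> real"
  assumes p: "0 < p" "p < 1" and x: "\<And>e. 0 \<le> x e \<and> x e \<le> 1" and B: "0 < B" "2 * \<gamma> * real B * p \<le> 1"
    and gam: "3 \<le> \<gamma> * (n * p)" and fro: "fro n (sm x) \<le> c"
    and tr: "t * (real n * p) ^ (m + 2) - (\<gamma> * (n * p)) ^ (m + 2) + (c / sqrt (real B)) ^ (m + 2)
      \<le> mtr n (pw n (sm x) (Suc m))"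
  shows "phi (m + 2) n p t \<le> ereal ((\<Sum>e\<in>index_pairs n. rI p (x e)) + 4 * \<gamma>\<^sup>2 * (real n ^ 2 * p\<^sup>2 * ln (1 / p)))"
proof -
  \<comment> \<open>The 2 makes up for the loss in \<open>mtr_clique_ge\<close>. Since
    \<open>3 \<le> \<gamma> * (n * p)\<close>, the size stays below 2 \<gamma> n p, so that
    \<open>B\<close> blocks of it fit into \<open>n\<close> vertices.\<close>
  define s where "s = nat \<lceil>\<gamma> * (n * p)\<rceil> + 2"
  have s: "\<gamma> * (n * p) \<le> real s - 2" "real s \<le> 2 * (\<gamma> * (n * p))" "2 \<le> s"
    using gam unfolding s_def by linarith+
  have "real (B * s) \<le> real B * (2 * (\<gamma> * (n * p)))"
    using s by (simp add: mult_left_mono)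
  also have "\<dots> = (2 * \<gamma> * real B * p) * n" by simp
  also have "\<dots> \<le> 1 * real n" using B by (intro mult_right_mono) auto
  finally have "real (B * s) \<le> real n" by simp
  then have Bs: "B * s \<le> n" by (simp only: of_nat_le_iff)
  obtain x' where x': "\<And>e. 0 \<le> x' e \<and> x' e \<le> 1"
    "(\<Sum>e\<in>index_pairs n. rI p (x' e)) \<le> (\<Sum>e\<in>index_pairs n. rI p (x e)) + real s ^ 2 * ln (1 / p)"
    "mtr n (pw n (sm x) (Suc m)) + (real s - 2) ^ (m + 2) - (c / sqrt (real B)) ^ (m + 2)
      \<le> mtr n (pw n (sm x') (Suc m))"
    using plant_light_clique[OF p x B(1) Bs s(3) fro, of m] by blast
  have "(\<gamma> * (n * p)) ^ (m + 2) \<le> (real s - 2) ^ (m + 2)"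
    using s gam by (intro power_mono) auto
  then have "t * (real n * p) ^ Suc (Suc m) \<le> mtr n (pw n (sm x') (Suc m))"
    using x'(3) tr by (simp del: pw.simps)
  then have "phi (Suc (Suc m)) n p t \<le> ereal (\<Sum>e\<in>index_pairs n. rI p (x' e))"
    by (intro phi_le x'(1))
  also have "\<dots> \<le> ereal ((\<Sum>e\<in>index_pairs n. rI p (x e)) + 4 * \<gamma>\<^sup>2 * (real n ^ 2 * p\<^sup>2 * ln (1 / p)))"
  proof -
    have "real s ^ 2 * ln (1 / p) \<le> (2 * (\<gamma> * (n * p))) ^ 2 * ln (1 / p)"
      using s(2) p by (intro mult_right_mono power_mono) auto
    also have "\<dots> = 4 * \<gamma>\<^sup>2 * (real n ^ 2 * p\<^sup>2 * ln (1 / p))"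
      by (simp add: power_mult_distrib mult_ac)
    finally show ?thesis using x'(2) by simp
  qed
  finally show ?thesis by simp
qed

text \<open>Plants a clique of size about (t + 1) n p in the constant matrix \<open>p\<close>, whose
  rate is 0; (t + 1)^d >= t + 1 pays for the target t and for the loss (n p)^d caused by
  \<open>B = 1\<close>. The bound makes \<open>phi\<close> finite and determines how large the
  truncation constant K must be.\<close>

lemma phi_upper:
  assumes p: "0 < p" "p < 1" and t: "1 \<le> t" and "2 * (t + 1) * p \<le> 1" and np: "3 \<le> n * p"
  shows "phi (m + 2) n p t \<le> ereal (4 * (t + 1)\<^sup>2 * (real n ^ 2 * p\<^sup>2 * ln (1 / p)))"
proof -
  have "phi (m + 2) n p t \<le> ereal ((\<Sum>e\<in>index_pairs n. rI p ((\<lambda>_. p) e))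
      + 4 * (t + 1)\<^sup>2 * (real n ^ 2 * p\<^sup>2 * ln (1 / p)))"
  proof (rule phi_perturb[where B = 1 and c = "n * p"])
    show "fro n (sm (\<lambda>_. p)) \<le> n * p" using p by (intro fro_sm_const) auto
    have "1 * (n * p) \<le> (t + 1) * (n * p)" using t np by (intro mult_right_mono) auto
    then show "3 \<le> (t + 1) * (n * p)" using np by linarith
    have "t + 1 \<le> (t + 1) ^ (m + 2)" using t by (intro self_le_power) auto
    then have "(t + 1) * (n * p) ^ (m + 2) \<le> ((t + 1) * (n * p)) ^ (m + 2)"
      unfolding power_mult_distrib[of "t + 1"] using np by (intro mult_right_mono) auto
    moreover have "0 \<le> mtr n (pw n (sm (\<lambda>_. p)) (Suc m))"
      unfolding mtr_def using p by (intro sum_nonneg pw_nonneg) (auto simp: sm_def)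
    ultimately show "t * (n * p) ^ (m + 2) - ((t + 1) * (n * p)) ^ (m + 2) + (n * p / sqrt (real 1)) ^ (m + 2)
        \<le> mtr n (pw n (sm (\<lambda>_. p)) (Suc m))"
      by (simp add: distrib_right[of t 1] del: pw.simps power_Suc)
  qed (use assms in auto)
  then show ?thesis using p by (simp add: rI_p)
qed

section \<open>Choice of the scales and conclusion\<close>

lemma mult_ln_inverse_le_one:
  fixes p :: real
  assumes "0 < p" "p < 1"
  shows "p * ln (1 / p) \<le> 1"
proof -
  have "p * ln (1 / p) \<le> p * (1 / p - 1)"
    using assms by (intro mult_left_mono ln_le_minus_one) auto
  also have "\<dots> \<le> 1" using assms by (simp add: algebra_simps)
  finally show ?thesis .
qed

text \<open>With radius \<open>g = n p / \<surd>L\<close>, where \<open>L = log (1/p)\<close>, the net is made of matrices of rank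
  \<open>O(L\<^sup>4)\<close>, so that its log-cardinality is \<open>O(n L\<^sup>4 log n)\<close>: this is where
  \<open>log\<^sup>4 n = o(n p\<^sup>2)\<close> is used in full.\<close>
lemma cover_at_scale:
  fixes p K L :: real
  defines "L \<equiv> ln (1 / p)" and "\<rho> \<equiv> 12 * sqrt K + 1"
  assumes p: "0 < p" "p < 1" and K: "0 < K" and L: "1 \<le> L" "L \<le> ln n"
    and np2: "486 * L ^ 2 \<le> n * p\<^sup>2" "\<rho> ^ 4 * L ^ 4 \<le> n * p\<^sup>2" "1 \<le> n * p\<^sup>2" "ln n ^ 4 \<le> n * p\<^sup>2"
    and n: "(12 * sqrt K + 6)\<^sup>2 \<le> real n" "4 * sqrt K + 3 \<le> n"
  shows "\<exists>N. finite N \<and> real (card N) \<le> exp (12 * (\<rho> * L) ^ 4 * (n * ln n)) \<and>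
    bprob p (index_pairs n) {S. \<forall>A\<in>N. n * p / sqrt L < s4 n (sm (bern S) - A)}
      \<le> 2 * exp (- (K * (real n ^ 2 * p\<^sup>2 * L)))"
proof -
  \<comment> \<open>The radius is split into thirds for the bulk, the truncated rank and the
    rounding. \<open>s\<close> solves s^2 / 16 = K v_n, \<open>r\<close> makes s / r at most g / 3,
    and m = g / 3 satisfies \<open>bulk_decomposition\<close> because 486 = 6 * 3^4.\<close>
  define g where "g = n * p / sqrt L"
  define s where "s = 4 * sqrt K * (n * p * sqrt L)"
  define r where "r = nat \<lceil>12 * sqrt K * L\<rceil>"
  define Q where "Q = n ^ 5"
  define h where "h = 1 / real n ^ 3"
  define m where "m = g / 3"
  have sK: "0 < sqrt K" using K by simp
  have n3: "3 \<le> real n" using n sK by linarith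
  have n0: "0 < real n" using n3 by linarith
  have n1: "1 \<le> real n" using n3 by linarith
  have L0: "0 < L" "0 < sqrt L" "sqrt L * sqrt L = L" using L by auto
  have np: "1 \<le> n * p"
  proof -
    have "n * p\<^sup>2 \<le> n * p" using p n0 by (simp add: power2_eq_square mult_left_le)
    then show ?thesis using np2 by linarith
  qed
  have g0: "0 < g" using np L0 by (simp add: g_def)
  have m4: "6 * real n ^ 3 * p\<^sup>2 \<le> m ^ 4"
  proof -
    have "(sqrt L) ^ 4 = L ^ 2" using L0 by (simp add: power2_eq_square eval_nat_numeral)
    then have "m ^ 4 = (real n ^ 3 * p\<^sup>2) * (n * p\<^sup>2) / (81 * L ^ 2)"
      by (simp add: m_def g_def power_divide power_mult_distrib eval_nat_numeral)
    also have "\<dots> \<ge> (real n ^ 3 * p\<^sup>2) * (486 * L ^ 2) / (81 * L ^ 2)"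
      using np2(1) L0 by (intro divide_right_mono mult_left_mono) auto
    finally show ?thesis using L0 by (simp add: mult_ac)
  qed
  have s0: "0 \<le> s" using p by (simp add: s_def L0 less_imp_le K)
  have s_le: "s \<le> 4 * sqrt K * n"
  proof -
    have "sqrt L \<le> L" using L by (simp add: sqrt_le_D real_sqrt_le_iff real_le_lsqrt power2_eq_square)
    then have "p * sqrt L \<le> p * L" using p by (intro mult_left_mono) auto
    also have "\<dots> \<le> 1" using mult_ln_inverse_le_one[OF p] by (simp add: L_def)
    finally have "n * (p * sqrt L) \<le> real n * 1" using n0 by (intro mult_left_mono) auto
    then show ?thesis using sK by (simp add: s_def mult.assoc)
  qed
  have r_ge: "12 * sqrt K * L \<le> r" unfolding r_def by linarith
  have "0 < 12 * sqrt K * L" using sK L0 by simp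
  then have r0: "0 < r" using r_ge by (metis less_le_trans of_nat_0_less_iff)
  have r_le: "real r \<le> \<rho> * L"
  proof -
    have "real r \<le> 12 * sqrt K * L + 1" using \<open>0 < 12 * sqrt K * L\<close> unfolding r_def by linarith
    also have "\<dots> \<le> 12 * sqrt K * L + 1 * L" using L by simp
    finally show ?thesis by (simp add: \<rho>_def distrib_right)
  qed
  have r4: "real r ^ 4 \<le> (\<rho> * L) ^ 4" using r_le by (intro power_mono) auto
  have r4n: "real r ^ 4 \<le> n"
  proof -
    have "n * p\<^sup>2 \<le> real n * 1" using p n0 by (intro mult_left_mono power_le_one) auto
    then show ?thesis using r4 np2(2) unfolding power_mult_distrib by linarith
  qed
  have sr: "s / r \<le> g / 3"
  proof -
    have "3 * s \<le> r * g"
    proof -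
      have "3 * s = (12 * sqrt K * L) * (n * p / sqrt L)"
        using L0 by (simp add: s_def field_simps)
      also have "\<dots> \<le> r * (n * p / sqrt L)"
        using r_ge np L0 by (intro mult_right_mono) auto
      finally show ?thesis by (simp add: g_def)
    qed
    then show ?thesis using r0 by (simp add: field_simps)
  qed
  have g_ge: "12 * sqrt K + 6 \<le> g"
  proof (rule power2_le_imp_le)
    have "L \<le> ln n ^ 4"
    proof -
      have "L \<le> ln n ^ 1" using L by simp
      also have "\<dots> \<le> ln n ^ 4" using L by (intro power_increasing) auto
      finally show ?thesis .
    qed
    then have "L \<le> n * p\<^sup>2" using np2(4) by linarith
    then have "n * L \<le> n * (n * p\<^sup>2)" using n0 by (intro mult_left_mono) auto
    then have "real n \<le> g\<^sup>2"
      using L0 by (simp add: g_def power_divide power_mult_distrib power2_eq_square field_simps)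
    then show "(12 * sqrt K + 6)\<^sup>2 \<le> g\<^sup>2" using n by linarith
  qed (use g0 in simp)
  \<comment> \<open>As r^4 <= n and s = O(n), the mesh n^(-3) leaves an error of constant order,
    whereas \<open>g\<close> is at least sqrt n.\<close>
  have rnd: "n * (real r ^ 4 * (h * (s + 2))) \<le> g / 3"
  proof -
    have "n * (real r ^ 4 * (h * (s + 2))) \<le> n * (n * (h * (4 * sqrt K * n + 2 * n)))"
      using r4n s_le s0 n1 n0 by (intro mult_left_mono mult_mono mult_nonneg_nonneg add_mono) (auto simp: h_def)
    also have "\<dots> = 4 * sqrt K + 2"
      using n0 by (simp add: h_def field_simps power3_eq_cube)
    finally show ?thesis using g_ge by simp
  qed
  have Q1: "s / h + 1 \<le> real Q"
  proof -
    have "s / h + 1 \<le> (4 * sqrt K * n) * real n ^ 3 + real n ^ 4"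
      using s_le n1 n0 by (intro add_mono) (auto simp: h_def one_le_power intro!: mult_right_mono)
    also have "\<dots> = (4 * sqrt K + 1) * real n ^ 4" by (simp add: algebra_simps eval_nat_numeral)
    also have "\<dots> \<le> n * real n ^ 4" using n n0 by (intro mult_right_mono) auto
    finally show ?thesis by (simp add: Q_def eval_nat_numeral)
  qed
  have Q2: "1 / h + 1 \<le> real Q"
  proof -
    have "1 / h + 1 \<le> real n ^ 3 + real n ^ 3" using n1 n0 by (auto simp: h_def one_le_power)
    also have "\<dots> = 2 * real n ^ 3" by simp
    also have "\<dots> \<le> (real n * real n) * real n ^ 3"
    proof (rule mult_right_mono)
      have "3 * 3 \<le> real n * real n" using n3 by (intro mult_mono) auto
      then show "2 \<le> real n * real n" by linarith
    qed (use n0 in auto)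
    finally show ?thesis by (simp add: Q_def eval_nat_numeral)
  qed
  have h: "0 < h" "h \<le> 1" using n1 n0 by (auto simp: h_def one_le_power)
  have "m + (s / real r + n * (real r ^ 4 * (h * (s + 2)))) \<le> g"
    using sr rnd unfolding m_def by linarith
  then obtain N where N: "finite N" "card N \<le> (2 * Q + 1) ^ (2 * r ^ 4 * n)"
    "bprob p (index_pairs n) {S. \<forall>A\<in>N. g < s4 n (sm (bern S) - A)} \<le> 2 * exp (- s\<^sup>2 / 16)"
    using s4_cover[OF p np m4 _ s0 r0 h Q1 Q2] g0 by (auto simp: m_def)
  have "s\<^sup>2 / 16 = K * (real n ^ 2 * p\<^sup>2 * L)"
    using K L0 by (simp add: s_def power_mult_distrib)
  moreover have "real (card N) \<le> exp (12 * (\<rho> * L) ^ 4 * (n * ln n))"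
  proof -
    have "real (2 * Q + 1) \<le> real n ^ 6"
    proof -
      have "real (2 * Q + 1) \<le> 3 * real n ^ 5" using n1 by (simp add: Q_def one_le_power)
      also have "\<dots> \<le> n * real n ^ 5" using n3 n0 by (intro mult_right_mono) auto
      finally show ?thesis by (simp add: eval_nat_numeral)
    qed
    also have "\<dots> = exp (6 * ln n)" using n0 by (simp add: exp_of_nat_mult[of 6, simplified])
    finally have Qe: "real (2 * Q + 1) \<le> exp (6 * ln n)" .
    have "real (card N) \<le> real (2 * Q + 1) ^ (2 * r ^ 4 * n)"
      using N(2) by (metis of_nat_le_iff of_nat_power)
    also have "\<dots> \<le> exp (6 * ln n) ^ (2 * r ^ 4 * n)"
      by (intro power_mono Qe) auto
    also have "\<dots> = exp (12 * real r ^ 4 * (n * ln n))"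
      by (simp add: exp_of_nat_mult[symmetric] mult_ac)
    also have "\<dots> \<le> exp (12 * (\<rho> * L) ^ 4 * (n * ln n))"
      using r4 n1 by (intro iffD2[OF exp_le_cancel_iff] mult_right_mono mult_left_mono) auto
    finally show ?thesis .
  qed
  ultimately show ?thesis using N(1,3) by (auto simp: g_def)
qed

text \<open>Here d = k + 2. \<open>K\<close> exceeds the constant of \<open>phi_upper\<close>, so
  truncating at K v is harmless. The planted gain (\<gamma> n p)^d = 32 \<alpha> (n p)^d is 2
  \<open>err\<close>: one half pays for \<open>err\<close>, the other for the block, by the size of
  \<open>B\<close>. \<open>err\<close> is split evenly between continuity of the trace and the cubic
  remainder 8 a. The budget \<eta> v splits into \<eta> / 2 for \<open>phi\<close>, \<eta> / 8 for
  the net and 3 \<eta> / 8 for numerical factors.\<close>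

lemma trace_tail_at_scale:
  fixes p t \<eta> L v K c \<gamma> \<alpha> \<rho> :: real and n k B :: nat
  defines "L \<equiv> ln (1 / p)" and "v \<equiv> real n ^ 2 * p\<^sup>2 * ln (1 / p)" and "K \<equiv> 4 * (t + 1)\<^sup>2 + 1"
  defines "c \<equiv> sqrt (8 * K + 162)" and "\<gamma> \<equiv> sqrt (\<eta> / 8)" and "\<rho> \<equiv> 12 * sqrt K + 1"
  defines "\<alpha> \<equiv> \<gamma> ^ (k + 2) / 32"
  assumes p: "0 < p" "p < 1" and t: "1 \<le> t" and \<eta>: "0 < \<eta>" and k: "1 \<le> k"
    and small: "2 * (t + 1) * p \<le> 1" "2 * \<gamma> * real B * p \<le> 1"
    and B: "0 < B" "(2 * c / \<gamma>)\<^sup>2 \<le> real B"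
    and np: "3 \<le> n * p" "3 \<le> \<gamma> * (n * p)"
    and L: "1 \<le> L" "L \<le> ln n"
    and np2: "486 * L ^ 2 \<le> n * p\<^sup>2" "\<rho> ^ 4 * L ^ 4 \<le> n * p\<^sup>2" "1 \<le> n * p\<^sup>2" "ln n ^ 4 \<le> n * p\<^sup>2"
      "96 * \<rho> ^ 4 * (L ^ 3 * ln n) \<le> \<eta> * (n * p\<^sup>2)"
    and n: "(12 * sqrt K + 6)\<^sup>2 \<le> real n" "4 * sqrt K + 3 \<le> n" "16 \<le> 3 * \<eta> * n"
    and large: "(real k + 5) * (c + 2) ^ (k + 1) \<le> 4 * \<alpha> * sqrt L" "16 * (c + 1) \<le> \<alpha> * L"
      "128 * (K + 1) \<le> \<alpha>\<^sup>2 * L"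
  shows "\<exists>F. phi (k + 2) n p t = ereal F \<and>
    bprob p (index_pairs n) {S. t * (n * p) ^ (k + 2) \<le> mtr n (pw n (sm (bern S)) (Suc k))} \<le> exp (- F + \<eta> * v)"
proof -
  define g where "g = n * p / sqrt L"
  define q where "q = exp (- (K * v))"
  define a where "a = \<alpha> * (n * p) ^ (k + 2)"
  define err where "err = 16 * \<alpha> * (n * p) ^ (k + 2)"
  define T where "T = t * (n * p) ^ (k + 2)"
  have K0: "0 < K" by (simp add: K_def add_nonneg_pos)
  have c0: "0 < c" using K0 by (simp add: c_def)
  have \<gamma>0: "0 < \<gamma>" using \<eta> by (simp add: \<gamma>_def)
  have \<alpha>0: "0 < \<alpha>" using \<gamma>0 by (simp add: \<alpha>_def)
  have L0: "0 < L" "1 \<le> sqrt L" using L by auto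
  have np0: "0 < n * p" using np by linarith
  have n0: "0 < real n" using np0 p by (simp add: zero_less_mult_iff)
  have v_eq: "v = n * (n * p\<^sup>2) * L" by (simp add: v_def L_def power2_eq_square)
  have vn: "n \<le> v"
  proof -
    have "real n * 1 * 1 \<le> n * (n * p\<^sup>2) * L" using np2(3) L n0 by (intro mult_mono) auto
    then show ?thesis by (simp add: v_eq)
  qed
  have phi_ub: "phi (k + 2) n p t \<le> ereal (4 * (t + 1)\<^sup>2 * v)"
    unfolding v_def by (rule phi_upper[OF p t small(1) np(1)])
  then obtain F where F: "phi (k + 2) n p t = ereal F"
    using phi_nonneg[OF p, of "k + 2" n t] by (cases "phi (k + 2) n p t") auto
  have F_le: "F \<le> K * v"
  proof -
    have "F \<le> 4 * (t + 1)\<^sup>2 * v" using phi_ub unfolding F by simp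
    also have "\<dots> \<le> K * v" using vn n0 by (simp add: K_def distrib_right)
    finally show ?thesis .
  qed
  define R where "R = F - \<eta> / 2 * v"
  have cont: "R \<le> (\<Sum>e\<in>index_pairs n. rI p (x e))"
    if x: "\<And>e. 0 \<le> x e \<and> x e \<le> 1" and low: "(\<Sum>e\<in>index_pairs n. rI p (x e)) \<le> K * (real n ^ 2 * p\<^sup>2 * ln (1 / p))"
      and tr: "T - err \<le> mtr n (pw n (sm x) (Suc k))" for x
  proof -
    have "phi (k + 2) n p t \<le> ereal ((\<Sum>e\<in>index_pairs n. rI p (x e)) + 4 * \<gamma>\<^sup>2 * (real n ^ 2 * p\<^sup>2 * ln (1 / p)))"
    proof (rule phi_perturb[OF p x B(1) small(2) np(2)])
      show "fro n (sm x) \<le> c * (n * p)"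
        unfolding c_def by (rule fro_le_of_rate[OF p x low]) (use K0 in simp)
      have "2 * c / \<gamma> \<le> sqrt B" using B(2) by (rule real_le_rsqrt)
      then have "2 * c \<le> \<gamma> * sqrt B" using \<gamma>0 by (simp add: field_simps)
      then have "(2 * c) * (n * p / (2 * sqrt B)) \<le> (\<gamma> * sqrt B) * (n * p / (2 * sqrt B))"
        using np0 by (intro mult_right_mono) auto
      moreover have "(2 * c) * (n * p / (2 * sqrt B)) = c * (n * p) / sqrt B"
        "(\<gamma> * sqrt B) * (n * p / (2 * sqrt B)) = \<gamma> * (n * p) / 2"
        using B(1) by simp_all
      ultimately have "c * (n * p) / sqrt B \<le> \<gamma> * (n * p) / 2" by linarith
      then have "(c * (n * p) / sqrt B) ^ (k + 2) \<le> (\<gamma> * (n * p) / 2) ^ (k + 2)"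
        using c0 np0 by (intro power_mono) auto
      also have "\<dots> = (\<gamma> * (n * p)) ^ (k + 2) / 2 ^ (k + 2)" by (rule power_divide)
      also have "\<dots> \<le> (\<gamma> * (n * p)) ^ (k + 2) / 2 ^ 1"
        using \<gamma>0 np0 by (intro divide_left_mono power_increasing) auto
      also have "\<dots> = err" by (simp add: err_def \<alpha>_def power_mult_distrib)
      finally have "(c * (n * p) / sqrt B) ^ (k + 2) \<le> err" .
      moreover have "(\<gamma> * (n * p)) ^ (k + 2) = 2 * err" by (simp add: err_def \<alpha>_def power_mult_distrib)
      ultimately show "t * (n * p) ^ (k + 2) - (\<gamma> * (n * p)) ^ (k + 2) + (c * (n * p) / sqrt B) ^ (k + 2)
          \<le> mtr n (pw n (sm x) (Suc k))"
        using tr unfolding T_def by linarith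
    qed
    then have "F \<le> (\<Sum>e\<in>index_pairs n. rI p (x e)) + 4 * \<gamma>\<^sup>2 * v"
      unfolding F ereal_less_eq v_def .
    moreover have "4 * \<gamma>\<^sup>2 * v = \<eta> / 2 * v" using \<eta> by (simp add: \<gamma>_def)
    ultimately show ?thesis unfolding R_def by linarith
  qed
  have g0: "0 < g" using np0 L0 by (simp add: g_def)
  have g_le: "g \<le> n * p"
  proof -
    have "n * p / sqrt L \<le> n * p / 1" using L0 np0 by (intro divide_left_mono) auto
    then show ?thesis by (simp add: g_def)
  qed
  have err_le: "(real (Suc k) + 4) * (c * (n * p) + 2 * g) ^ Suc k * (2 * g) + 8 * a \<le> err"
  proof -
    have "(c * (n * p) + 2 * g) ^ Suc k \<le> ((c + 2) * (n * p)) ^ Suc k"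
      using g_le g0 c0 np0 by (intro power_mono) (auto simp: distrib_right)
    then have "(real (Suc k) + 4) * (c * (n * p) + 2 * g) ^ Suc k * (2 * g)
        \<le> (real k + 5) * ((c + 2) * (n * p)) ^ Suc k * (2 * g)"
      using g0 by (intro mult_right_mono mult_mono) (auto simp: c0 less_imp_le g0 np0)
    also have "\<dots> = ((real k + 5) * (c + 2) ^ (k + 1)) * (2 * (n * p) ^ (k + 2) / sqrt L)"
      by (simp add: g_def power_mult_distrib mult_ac)
    also have "\<dots> \<le> (4 * \<alpha> * sqrt L) * (2 * (n * p) ^ (k + 2) / sqrt L)"
      using large(1) L0 np0 by (intro mult_right_mono) auto
    also have "\<dots> = 8 * \<alpha> * (n * p) ^ (k + 2)" using L0 by simp
    finally show ?thesis by (simp add: a_def err_def)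
  qed
  have g2: "g\<^sup>2 = (n * p)\<^sup>2 / L" using L0 by (simp add: g_def power_divide)
  have cub1: "4 * ((c + 1) * (n * p)) * (2 * g)\<^sup>2 \<le> a" if "Suc k = 2"
  proof -
    have k1: "k = 1" using that by simp
    have "4 * ((c + 1) * (n * p)) * (2 * g)\<^sup>2 = (16 * (c + 1)) * ((n * p) ^ 3 / L)"
      unfolding power_mult_distrib[of 2 g] g2 by (simp add: power2_eq_square power3_eq_cube)
    also have "\<dots> \<le> (\<alpha> * L) * ((n * p) ^ 3 / L)"
      using large(2) L0 np0 by (intro mult_right_mono) auto
    also have "\<dots> = a" using L0 by (simp add: a_def k1 power3_eq_cube mult.assoc)
    finally show ?thesis .
  qed
  \<comment> \<open>The exponent equals \<alpha>^2 L v / 128, above v by a factor of order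
    \<open>L\<close>. It exceeds K v + v, and the extra v absorbs the 2^n cuts because n <=
    v.\<close>
  have cub2: "2 ^ n * exp (- a\<^sup>2 / (8 * (2 * g) ^ 4)) \<le> q" if "Suc k = 2"
  proof -
    have k1: "k = 1" using that by simp
    have "(2 * g) ^ 4 = 16 * (g\<^sup>2)\<^sup>2" by (simp add: power_mult_distrib)
    also have "\<dots> = 16 * (n * p) ^ 4 / L\<^sup>2" by (simp add: g2 power_divide)
    finally have g4: "(2 * g) ^ 4 = 16 * (n * p) ^ 4 / L\<^sup>2" .
    define X where "X = n * p"
    have "a\<^sup>2 = \<alpha>\<^sup>2 * X\<^sup>2 * X ^ 4"
      by (simp add: a_def k1 X_def[symmetric] power_mult_distrib eval_nat_numeral mult.assoc)
    moreover have "0 < X" using np0 by (simp add: X_def)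
    ultimately have "a\<^sup>2 / (8 * (2 * g) ^ 4) = \<alpha>\<^sup>2 * L * (X\<^sup>2 * L) / 128"
      unfolding g4 X_def[symmetric] using L0 by (simp add: power2_eq_square)
    then have "a\<^sup>2 / (8 * (2 * g) ^ 4) = \<alpha>\<^sup>2 * L * ((n * p)\<^sup>2 * L) / 128"
      by (simp only: X_def)
    also have "\<dots> \<ge> 128 * (K + 1) * ((n * p)\<^sup>2 * L) / 128"
      using large(3) L0 by (intro divide_right_mono mult_right_mono) auto
    also have "128 * (K + 1) * ((n * p)\<^sup>2 * L) / 128 = K * v + v"
      by (simp add: v_def L_def power_mult_distrib algebra_simps)
    finally have ge: "K * v + n \<le> a\<^sup>2 / (8 * (2 * g) ^ 4)" using vn by linarith
    have "(2 :: real) ^ n \<le> exp 1 ^ n"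
      using exp_ge_add_one_self[of 1] by (intro power_mono) auto
    also have "\<dots> = exp n" by (simp add: exp_of_nat_mult[symmetric])
    finally have "2 ^ n * exp (- a\<^sup>2 / (8 * (2 * g) ^ 4)) \<le> exp n * exp (- a\<^sup>2 / (8 * (2 * g) ^ 4))"
      by (intro mult_right_mono) auto
    also have "\<dots> = exp (n - a\<^sup>2 / (8 * (2 * g) ^ 4))" by (simp flip: exp_add)
    also have "\<dots> \<le> q" unfolding q_def using ge by simp
    finally show ?thesis .
  qed
  obtain N where N: "finite N" "real (card N) \<le> exp (12 * (\<rho> * L) ^ 4 * (n * ln n))"
    "bprob p (index_pairs n) {S. \<forall>A\<in>N. g < s4 n (sm (bern S) - A)} \<le> 2 * q"
    using cover_at_scale[OF p K0 L[unfolded L_def] np2(1,2,3,4)[unfolded L_def \<rho>_def] n(1,2)]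
    unfolding L_def[symmetric] \<rho>_def[symmetric] g_def q_def v_def by blast
  define W where "W = exp (\<eta> / 8 * v)"
  have N_le: "real (card N) \<le> W"
  proof -
    have "12 * (\<rho> * L) ^ 4 * (n * ln n) = (96 * \<rho> ^ 4 * (L ^ 3 * ln n)) * (n * L) / 8"
      by (simp add: power_mult_distrib eval_nat_numeral)
    also have "\<dots> \<le> (\<eta> * (n * p\<^sup>2)) * (n * L) / 8"
      using np2(5) L0 n0 by (intro divide_right_mono mult_right_mono) auto
    also have "\<dots> = \<eta> / 8 * v" by (simp add: v_eq)
    finally have "exp (12 * (\<rho> * L) ^ 4 * (n * ln n)) \<le> W" by (simp add: W_def)
    then show ?thesis using N(2) by linarith
  qed
  have \<eta>v: "2 \<le> 3 * \<eta> / 8 * v"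
  proof -
    have "3 * \<eta> * n \<le> 3 * \<eta> * v" using vn \<eta> by (intro mult_left_mono) auto
    then show ?thesis using n(3) by simp
  qed
  have W1: "1 \<le> W" using vn n0 \<eta> by (simp add: W_def)
  have qR: "q \<le> exp (- R)"
  proof -
    have "R \<le> F" using vn n0 \<eta> by (simp add: R_def)
    then show ?thesis using F_le by (simp add: q_def)
  qed
  have "bprob p (index_pairs n) {S. T \<le> mtr n (pw n (sm (bern S)) (Suc k))} \<le> 2 * q + card N * (q + exp (- R))"
    by (rule bprob_trace_le[where K = K and g = g and a = a and c = c and err = err])
      (use p K0 k g0 err_le cub1 cub2 cont N \<alpha>0 np0 in \<open>auto simp: a_def c_def q_def v_def simp del: pw.simps power_Suc\<close>)
  also have "\<dots> \<le> 2 * exp (- R) + card N * (exp (- R) + exp (- R))"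
    using qR by (intro add_mono mult_left_mono) auto
  also have "\<dots> = (2 + 2 * real (card N)) * exp (- R)" by (simp add: algebra_simps)
  also have "\<dots> \<le> (4 * W) * exp (- R)" using N_le W1 by (intro mult_right_mono) auto
  also have "\<dots> \<le> (exp (3 * \<eta> / 8 * v) * W) * exp (- R)"
  proof -
    have "1 + 2 + 2\<^sup>2 / 2 \<le> exp (2 :: real)" by (rule exp_lower_Taylor_quadratic) simp
    moreover have "exp 2 \<le> exp (3 * \<eta> / 8 * v)" using \<eta>v by simp
    moreover have "(1 :: real) + 2 + 2\<^sup>2 / 2 = 5" by simp
    ultimately have "4 \<le> exp (3 * \<eta> / 8 * v)" by linarith
    then show ?thesis using W1 by (intro mult_right_mono) auto
  qed
  also have "\<dots> = exp (- F + \<eta> * v)"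
    by (simp add: W_def R_def flip: exp_add)
  finally show ?thesis using F by (simp add: T_def)
qed

theorem proposition1p19:
  fixes d :: nat
    and p :: "nat \<Rightarrow> real"
    and t :: real
    and M :: "nat \<Rightarrow> 'a measure"
    and X :: "nat \<Rightarrow> 'a \<Rightarrow> real mat"
  assumes "d \<ge> 3"
    and "\<And>n. 0 < p n \<and> p n < 1"
    and "p \<in> o(\<lambda>_. 1)"
    and "(\<lambda>n. ln (real n) ^ 4) \<in> o(\<lambda>n. real n * p n ^ 2)"
    and "\<And>n. erdos_renyi_adjacency (M n) n (p n) (X n)"
    and "t \<ge> 1"
  shows "\<exists>e :: nat \<Rightarrow> real.
    e \<in> o(\<lambda>n. real n ^ 2 * p n ^ 2 * ln (1 / p n)) \<and>
    (\<forall>\<^sub>F n in sequentially.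
       log_prob (measure (M n)
         {\<omega> \<in> space (M n). mat_trace (X n \<omega> ^\<^sub>m d) \<ge> t * real n ^ d * p n ^ d})
       \<le> - phi d n (p n) t + ereal (e n))"
proof -
  define k where "k = d - 2"
  have d: "d = k + 2" and k: "1 \<le> k" using assms(1) by (auto simp: k_def)
  have d': "d = Suc (Suc k)" using d by simp
  define v where "v n = real n ^ 2 * p n ^ 2 * ln (1 / p n)" for n
  define P where "P n = measure (M n)
    {\<omega> \<in> space (M n). mat_trace (X n \<omega> ^\<^sub>m d) \<ge> t * real n ^ d * p n ^ d}" for n
  define K where "K = 4 * (t + 1)\<^sup>2 + 1"
  define c where "c = sqrt (8 * K + 162)"
  define \<rho> where "\<rho> = 12 * sqrt K + 1"
  have p: "0 < p n" "p n < 1" for n using assms(2)[of n] by auto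
  have v0: "0 \<le> v n" for n using p[of n] by (simp add: v_def)
  have small: "\<forall>\<^sub>F n in sequentially. p n \<le> b" if "0 < b" for b
    using landau_o.smallD[OF assms(3) that] p by (auto elim!: eventually_mono simp: less_imp_le)
  have Lge: "\<forall>\<^sub>F n in sequentially. b \<le> ln (1 / p n)" for b
    using small[OF exp_gt_zero, of "- b"]
  proof eventually_elim
    case (elim n)
    have "ln (p n) \<le> ln (exp (- b))" using elim p by (intro ln_mono) auto
    then show ?case using p[of n] by (simp add: ln_div)
  qed
  have large: "\<forall>\<^sub>F n in sequentially. b * ln (real n) ^ 4 \<le> real n * p n ^ 2" if "0 < b" for b
    using landau_o.smallD[OF assms(4), of "1 / b"] that
    by (auto elim!: eventually_mono simp: field_simps)
  have nge: "\<forall>\<^sub>F n in sequentially. b \<le> real n" for b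
    by (rule eventually_sequentiallyI[of "nat \<lceil>b\<rceil>"]) linarith
  have lnge: "\<forall>\<^sub>F n in sequentially. b \<le> ln (real n)" for b
    using nge[of "exp b"] by eventually_elim (metis exp_gt_zero ln_exp ln_mono)
  \<comment> \<open>For fixed \<eta> every hypothesis of \<open>trace_tail_at_scale\<close> holds
    eventually; the o(v_n) term is extracted from this afterwards.\<close>
  have key: "\<forall>\<^sub>F n in sequentially. \<exists>F. phi d n (p n) t = ereal F \<and> P n \<le> exp (- F + \<eta> * v n)"
    if \<eta>: "0 < \<eta>" for \<eta>
  proof -
    define \<gamma> where "\<gamma> = sqrt (\<eta> / 8)"
    define \<alpha> where "\<alpha> = \<gamma> ^ (k + 2) / 32"
    define B where "B = nat \<lceil>(2 * c / \<gamma>)\<^sup>2\<rceil> + 1"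
    have K0: "0 < K" by (simp add: K_def add_nonneg_pos)
    have \<gamma>0: "0 < \<gamma>" using \<eta> by (simp add: \<gamma>_def)
    have \<alpha>0: "0 < \<alpha>" using \<gamma>0 by (simp add: \<alpha>_def)
    have \<rho>0: "0 < \<rho>" using K0 by (simp add: \<rho>_def add_nonneg_pos)
    have B0: "0 < B" "(2 * c / \<gamma>)\<^sup>2 \<le> real B"
      unfolding B_def by (simp, linarith)
    have t0: "0 < 2 * (t + 1)" using assms(6) by simp
    have gB: "0 < 2 * \<gamma> * real B" using \<gamma>0 B0 by simp
    have ev_p: "\<forall>\<^sub>F n in sequentially. p n \<le> 1 / (2 * (t + 1))"
      "\<forall>\<^sub>F n in sequentially. p n \<le> 1 / (2 * \<gamma> * real B)"
      using t0 gB by (intro small; simp)+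
    \<comment> \<open>Since L <= log n eventually, all lower bounds on n p^2 follow from constant
      multiples of log^4 n.\<close>
    have ev_np2: "\<forall>\<^sub>F n in sequentially. 486 * ln (real n) ^ 4 \<le> real n * p n ^ 2"
      "\<forall>\<^sub>F n in sequentially. \<rho> ^ 4 * ln (real n) ^ 4 \<le> real n * p n ^ 2"
      "\<forall>\<^sub>F n in sequentially. 1 * ln (real n) ^ 4 \<le> real n * p n ^ 2"
      "\<forall>\<^sub>F n in sequentially. 96 * \<rho> ^ 4 / \<eta> * ln (real n) ^ 4 \<le> real n * p n ^ 2"
      using \<rho>0 \<eta> by (intro large; simp)+
    show ?thesis
      using ev_p ev_np2 lnge[of "max 3 (3 / \<gamma>)"]
        nge[of "(12 * sqrt K + 6)\<^sup>2"] nge[of "4 * sqrt K + 3"] nge[of "16 / (3 * \<eta>)"] nge[of 2]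
        Lge[of 1] Lge[of "((real k + 5) * (c + 2) ^ (k + 1) / (4 * \<alpha>))\<^sup>2"]
        Lge[of "16 * (c + 1) / \<alpha>"] Lge[of "128 * (K + 1) / \<alpha>\<^sup>2"]
    proof eventually_elim
      case (elim n)
      define l where "l = ln (real n)"
      define L where "L = ln (1 / p n)"
      have l: "3 \<le> l" "3 / \<gamma> \<le> l" using elim(7) by (auto simp: l_def)
      have np2: "486 * l ^ 4 \<le> n * p n ^ 2" "\<rho> ^ 4 * l ^ 4 \<le> n * p n ^ 2" "l ^ 4 \<le> n * p n ^ 2"
        "96 * \<rho> ^ 4 / \<eta> * l ^ 4 \<le> n * p n ^ 2"
        using elim(3-6) by (auto simp: l_def)
      have L1: "1 \<le> L" using elim(12) by (simp add: L_def)
      have l4: "l \<le> l ^ 4" using l by (intro self_le_power) auto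
      have "n * p n ^ 2 \<le> n * p n"
        using p[of n] by (intro mult_left_mono) (auto simp: power2_eq_square)
      then have l_np: "l \<le> n * p n" using l4 np2(3) by linarith
      \<comment> \<open>n p^2 >= 1 means (1 / p)^2 <= n, so \<open>L\<close> is at most half of log
        n.\<close>
      have Ll: "L \<le> l"
      proof -
        have "1 \<le> n * p n ^ 2" using l l4 np2(3) by linarith
        then have "(1 / p n) ^ 2 \<le> n" using p[of n] by (simp add: power_divide field_simps)
        then have "ln ((1 / p n) ^ 2) \<le> l" unfolding l_def using p[of n] by (intro ln_mono) auto
        then have "2 * L \<le> l" using p[of n] by (simp add: ln_realpow L_def)
        then show ?thesis using L1 by linarith
      qed
      have L_pow: "L ^ 2 \<le> l ^ 4" "L ^ 4 \<le> l ^ 4" "L ^ 3 * l \<le> l ^ 4"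
      proof -
        have "L ^ 2 \<le> l ^ 2" using Ll L1 by (intro power_mono) auto
        also have "\<dots> \<le> l ^ 4" using l by (intro power_increasing) auto
        finally show "L ^ 2 \<le> l ^ 4" .
        show "L ^ 4 \<le> l ^ 4" using Ll L1 by (intro power_mono) auto
        have "L ^ 3 * l \<le> l ^ 3 * l" using Ll L1 l by (intro mult_right_mono power_mono) auto
        then show "L ^ 3 * l \<le> l ^ 4" by (simp add: eval_nat_numeral)
      qed
      note tail = trace_tail_at_scale[where p = "p n" and t = t and \<eta> = \<eta> and k = k and B = B and n = n,
          folded K_def \<gamma>_def, folded c_def \<rho>_def \<alpha>_def v_def L_def l_def]
      have "\<exists>F. phi (k + 2) n (p n) t = ereal F \<and>
          bprob (p n) (index_pairs n) {S. t * (n * p n) ^ (k + 2) \<le> mtr n (pw n (sm (bern S)) (Suc k))}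
          \<le> exp (- F + \<eta> * v n)"
      proof (rule tail)
        show "2 * (t + 1) * p n \<le> 1" using elim(1) t0 by (simp add: field_simps)
        show "2 * \<gamma> * real B * p n \<le> 1" using elim(2) gB by (simp add: field_simps)
        show "3 \<le> n * p n" using l l_np by linarith
        have "\<gamma> * (3 / \<gamma>) \<le> \<gamma> * (n * p n)"
          using l l_np \<gamma>0 by (intro mult_left_mono) auto
        then show "3 \<le> \<gamma> * (n * p n)" using \<gamma>0 by simp
        show "486 * L ^ 2 \<le> n * p n ^ 2" using np2(1) L_pow(1) by linarith
        have "\<rho> ^ 4 * L ^ 4 \<le> \<rho> ^ 4 * l ^ 4" using L_pow(2) by (intro mult_left_mono) auto
        then show "\<rho> ^ 4 * L ^ 4 \<le> n * p n ^ 2" using np2(2) by linarith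
        show "1 \<le> n * p n ^ 2" using l l4 np2(3) by linarith
        have "96 * \<rho> ^ 4 * (L ^ 3 * l) \<le> 96 * \<rho> ^ 4 * l ^ 4" using L_pow(3) by (intro mult_left_mono) auto
        also have "\<dots> \<le> \<eta> * (n * p n ^ 2)" using np2(4) \<eta> by (simp add: field_simps)
        finally show "96 * \<rho> ^ 4 * (L ^ 3 * l) \<le> \<eta> * (n * p n ^ 2)" .
        show "16 \<le> 3 * \<eta> * n" using elim(10) \<eta> by (simp add: field_simps)
        have "(real k + 5) * (c + 2) ^ (k + 1) / (4 * \<alpha>) \<le> sqrt L"
          using elim(13) by (intro real_le_rsqrt) (simp add: L_def)
        then show "(real k + 5) * (c + 2) ^ (k + 1) \<le> 4 * \<alpha> * sqrt L"
          using \<alpha>0 by (simp add: pos_divide_le_eq mult.commute)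
        show "16 * (c + 1) \<le> \<alpha> * L"
          using elim(14) \<alpha>0 by (simp add: L_def pos_divide_le_eq mult.commute)
        show "128 * (K + 1) \<le> \<alpha>\<^sup>2 * L"
          using elim(15) \<alpha>0 by (simp add: L_def pos_divide_le_eq mult.commute)
      qed (use p assms(6) \<eta> k B0 L1 Ll np2(3) elim(8,9) in auto)
      then obtain F where F: "phi (k + 2) n (p n) t = ereal F"
        "bprob (p n) (index_pairs n) {S. t * (n * p n) ^ (k + 2) \<le> mtr n (pw n (sm (bern S)) (Suc k))}
          \<le> exp (- F + \<eta> * v n)"
        by blast
      have "P n \<le> bprob (p n) (index_pairs n) {S. t * real n ^ d * p n ^ d \<le> mtr n (pw n (sm (bern S)) (Suc k))}"
        unfolding P_def using erdos_renyi_measure_le[OF assms(5) p, of n _ "Suc k"] elim(11)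
        by (simp only: d' of_nat_le_iff of_nat_numeral)
      also have "t * real n ^ d * p n ^ d = t * (n * p n) ^ (k + 2)"
        by (simp only: d power_mult_distrib mult.assoc)
      finally show ?case using F unfolding d by (intro exI[of _ F]) linarith
    qed
  qed
  define F where "F n = real_of_ereal (phi d n (p n) t)" for n
  \<comment> \<open>The smallest nonnegative error that works; \<open>key\<close> for every \<eta>
    makes it o(v_n). Probability 0 is set apart because \<open>ln\<close> carries no meaning
    there.\<close>
  define e where "e n = (if P n = 0 then 0 else max 0 (ln (P n) + F n))" for n
  have P0: "0 \<le> P n" for n by (simp add: P_def)
  have "e \<in> o(v)"
  proof (rule landau_o.smallI)
    fix \<eta> :: real assume "0 < \<eta>"
    from key[OF this] show "\<forall>\<^sub>F n in sequentially. norm (e n) \<le> \<eta> * norm (v n)"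
    proof eventually_elim
      case (elim n)
      then obtain F' where F': "phi d n (p n) t = ereal F'" "P n \<le> exp (- F' + \<eta> * v n)" by blast
      have "0 \<le> \<eta> * v n" using v0 \<open>0 < \<eta>\<close> by simp
      moreover have "ln (P n) + F n \<le> \<eta> * v n" if "P n \<noteq> 0"
      proof -
        have "ln (P n) \<le> ln (exp (- F' + \<eta> * v n))"
          using that P0[of n] F'(2) by (intro ln_mono) auto
        then show ?thesis by (simp add: F_def F'(1))
      qed
      ultimately show ?case using v0[of n] by (simp add: e_def)
    qed
  qed
  moreover have "\<forall>\<^sub>F n in sequentially. log_prob (P n) \<le> - phi d n (p n) t + ereal (e n)"
    \<comment> \<open>Any \<eta> serves here: it supplies the eventual finiteness of
      \<open>phi\<close>, after which the inequality holds by the choice of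
      \<open>e\<close>.\<close>
    using key[of 1, simplified]
  proof eventually_elim
    case (elim n)
    then obtain F' where F': "phi d n (p n) t = ereal F'" by blast
    show ?case
      by (auto simp: log_prob_def e_def F_def F')
  qed
  ultimately show ?thesis unfolding v_def P_def by blast
qed

end
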